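(* Let $(\gamma,\nu):I\to\mathbb{R}^2\times S^1$ be a Legendre curve with curvature $(\ell,\beta)$, $\gamma(u)=(x(u),z(u))$, $\nu(u)=(a(u),b(u))$, let $u_0\in I$ with $x(u_0)=0$, let $\lambda\neq0$ be a constant and $r(u,v)=(x(u)\cos v,x(u)\sin v,z(u)+\lambda v)$. Then: (I) If $\beta(u_0)=0$, $x(u_0)=0$, $b(u_0)\neq0$, then for any $v$, $r$ is a $5/2$-cuspidal edge at $(u_0,v)$ if and only if $\dot\beta(u_0)\ell(u_0)\neq0$. In this case (i.e. under these hypotheses), $r$ at $(u_0,v)$ is never a cuspidal edge, a $4/3$-cuspidal edge nor a $5/3$-cuspidal edge. (II) If $\beta(u_0)\neq0$, $(x(u_0),b(u_0))=(0,0)$, then for any $v$, $r$ is a $3/2$-cuspidal edge at $(u_0,v)$ if and only if $\ell(u_0)\neq0$, and $r$ is a $4/3$-cuspidal edge at $(u_0,v)$ if and only if $\ell(u_0)=0$ and $\dot\ell(u_0)\neq0$. In this case, $r$ at $(u_0,v)$ is never a $5/2$-cuspidal edge nor a $5/3$-cuspidal edge. (III) If $\beta(u_0)=0$, $(x(u_0),b(u_0))=(0,0)$, then for any $v$, $r$ is a $5/3$-cuspidal edge at $(u_0,v)$ if and only if $\dot\beta(u_0)\ell(u_0)\neq0$. In this case, $r$ at $(u_0,v)$ is never a cuspidal edge, a $5/2$-cuspidal edge nor a $4/3$-cuspidal edge.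
   Context: A Legendre curve is a smooth $(\gamma,\nu):I\to\mathbb{R}^2\times S^1$ with $\dot\gamma\cdot\nu=0$; with $\mu=J\nu$ ($J$ anticlockwise rotation by $\pi/2$), its curvature is $(\ell,\beta)$ with $\ell=\dot\nu\cdot\mu$, $\beta=\dot\gamma\cdot\mu$; so $\dot x=-\beta b$, $\dot z=\beta a$, $\dot a=-\ell b$, $\dot b=\ell a$. Two map-germs $f:(\mathbb{R}^m,p)\to(\mathbb{R}^n,f(p))$, $g:(\mathbb{R}^m,q)\to(\mathbb{R}^n,g(q))$ are $\mathcal{A}$-equivalent if there are diffeomorphism-germs $\varphi:(\mathbb{R}^m,p)\to(\mathbb{R}^m,q)$ and $\Phi:(\mathbb{R}^n,f(p))\to(\mathbb{R}^n,g(q))$ with $g\circ\varphi=\Phi\circ f$. For $(i,j)\in\{(2,3),(2,5),(3,4),(3,5)\}$, a surface germ $f$ at a point is a $j/i$-cuspidal edge if it is $\mathcal{A}$-equivalent to $(u,v)\mapsto(u,v^i,v^j)$ at the origin; a $3/2$-cuspidal edge is also called a cuspidal edge. *)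

theory Defs
  imports "HOL-Analysis.Analysis"
begin

text \<open>C-infinity smoothness on an open set S: all iterated (Frechet/directional)
  derivatives exist. D ds x is the iterated derivative of f at x applied to the
  directions in the list ds; D [] agrees with f on S.\<close>
definition smooth_on :: "'a::euclidean_space set \<Rightarrow> ('a \<Rightarrow> 'b::real_normed_vector) \<Rightarrow> bool" where
  "smooth_on S f \<longleftrightarrow> open S \<and>
     (\<exists>D :: 'a list \<Rightarrow> 'a \<Rightarrow> 'b. (\<forall>x\<in>S. D [] x = f x) \<and>
        (\<forall>ds. \<forall>x\<in>S. (D ds has_derivative (\<lambda>w. D (w # ds) x)) (at x)))"

definition diffeo_on :: "'a::euclidean_space set \<Rightarrow> ('a \<Rightarrow> 'a) \<Rightarrow> bool" where
  "diffeo_on U \<phi> \<longleftrightarrow> open U \<and> smooth_on U \<phi> \<and> inj_on \<phi> U \<and> open (\<phi> ` U) \<and>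
     smooth_on (\<phi> ` U) (inv_into U \<phi>)"

definition A_equiv :: "('a::euclidean_space \<Rightarrow> 'b::euclidean_space) \<Rightarrow> 'a \<Rightarrow> ('a \<Rightarrow> 'b) \<Rightarrow> 'a \<Rightarrow> bool" where
  "A_equiv f p g q \<longleftrightarrow>
     (\<exists>U V \<phi> \<Phi>. p \<in> U \<and> f p \<in> V \<and> diffeo_on U \<phi> \<and> diffeo_on V \<Phi> \<and>
        \<phi> p = q \<and> \<Phi> (f p) = g q \<and> (\<forall>w\<in>U. f w \<in> V \<and> g (\<phi> w) = \<Phi> (f w)))"

definition cusp_edge :: "nat \<Rightarrow> nat \<Rightarrow> (real \<times> real \<Rightarrow> real \<times> real \<times> real) \<Rightarrow> real \<times> real \<Rightarrow> bool" where
  "cusp_edge i j f p \<longleftrightarrow> A_equiv f p (\<lambda>(u, v). (u, v ^ i, v ^ j)) (0, 0)"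

definition legendre_curve :: "real set \<Rightarrow> (real \<Rightarrow> real) \<Rightarrow> (real \<Rightarrow> real) \<Rightarrow> (real \<Rightarrow> real) \<Rightarrow> (real \<Rightarrow> real) \<Rightarrow> bool" where
  "legendre_curve I x z a b \<longleftrightarrow> open I \<and> is_interval I \<and> I \<noteq> {} \<and>
     smooth_on I x \<and> smooth_on I z \<and> smooth_on I a \<and> smooth_on I b \<and>
     (\<forall>u\<in>I. (a u)\<^sup>2 + (b u)\<^sup>2 = 1) \<and>
     (\<forall>u\<in>I. deriv x u * a u + deriv z u * b u = 0)"

text \<open>Curvature: mu = J nu = (-b, a), ell = nu' . mu, beta = gamma' . mu.\<close>
definition leg_ell :: "(real \<Rightarrow> real) \<Rightarrow> (real \<Rightarrow> real) \<Rightarrow> real \<Rightarrow> real" where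
  "leg_ell a b u = deriv a u * (- b u) + deriv b u * a u"

definition leg_beta :: "(real \<Rightarrow> real) \<Rightarrow> (real \<Rightarrow> real) \<Rightarrow> (real \<Rightarrow> real) \<Rightarrow> (real \<Rightarrow> real) \<Rightarrow> real \<Rightarrow> real" where
  "leg_beta x z a b u = deriv x u * (- b u) + deriv z u * a u"

end

theory Submission
  imports Defs "HOL-Library.Landau_Symbols"
begin

text \<open>Use \<open>w = z + \<lambda> v\<close> instead of \<open>v\<close> as a source coordinate and undo the rotation by \<open>w / \<lambda>\<close> in the
  target: the helicoidal surface becomes the cylinder over the plane curve with polar coordinates
  \<open>x (u)\<close> and \<open>(z (u) - z (u0)) / \<lambda>\<close>.

  Sufficiency of the conditions is the normal form \<open>(t ^ i, t ^ j)\<close> of plane curves. It is reached by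
  taking a root of the first coordinate as parameter, and then writing the second coordinate as
  \<open>A (t ^ i) + t ^ j B (t ^ i) + t ^ (2 j) C (t ^ i)\<close>; Borel's lemma provides smooth \<open>A\<close>, \<open>B\<close>, \<open>C\<close> up to a
  flat error, which is absorbed.

  For necessity, the set of vanishing orders at the singular point of smooth functions restricted to
  the curve is an invariant of the \<open>\<A>\<close>-class of the cylinder. It contains \<open>i\<close> and \<open>j\<close> and omits the gaps
  of the semigroup generated by them.\<close>

section \<open>Smooth maps and A-equivalence\<close>

text \<open>With \<open>\<xi> t = x (t + u0)\<close> and
  \<open>\<zeta> t = (z (t + u0) - z u0) / lam\<close> the plane curve is
  \<open>\<xi> cos \<zeta>\<close>, \<open>\<xi> sin \<zeta>\<close>. If \<open>\<xi>\<close> and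
  \<open>\<zeta>\<close> vanish to orders p and m \<ge> 1, its coordinates vanish to orders p and p
  + m. In all three cases \<open>beta * b\<close> is 0 at \<open>u0\<close>, hence p \<ge> 2. In
  (II) m = 1, which leads to the exponents (2, 3) and (3, 4); in (III) a nonzero cubic coefficient
  of \<open>\<xi>\<close> forces m = 2, hence (3, 5). In (I), when p = 2, the quartic term of the
  second coordinate is a multiple of the square of the first; once that multiple is subtracted, the
  coefficient of \<open>t ^ 5\<close> is a minor of the quadratic and cubic Taylor coefficients,
  equal to \<open>(deriv beta)\<^sup>2 * ell / (6 * lam)\<close>. So the conditions of the theorem
  say that leading coefficients are nonzero. The obstacle is that the data are only smooth: finitely
  many coefficients decide the type only after the flat remainders have been written through
  \<open>t ^ i\<close>. For i = 2 an odd flat function is not a function of \<open>t ^ 2\<close>; it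
  becomes one after division by an odd power of \<open>t\<close>.\<close>

lemma smooth_on_imp_open: "smooth_on S f \<Longrightarrow> open S"
  by (simp add: smooth_on_def)

section \<open>Closure properties of smooth maps\<close>

text \<open>A class of functions closed under directional derivatives consists of smooth functions:
  choosing one derivative for each member and folding the choice along a list of directions produces
  the family \<open>D\<close> of the definition. Each closure property below reduces to finding such
  a class.\<close>

lemma smooth_on_coinduct:
  fixes f :: "'a::euclidean_space \<Rightarrow> 'b::real_normed_vector"
  assumes S: "open S" and f: "P f"
    and step: "\<And>g. P g \<Longrightarrow> \<exists>g'. (\<forall>x\<in>S. (g has_derivative g' x) (at x)) \<and> (\<forall>w. P (\<lambda>x. g' x w))"
  shows "smooth_on S f"
proof -
  obtain d where d: "\<And>g x. P g \<Longrightarrow> x \<in> S \<Longrightarrow> (g has_derivative d g x) (at x)"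
    "\<And>g w. P g \<Longrightarrow> P (\<lambda>x. d g x w)"
    using step by metis
  define D where "D = (\<lambda>ds. foldr (\<lambda>w g x. d g x w) ds f)"
  have P: "P (D ds)" for ds
    by (induction ds) (auto simp: D_def f d(2))
  have "(D ds has_derivative (\<lambda>w. D (w # ds) x)) (at x)" if "x \<in> S" for ds x
    using d(1)[OF P that, of ds] by (simp add: D_def)
  then show ?thesis
    unfolding smooth_on_def using S by (intro conjI exI[of _ D]) (auto simp: D_def)
qed

lemma smooth_onE:
  assumes "smooth_on S f"
  obtains f' where "\<And>x. x \<in> S \<Longrightarrow> (f has_derivative f' x) (at x)"
    and "\<And>w. smooth_on S (\<lambda>x. f' x w)"
proof -
  obtain D where S: "open S" and D0: "\<And>x. x \<in> S \<Longrightarrow> D [] x = f x"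
    and D: "\<And>ds x. x \<in> S \<Longrightarrow> (D ds has_derivative (\<lambda>w. D (w # ds) x)) (at x)"
    using assms unfolding smooth_on_def by auto
  have 1: "(f has_derivative (\<lambda>w. D [w] x)) (at x)" if "x \<in> S" for x
    by (rule has_derivative_transform_within_open[OF D[OF that] S that D0])
  \<comment> \<open>Directions are consed at the front, so the direction taken first stands last in
    the list; appending \<open>[w]\<close> shifts the whole family by one derivative.\<close>
  have 2: "smooth_on S (\<lambda>x. D [w] x)" for w
    unfolding smooth_on_def
    by (intro conjI S exI[of _ "\<lambda>ds. D (ds @ [w])"]) (auto intro: D)
  show ?thesis using that[OF 1 2] .
qed

lemma smooth_on_cong:
  assumes "smooth_on S f" and "\<And>x. x \<in> S \<Longrightarrow> g x = f x"
  shows "smooth_on S g"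
  using assms unfolding smooth_on_def by auto

lemma smooth_on_subset:
  assumes "smooth_on S f" and "open T" and "T \<subseteq> S"
  shows "smooth_on T f"
  using assms unfolding smooth_on_def by blast

lemma smooth_on_imp_continuous_on: "smooth_on S f \<Longrightarrow> continuous_on S f"
  by (elim smooth_onE) (meson continuous_at_imp_continuous_on has_derivative_continuous)

lemma smooth_on_const: "open S \<Longrightarrow> smooth_on S (\<lambda>x. c)"
  by (rule smooth_on_coinduct[where P = "\<lambda>g. \<exists>c. g = (\<lambda>x. c)"]) (auto intro!: exI[of _ "\<lambda>x w. 0"])

lemma smooth_on_bounded_linear_comp:
  assumes L: "bounded_linear L" and f: "smooth_on S f"
  shows "smooth_on S (\<lambda>x. L (f x))"
proof (rule smooth_on_coinduct[where P = "\<lambda>g. \<exists>h. smooth_on S h \<and> g = (\<lambda>x. L (h x))"])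
  fix g assume "\<exists>h. smooth_on S h \<and> g = (\<lambda>x. L (h x))"
  then obtain h where h: "smooth_on S h" "g = (\<lambda>x. L (h x))" by blast
  obtain h' where h': "\<And>x. x \<in> S \<Longrightarrow> (h has_derivative h' x) (at x)" "\<And>w. smooth_on S (\<lambda>x. h' x w)"
    using smooth_onE[OF h(1)] by blast
  show "\<exists>g'. (\<forall>x\<in>S. (g has_derivative g' x) (at x)) \<and> (\<forall>w. \<exists>h. smooth_on S h \<and> (\<lambda>x. g' x w) = (\<lambda>x. L (h x)))"
    by (rule exI[of _ "\<lambda>x w. L (h' x w)"]) (auto simp: h(2) intro!: bounded_linear.has_derivative[OF L] h')
qed (use f smooth_on_imp_open in auto)

lemma smooth_on_add:
  assumes f: "smooth_on S f" and g: "smooth_on S g"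
  shows "smooth_on S (\<lambda>x. f x + g x)"
proof (rule smooth_on_coinduct[where P = "\<lambda>k. \<exists>f g. smooth_on S f \<and> smooth_on S g \<and> k = (\<lambda>x. f x + g x)"])
  fix k assume "\<exists>f g. smooth_on S f \<and> smooth_on S g \<and> k = (\<lambda>x. f x + g x)"
  then obtain f g where fg: "smooth_on S f" "smooth_on S g" "k = (\<lambda>x. f x + g x)" by blast
  obtain f' where f': "\<And>x. x \<in> S \<Longrightarrow> (f has_derivative f' x) (at x)" "\<And>w. smooth_on S (\<lambda>x. f' x w)"
    using smooth_onE[OF fg(1)] by blast
  obtain g' where g': "\<And>x. x \<in> S \<Longrightarrow> (g has_derivative g' x) (at x)" "\<And>w. smooth_on S (\<lambda>x. g' x w)"
    using smooth_onE[OF fg(2)] by blast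
  show "\<exists>k'. (\<forall>x\<in>S. (k has_derivative k' x) (at x)) \<and>
      (\<forall>w. \<exists>f g. smooth_on S f \<and> smooth_on S g \<and> (\<lambda>x. k' x w) = (\<lambda>x. f x + g x))"
  proof (intro exI[of _ "\<lambda>x w. f' x w + g' x w"] conjI ballI allI)
    show "(k has_derivative (\<lambda>w. f' x w + g' x w)) (at x)" if "x \<in> S" for x
      unfolding fg(3) using that by (intro has_derivative_add f' g')
  qed (use f' g' in blast)
qed (use f g smooth_on_imp_open in auto)

lemma smooth_on_Pair:
  assumes f: "smooth_on S f" and g: "smooth_on S g"
  shows "smooth_on S (\<lambda>x. (f x, g x))"
proof (rule smooth_on_coinduct[where P = "\<lambda>k. \<exists>f g. smooth_on S f \<and> smooth_on S g \<and> k = (\<lambda>x. (f x, g x))"])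
  fix k assume "\<exists>f g. smooth_on S f \<and> smooth_on S g \<and> k = (\<lambda>x. (f x, g x))"
  then obtain f g where fg: "smooth_on S f" "smooth_on S g" "k = (\<lambda>x. (f x, g x))" by blast
  obtain f' where f': "\<And>x. x \<in> S \<Longrightarrow> (f has_derivative f' x) (at x)" "\<And>w. smooth_on S (\<lambda>x. f' x w)"
    using smooth_onE[OF fg(1)] by blast
  obtain g' where g': "\<And>x. x \<in> S \<Longrightarrow> (g has_derivative g' x) (at x)" "\<And>w. smooth_on S (\<lambda>x. g' x w)"
    using smooth_onE[OF fg(2)] by blast
  show "\<exists>k'. (\<forall>x\<in>S. (k has_derivative k' x) (at x)) \<and>
      (\<forall>w. \<exists>f g. smooth_on S f \<and> smooth_on S g \<and> (\<lambda>x. k' x w) = (\<lambda>x. (f x, g x)))"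
  proof (intro exI[of _ "\<lambda>x w. (f' x w, g' x w)"] conjI ballI allI)
    show "(k has_derivative (\<lambda>w. (f' x w, g' x w))) (at x)" if "x \<in> S" for x
      unfolding fg(3) using that by (intro has_derivative_Pair f' g')
  qed (use f' g' in blast)
qed (use f g smooth_on_imp_open in auto)

text \<open>The product rule turns one product into a sum of two, so the single products are not
  closed under differentiation, but their finite sums are.\<close>

inductive bilinear_span :: "'a::euclidean_space set \<Rightarrow> ('b::real_normed_vector \<Rightarrow> 'c::real_normed_vector \<Rightarrow> 'd::real_normed_vector) \<Rightarrow> ('a \<Rightarrow> 'd) \<Rightarrow> bool"
  for S and B where
  base: "smooth_on S f \<Longrightarrow> smooth_on S g \<Longrightarrow> bilinear_span S B (\<lambda>x. B (f x) (g x))"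
| add: "bilinear_span S B h \<Longrightarrow> bilinear_span S B k \<Longrightarrow> bilinear_span S B (\<lambda>x. h x + k x)"

lemma smooth_on_bounded_bilinear:
  assumes B: "bounded_bilinear B" and f: "smooth_on S f" and g: "smooth_on S g"
  shows "smooth_on S (\<lambda>x. B (f x) (g x))"
proof (rule smooth_on_coinduct[where P = "bilinear_span S B"])
  fix k assume "bilinear_span S B k"
  then show "\<exists>k'. (\<forall>x\<in>S. (k has_derivative k' x) (at x)) \<and> (\<forall>w. bilinear_span S B (\<lambda>x. k' x w))"
  proof induction
    case (base f g)
    obtain f' where f': "\<And>x. x \<in> S \<Longrightarrow> (f has_derivative f' x) (at x)" "\<And>w. smooth_on S (\<lambda>x. f' x w)"
      using smooth_onE[OF base(1)] by blast
    obtain g' where g': "\<And>x. x \<in> S \<Longrightarrow> (g has_derivative g' x) (at x)" "\<And>w. smooth_on S (\<lambda>x. g' x w)"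
      using smooth_onE[OF base(2)] by blast
    show ?case
      by (rule exI[of _ "\<lambda>x w. B (f x) (g' x w) + B (f' x w) (g x)"])
        (auto intro!: bounded_bilinear.FDERIV[OF B] bilinear_span.intros f' g' base)
  next
    case (add h k)
    then obtain h' k' where "\<forall>x\<in>S. (h has_derivative h' x) (at x)" "\<forall>w. bilinear_span S B (\<lambda>x. h' x w)"
      "\<forall>x\<in>S. (k has_derivative k' x) (at x)" "\<forall>w. bilinear_span S B (\<lambda>x. k' x w)" by blast
    then show ?case
      by (intro exI[of _ "\<lambda>x w. h' x w + k' x w"]) (auto intro: bilinear_span.add has_derivative_add)
  qed
qed (use f g smooth_on_imp_open in \<open>auto intro: bilinear_span.base\<close>)

lemmas smooth_on_mult = smooth_on_bounded_bilinear[OF bounded_bilinear_mult]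

text \<open>By the chain rule a derivative of \<open>h o \<phi>\<close> is a sum of partial
  derivatives of \<open>h\<close> at \<open>\<phi> x\<close>, each multiplied by a smooth function
  on the source. The rules \<open>add\<close> and \<open>scale\<close> make the class closed under
  this.\<close>

inductive comp_span :: "'a::euclidean_space set \<Rightarrow> 'b::euclidean_space set \<Rightarrow> ('a \<Rightarrow> 'b) \<Rightarrow> ('a \<Rightarrow> 'c::real_normed_vector) \<Rightarrow> bool"
  for S T \<phi> where
  base: "smooth_on T h \<Longrightarrow> comp_span S T \<phi> (\<lambda>x. h (\<phi> x))"
| add: "comp_span S T \<phi> h \<Longrightarrow> comp_span S T \<phi> k \<Longrightarrow> comp_span S T \<phi> (\<lambda>x. h x + k x)"
| scale: "smooth_on S g \<Longrightarrow> comp_span S T \<phi> k \<Longrightarrow> comp_span S T \<phi> (\<lambda>x. g x *\<^sub>R k x)"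

lemma comp_span_sum:
  assumes "open T" and "\<And>i. i \<in> A \<Longrightarrow> comp_span S T \<phi> (f i)"
  shows "comp_span S T \<phi> (\<lambda>x. \<Sum>i\<in>A. f i x)"
  using assms(2)
proof (induction A rule: infinite_finite_induct)
qed (auto intro: comp_span.base[OF smooth_on_const[OF assms(1), of 0]] comp_span.add)

lemma smooth_on_compose:
  fixes h :: "'b::euclidean_space \<Rightarrow> 'c::real_normed_vector"
  assumes h: "smooth_on T h" and \<phi>: "smooth_on S \<phi>" and ST: "\<And>x. x \<in> S \<Longrightarrow> \<phi> x \<in> T"
  shows "smooth_on S (\<lambda>x. h (\<phi> x))"
proof (rule smooth_on_coinduct[where P = "comp_span S T \<phi>"])
  obtain \<phi>' where \<phi>': "\<And>x. x \<in> S \<Longrightarrow> (\<phi> has_derivative \<phi>' x) (at x)" "\<And>w. smooth_on S (\<lambda>x. \<phi>' x w)"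
    using smooth_onE[OF \<phi>] by blast
  fix k :: "'a \<Rightarrow> 'c" assume "comp_span S T \<phi> k"
  then show "\<exists>k'. (\<forall>x\<in>S. (k has_derivative k' x) (at x)) \<and> (\<forall>w. comp_span S T \<phi> (\<lambda>x. k' x w))"
  proof induction
    case (base h)
    obtain h' where h': "\<And>x. x \<in> T \<Longrightarrow> (h has_derivative h' x) (at x)" "\<And>w. smooth_on T (\<lambda>x. h' x w)"
      using smooth_onE[OF base] by blast
    \<comment> \<open>The direction \<open>\<phi>' x w\<close> varies with \<open>x\<close>, so
      \<open>h'\<close> in that direction is not of the form covered by \<open>base\<close>.
      Expanding in the basis moves the dependence into scalar factors.\<close>
    have lin: "h' y v = (\<Sum>b\<in>Basis. (v \<bullet> b) *\<^sub>R h' y b)" if "y \<in> T" for y v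
    proof -
      interpret bounded_linear "h' y" using h'(1)[OF that] has_derivative_bounded_linear by blast
      have "h' y v = h' y (\<Sum>b\<in>Basis. (v \<bullet> b) *\<^sub>R b)" by (simp add: euclidean_representation)
      then show ?thesis by (simp add: sum scaleR)
    qed
    have "((\<lambda>x. h (\<phi> x)) has_derivative (\<lambda>w. \<Sum>b\<in>Basis. (\<phi>' x w \<bullet> b) *\<^sub>R h' (\<phi> x) b)) (at x)" if "x \<in> S" for x
      by (rule has_derivative_eq_rhs[OF has_derivative_compose[OF \<phi>'(1)[OF that] h'(1)[OF ST[OF that]]] ext])
        (rule lin[OF ST[OF that]])
    moreover have "comp_span S T \<phi> (\<lambda>x. \<Sum>b\<in>Basis. (\<phi>' x w \<bullet> b) *\<^sub>R h' (\<phi> x) b)" for w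
    proof (rule comp_span_sum)
      fix b :: 'b
      have "smooth_on S (\<lambda>x. \<phi>' x w \<bullet> b)"
        using smooth_on_bounded_linear_comp[OF bounded_linear_inner_left \<phi>'(2)] .
      then show "comp_span S T \<phi> (\<lambda>x. (\<phi>' x w \<bullet> b) *\<^sub>R h' (\<phi> x) b)"
        by (intro comp_span.scale) (auto intro: comp_span.base h'(2))
    qed (use h smooth_on_imp_open in auto)
    ultimately show ?case
      by (intro exI[of _ "\<lambda>x w. \<Sum>b\<in>Basis. (\<phi>' x w \<bullet> b) *\<^sub>R h' (\<phi> x) b"]) simp
  next
    case (add h k)
    then obtain h' k' where "\<forall>x\<in>S. (h has_derivative h' x) (at x)" "\<forall>w. comp_span S T \<phi> (\<lambda>x. h' x w)"
      "\<forall>x\<in>S. (k has_derivative k' x) (at x)" "\<forall>w. comp_span S T \<phi> (\<lambda>x. k' x w)" by blast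
    then show ?case
      by (intro exI[of _ "\<lambda>x w. h' x w + k' x w"]) (auto intro: comp_span.add has_derivative_add)
  next
    case (scale g k)
    then obtain k' where k': "\<forall>x\<in>S. (k has_derivative k' x) (at x)" "\<forall>w. comp_span S T \<phi> (\<lambda>x. k' x w)" by blast
    obtain g' where g': "\<And>x. x \<in> S \<Longrightarrow> (g has_derivative g' x) (at x)" "\<And>w. smooth_on S (\<lambda>x. g' x w)"
      using smooth_onE[OF scale(1)] by blast
    show ?case
      by (rule exI[of _ "\<lambda>x w. g x *\<^sub>R k' x w + g' x w *\<^sub>R k x"])
        (use k' scale(1,2) g' in \<open>auto intro!: has_derivative_scaleR comp_span.add intro: comp_span.scale\<close>)
  qed
qed (use h \<phi> smooth_on_imp_open in \<open>auto intro: comp_span.base\<close>)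

lemma smooth_on_linear: "open S \<Longrightarrow> bounded_linear L \<Longrightarrow> smooth_on S L"
proof (rule smooth_on_coinduct[where P = "\<lambda>g. bounded_linear g \<or> (\<exists>c. g = (\<lambda>x. c))"], goal_cases)
  case (3 g)
  from 3(3) show ?case
  proof
    assume "bounded_linear g"
    then show ?thesis
      by (auto intro: bounded_linear_imp_has_derivative intro!: exI[of _ "\<lambda>x w. g w"])
  qed (auto intro!: exI[of _ "\<lambda>x w. 0"])
qed auto

lemma smooth_on_ident: "open S \<Longrightarrow> smooth_on S (\<lambda>x. x)"
  by (rule smooth_on_linear) (auto intro: bounded_linear_ident)

lemma smooth_on_fst: "smooth_on S f \<Longrightarrow> smooth_on S (\<lambda>x. fst (f x))"
  by (rule smooth_on_bounded_linear_comp[OF bounded_linear_fst])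

lemma smooth_on_snd: "smooth_on S f \<Longrightarrow> smooth_on S (\<lambda>x. snd (f x))"
  by (rule smooth_on_bounded_linear_comp[OF bounded_linear_snd])

lemma smooth_on_minus: "smooth_on S f \<Longrightarrow> smooth_on S (\<lambda>x. - f x)"
  by (rule smooth_on_bounded_linear_comp[OF bounded_linear_minus[OF bounded_linear_ident]])

lemma smooth_on_diff: "smooth_on S f \<Longrightarrow> smooth_on S g \<Longrightarrow> smooth_on S (\<lambda>x. f x - g x)"
  using smooth_on_add[OF _ smooth_on_minus, of S f g] by simp

lemma smooth_on_divide_const:
  fixes f :: "'a::euclidean_space \<Rightarrow> real"
  shows "smooth_on S f \<Longrightarrow> smooth_on S (\<lambda>x. f x / c)"
  by (rule smooth_on_bounded_linear_comp[OF bounded_linear_divide])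

lemma smooth_on_power:
  fixes f :: "'a::euclidean_space \<Rightarrow> real"
  shows "smooth_on S f \<Longrightarrow> smooth_on S (\<lambda>x. f x ^ n)"
  by (induction n) (auto intro: smooth_on_mult smooth_on_const dest: smooth_on_imp_open)

text \<open>On the line the derivative in direction \<open>w\<close> is \<open>w\<close> times the
  ordinary derivative, so a class closed under the ordinary derivative is enlarged by constant
  multiples and handed to the general principle.\<close>

lemma smooth_on_real_coinduct:
  fixes f :: "real \<Rightarrow> real"
  assumes S: "open S" and f: "P f"
    and step: "\<And>g. P g \<Longrightarrow> \<exists>g'. (\<forall>x\<in>S. (g has_real_derivative g' x) (at x)) \<and> P g'"
  shows "smooth_on S f"
proof (rule smooth_on_coinduct[where P = "\<lambda>g. \<exists>c h. P h \<and> g = (\<lambda>x. h x * c)"])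
  fix g assume "\<exists>c h. P h \<and> g = (\<lambda>x. h x * c)"
  then obtain c h where h: "P h" "g = (\<lambda>x. h x * c)" by blast
  obtain h' where h': "\<forall>x\<in>S. (h has_real_derivative h' x) (at x)" "P h'" using step[OF h(1)] by blast
  have "(g has_derivative (\<lambda>w. h' x * (w * c))) (at x)" if "x \<in> S" for x
    using h'(1) that unfolding h(2) has_field_derivative_def
    by (auto intro!: derivative_eq_intros simp: mult_ac)
  then show "\<exists>g'. (\<forall>x\<in>S. (g has_derivative g' x) (at x)) \<and> (\<forall>w. \<exists>c h. P h \<and> (\<lambda>x. g' x w) = (\<lambda>x. h x * c))"
    using h'(2) by (intro exI[of _ "\<lambda>x w. h' x * (w * c)"]) blast
qed (use S f in \<open>auto intro!: exI[of _ 1] exI[of _ f]\<close>)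

lemma smooth_on_realE:
  fixes f :: "real \<Rightarrow> real"
  assumes "smooth_on S f"
  obtains f' where "\<And>x. x \<in> S \<Longrightarrow> (f has_real_derivative f' x) (at x)" and "smooth_on S f'"
proof -
  obtain D where D: "\<And>x. x \<in> S \<Longrightarrow> (f has_derivative D x) (at x)" "\<And>w. smooth_on S (\<lambda>x. D x w)"
    using smooth_onE[OF assms] by blast
  have "(f has_real_derivative D x 1) (at x)" if "x \<in> S" for x
    using D(1)[OF that] by (rule has_derivative_imp_has_field_derivative)
      (metis D(1)[OF that] has_derivative_bounded_linear linear_simps(5) mult.commute mult.right_neutral real_scaleR_def)
  then show ?thesis using that[OF _ D(2)[of 1]] by simp
qed

lemma smooth_on_deriv:
  fixes f :: "real \<Rightarrow> real"
  assumes "smooth_on S f"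
  shows "smooth_on S (deriv f)" and "x \<in> S \<Longrightarrow> (f has_real_derivative deriv f x) (at x)"
proof -
  obtain f' where f': "\<And>x. x \<in> S \<Longrightarrow> (f has_real_derivative f' x) (at x)" "smooth_on S f'"
    using smooth_on_realE[OF assms] by blast
  then have eq: "\<And>x. x \<in> S \<Longrightarrow> deriv f x = f' x" by (simp add: DERIV_imp_deriv)
  show "smooth_on S (deriv f)" by (rule smooth_on_cong[OF f'(2) eq])
  show "x \<in> S \<Longrightarrow> (f has_real_derivative deriv f x) (at x)" using f'(1) eq by simp
qed

lemma smooth_on_sin: "smooth_on UNIV (sin :: real \<Rightarrow> real)"
  and smooth_on_cos: "smooth_on UNIV (cos :: real \<Rightarrow> real)"
proof -
  have "smooth_on UNIV (\<lambda>x::real. p * sin x + q * cos x)" for p q :: real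
  proof (rule smooth_on_real_coinduct[where P = "\<lambda>g. \<exists>p q. g = (\<lambda>x::real. p * sin x + q * cos x)"])
    fix g :: "real \<Rightarrow> real" assume "\<exists>p q. g = (\<lambda>x. p * sin x + q * cos x)"
    then obtain p q where g: "g = (\<lambda>x. p * sin x + q * cos x)" by blast
    show "\<exists>g'. (\<forall>x\<in>UNIV. (g has_real_derivative g' x) (at x)) \<and> (\<exists>p q. g' = (\<lambda>x. p * sin x + q * cos x))"
      by (intro exI[of _ "\<lambda>x. - q * sin x + p * cos x"] conjI ballI exI[of _ "-q"] exI[of _ p])
        (auto simp: g intro!: derivative_eq_intros)
  qed auto
  from this[of 1 0] this[of 0 1]
  show "smooth_on UNIV (sin :: real \<Rightarrow> real)" "smooth_on UNIV (cos :: real \<Rightarrow> real)" by simp_all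
qed

lemma smooth_on_powr: "smooth_on {0<..} (\<lambda>x::real. x powr a)"
proof (rule smooth_on_real_coinduct[where P = "\<lambda>g. \<exists>p a. g = (\<lambda>x. p * x powr a)"])
  fix g :: "real \<Rightarrow> real" assume "\<exists>p a. g = (\<lambda>x. p * x powr a)"
  then obtain p a where g: "g = (\<lambda>x. p * x powr a)" by blast
  show "\<exists>g'. (\<forall>x\<in>{0<..}. (g has_real_derivative g' x) (at x)) \<and> (\<exists>p a. g' = (\<lambda>x. p * x powr a))"
    by (intro exI[of _ "\<lambda>x. p * a * x powr (a - 1)"] conjI ballI exI[of _ "p * a"] exI[of _ "a - 1"])
      (auto simp: g intro!: derivative_eq_intros)
next
  show "\<exists>p b. (\<lambda>x. x powr a) = (\<lambda>x. p * x powr b)" by (rule exI[of _ 1], rule exI[of _ a]) simp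
qed simp

lemma smooth_on_powr_comp:
  fixes f :: "'a::euclidean_space \<Rightarrow> real"
  assumes "smooth_on S f" and "\<And>x. x \<in> S \<Longrightarrow> f x > 0"
  shows "smooth_on S (\<lambda>x. f x powr a)"
  using smooth_on_compose[OF smooth_on_powr assms(1)] assms(2) by auto

lemma smooth_on_divide:
  fixes f g :: "'a::euclidean_space \<Rightarrow> real"
  assumes "smooth_on S f" and "smooth_on S g" and "\<And>x. x \<in> S \<Longrightarrow> g x > 0"
  shows "smooth_on S (\<lambda>x. f x / g x)"
  by (rule smooth_on_cong[OF smooth_on_mult[OF assms(1) smooth_on_powr_comp[OF assms(2,3), of "-1"]]])
    (auto simp: powr_minus_divide dest: assms(3))

lemmas smooth_on_intros = smooth_on_const smooth_on_add smooth_on_diff smooth_on_minus smooth_on_mult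
  smooth_on_power smooth_on_Pair smooth_on_fst smooth_on_snd smooth_on_ident smooth_on_divide_const
  smooth_on_compose[OF smooth_on_sin] smooth_on_compose[OF smooth_on_cos]

section \<open>Diffeomorphisms, and A-equivalence as an equivalence relation\<close>

lemma diffeo_onI:
  assumes "open U" "open V" "smooth_on U \<phi>" "smooth_on V \<psi>"
    and "\<And>x. x \<in> U \<Longrightarrow> \<phi> x \<in> V \<and> \<psi> (\<phi> x) = x" and "\<And>y. y \<in> V \<Longrightarrow> \<psi> y \<in> U \<and> \<phi> (\<psi> y) = y"
  shows "diffeo_on U \<phi>"
proof -
  have inj: "inj_on \<phi> U" using assms(5) by (metis inj_onI)
  have im: "\<phi> ` U = V" using assms(5,6) by force
  have "smooth_on V (inv_into U \<phi>)"
    using assms(6) by (intro smooth_on_cong[OF assms(4)]) (metis inj inv_into_f_f)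
  then show ?thesis using assms inj im by (simp add: diffeo_on_def)
qed

lemma diffeo_on_subset:
  assumes "diffeo_on U \<phi>" and "open W" and "W \<subseteq> U"
  shows "diffeo_on W \<phi>"
proof -
  let ?\<psi> = "inv_into U \<phi>"
  have U: "open U" "smooth_on U \<phi>" "inj_on \<phi> U" "open (\<phi> ` U)" "smooth_on (\<phi> ` U) ?\<psi>"
    using assms(1) by (auto simp: diffeo_on_def)
  have eq: "\<phi> ` W = \<phi> ` U \<inter> ?\<psi> -` W"
    using assms(3) U(3) by (force simp: inv_into_f_f)
  have op: "open (\<phi> ` W)"
    unfolding eq using continuous_open_preimage[OF smooth_on_imp_continuous_on[OF U(5)] U(4) assms(2)] .
  show ?thesis
    by (rule diffeo_onI[OF assms(2) op smooth_on_subset[OF U(2) assms(2,3)] smooth_on_subset[OF U(5) op]])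
      (use assms(3) U(3) in \<open>auto simp: inv_into_f_f subset_iff\<close>)
qed

lemma diffeo_on_inverse:
  assumes "diffeo_on U \<phi>"
  shows "diffeo_on (\<phi> ` U) (inv_into U \<phi>)"
  using assms by (intro diffeo_onI[of _ U _ \<phi>]) (auto simp: diffeo_on_def inv_into_f_f inv_into_into)

lemma diffeo_on_compose:
  assumes "diffeo_on U \<phi>" and "diffeo_on V \<psi>" and "\<phi> ` U \<subseteq> V"
  shows "diffeo_on U (\<lambda>x. \<psi> (\<phi> x))"
proof -
  have U: "open U" "smooth_on U \<phi>" "inj_on \<phi> U" "open (\<phi> ` U)" "smooth_on (\<phi> ` U) (inv_into U \<phi>)"
    using assms(1) by (auto simp: diffeo_on_def)
  have "diffeo_on (\<phi> ` U) \<psi>" using diffeo_on_subset[OF assms(2) U(4) assms(3)] .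
  then have V: "smooth_on (\<phi> ` U) \<psi>" "inj_on \<psi> (\<phi> ` U)" "open (\<psi> ` \<phi> ` U)"
    "smooth_on (\<psi> ` \<phi> ` U) (inv_into (\<phi> ` U) \<psi>)"
    by (auto simp: diffeo_on_def)
  show ?thesis
  proof (rule diffeo_onI[OF U(1) V(3)])
    show "smooth_on U (\<lambda>x. \<psi> (\<phi> x))" by (rule smooth_on_compose[OF V(1) U(2)]) auto
    show "smooth_on (\<psi> ` \<phi> ` U) (\<lambda>y. inv_into U \<phi> (inv_into (\<phi> ` U) \<psi> y))"
      by (rule smooth_on_compose[OF U(5) V(4)]) (auto intro: inv_into_into)
  qed (use U(3) V(2) in \<open>auto simp: inv_into_f_f\<close>)
qed

lemma diffeo_on_continuous: "diffeo_on U \<phi> \<Longrightarrow> continuous_on U \<phi>"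
  by (simp add: diffeo_on_def smooth_on_imp_continuous_on)

lemma A_equiv_sym:
  assumes "A_equiv f p g q"
  shows "A_equiv g q f p"
proof -
  obtain U V \<phi> \<Phi> where *: "p \<in> U" "f p \<in> V" "diffeo_on U \<phi>" "diffeo_on V \<Phi>" "\<phi> p = q" "\<Phi> (f p) = g q"
    "\<And>w. w \<in> U \<Longrightarrow> f w \<in> V \<and> g (\<phi> w) = \<Phi> (f w)"
    using assms unfolding A_equiv_def by blast
  have inj: "inj_on \<phi> U" "inj_on \<Phi> V" using *(3,4) by (auto simp: diffeo_on_def)
  show ?thesis unfolding A_equiv_def
    by (rule exI[of _ "\<phi> ` U"], rule exI[of _ "\<Phi> ` V"], rule exI[of _ "inv_into U \<phi>"], rule exI[of _ "inv_into V \<Phi>"])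
      (use * inj diffeo_on_inverse[OF *(3)] diffeo_on_inverse[OF *(4)] in \<open>auto simp: inv_into_f_f inv_into_into\<close>)
qed

lemma A_equiv_trans:
  assumes "A_equiv f p g q" and "A_equiv g q h s"
  shows "A_equiv f p h s"
proof -
  obtain U V \<phi> \<Phi> where 1: "p \<in> U" "f p \<in> V" "diffeo_on U \<phi>" "diffeo_on V \<Phi>" "\<phi> p = q" "\<Phi> (f p) = g q"
    "\<And>w. w \<in> U \<Longrightarrow> f w \<in> V \<and> g (\<phi> w) = \<Phi> (f w)"
    using assms(1) unfolding A_equiv_def by blast
  obtain U' V' \<psi> \<Psi> where 2: "q \<in> U'" "g q \<in> V'" "diffeo_on U' \<psi>" "diffeo_on V' \<Psi>" "\<psi> q = s" "\<Psi> (g q) = h s"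
    "\<And>w. w \<in> U' \<Longrightarrow> g w \<in> V' \<and> h (\<psi> w) = \<Psi> (g w)"
    using assms(2) unfolding A_equiv_def by blast
  define W where "W = U \<inter> \<phi> -` U'"
  define X where "X = V \<inter> \<Phi> -` V'"
  have "open W" "open X" unfolding W_def X_def
    using 1(3,4) 2(3,4) by (auto intro!: continuous_open_preimage diffeo_on_continuous simp: diffeo_on_def)
  then have d: "diffeo_on W (\<lambda>x. \<psi> (\<phi> x))" "diffeo_on X (\<lambda>x. \<Psi> (\<Phi> x))"
    by (auto intro!: diffeo_on_compose[OF diffeo_on_subset[OF 1(3)] 2(3)]
        diffeo_on_compose[OF diffeo_on_subset[OF 1(4)] 2(4)] simp: W_def X_def)
  show ?thesis unfolding A_equiv_def
    by (rule exI[of _ W], rule exI[of _ X], rule exI[of _ "\<lambda>x. \<psi> (\<phi> x)"], rule exI[of _ "\<lambda>x. \<Psi> (\<Phi> x)"])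
      (use 1 2 d in \<open>auto simp: W_def X_def\<close>, metis+)
qed

section \<open>Taylor expansions, division and flat functions\<close>

lemma power_bigo_power:
  assumes "m \<le> n"
  shows "(\<lambda>s::real. s ^ n) \<in> O[at 0](\<lambda>s. s ^ m)"
proof (rule bigoI[of _ 1])
  have "eventually (\<lambda>s::real. s \<in> {-1<..<1}) (at 0)" by (rule eventually_at_in_open') auto
  then show "eventually (\<lambda>s::real. norm (s ^ n) \<le> 1 * norm (s ^ m)) (at 0)"
    by eventually_elim (use assms in \<open>auto simp: power_abs intro!: power_decreasing\<close>)
qed

lemma bigo_power_weaken:
  fixes f :: "real \<Rightarrow> real"
  shows "f \<in> O[at 0](\<lambda>s. s ^ n) \<Longrightarrow> m \<le> n \<Longrightarrow> f \<in> O[at 0](\<lambda>s. s ^ m)"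
  using power_bigo_power landau_o.big_trans by blast

lemma eventually_power_nonzero: "eventually (\<lambda>s::real. s ^ n \<noteq> 0) (at 0)"
  by (rule eventually_mono[OF eventually_neq_at_within[of 0]]) auto

lemma bigo_Suc_imp_tendsto_0:
  fixes f :: "real \<Rightarrow> real"
  assumes "f \<in> O[at 0](\<lambda>s. s ^ Suc n)"
  shows "((\<lambda>s. f s / s ^ n) \<longlongrightarrow> 0) (at 0)"
proof -
  have "(\<lambda>s::real. s * s ^ n) \<in> o[at 0](\<lambda>s. 1 * s ^ n)"
    by (intro landau_o.small.mult_right smalloI_tendsto) (auto intro!: tendsto_eq_intros)
  then have "f \<in> o[at 0](\<lambda>s. s ^ n)"
    using assms landau_o.big_small_trans by fastforce
  then show ?thesis by (rule smalloD_tendsto)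
qed

lemma monomial_bigo_imp_zero:
  assumes "(\<lambda>s::real. k * s ^ m) \<in> O[at 0](\<lambda>s. s ^ n)" and "m < n"
  shows "k = 0"
proof -
  have "(\<lambda>s::real. k * s ^ m) \<in> O[at 0](\<lambda>s. s ^ Suc m)"
    using assms by (intro bigo_power_weaken[OF assms(1)]) auto
  then have "((\<lambda>s::real. k * s ^ m / s ^ m) \<longlongrightarrow> 0) (at 0)" by (rule bigo_Suc_imp_tendsto_0)
  moreover have "((\<lambda>s::real. k * s ^ m / s ^ m) \<longlongrightarrow> k) (at 0)"
    by (rule tendsto_eventually) (auto simp: eventually_at_filter)
  ultimately show ?thesis by (metis LIM_unique)
qed

lemma bigtheta_power_not_bigo:
  fixes f :: "real \<Rightarrow> real"
  assumes "f \<in> \<Theta>[at 0](\<lambda>s. s ^ m)" and "f \<in> O[at 0](\<lambda>s. s ^ n)"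
  shows "n \<le> m"
proof (rule ccontr)
  assume "\<not> n \<le> m"
  moreover have "(\<lambda>s::real. 1 * s ^ m) \<in> O[at 0](\<lambda>s. s ^ n)"
    using assms by (metis (no_types, lifting) bigtheta_sym bigthetaD1 landau_o.big_trans mult_1 ext)
  ultimately show False using monomial_bigo_imp_zero[of 1 m n] by auto
qed

text \<open>By the mean value theorem \<open>f s\<close> is \<open>s\<close> times a value of
  \<open>f'\<close> at a point no farther from 0 than \<open>s\<close>, so the bound gains one
  power.\<close>

lemma bigo_antiderivative:
  fixes f :: "real \<Rightarrow> real"
  assumes S: "open S" "0 \<in> S" and f: "\<And>x. x \<in> S \<Longrightarrow> (f has_real_derivative f' x) (at x)"
    and "f 0 = 0" and f': "f' \<in> O[at 0](\<lambda>s. s ^ n)"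
  shows "f \<in> O[at 0](\<lambda>s. s ^ Suc n)"
proof -
  obtain C where C: "C > 0" "eventually (\<lambda>s. norm (f' s) \<le> C * norm (s ^ n)) (at 0)"
    using landau_o.bigE[OF f'] by blast
  have "eventually (\<lambda>s. s \<in> S) (at 0)" by (rule eventually_at_in_open'[OF S])
  with C(2) have "eventually (\<lambda>s. norm (f' s) \<le> C * norm (s ^ n) \<and> s \<in> S) (at 0)" by eventually_elim auto
  then obtain e where e: "e > 0" "\<And>s. s \<noteq> 0 \<Longrightarrow> dist s 0 < e \<Longrightarrow> norm (f' s) \<le> C * norm (s ^ n) \<and> s \<in> S"
    unfolding eventually_at by auto
  have bd: "norm (f s) \<le> C * norm (s ^ Suc n)" if s: "s \<noteq> 0" "dist s 0 < e" for s
  proof -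
    have seg: "closed_segment 0 s \<subseteq> S"
    proof
      fix t assume t: "t \<in> closed_segment 0 s"
      have "\<bar>t\<bar> \<le> \<bar>s\<bar>" using t by (auto simp: closed_segment_eq_real_ivl split: if_splits)
      then show "t \<in> S" using e(2)[of t] S s by (cases "t = 0") auto
    qed
    have bnd: "norm (f' t) \<le> C * norm (s ^ n)" if "t \<in> open_segment 0 s" for t
    proof -
      have "\<bar>t\<bar> \<le> \<bar>s\<bar>" "t \<noteq> 0" using that by (auto simp: open_segment_eq_real_ivl split: if_splits)
      then have "norm (f' t) \<le> C * norm (t ^ n)" "norm (t ^ n) \<le> norm (s ^ n)"
        using e(2)[of t] s by (auto simp: power_abs intro!: power_mono)
      then show ?thesis using C(1) by (meson dual_order.trans mult_left_mono less_imp_le)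
    qed
    have "\<exists>t\<in>open_segment 0 s. norm (f s - f 0) \<le> norm (s - 0) * norm (f' t)"
    proof (cases "s > 0")
      case True
      then have "\<exists>z>0. z < s \<and> f s - f 0 = (s - 0) * f' z"
        using seg by (intro MVT2) (auto intro!: f simp: closed_segment_eq_real_ivl)
      then show ?thesis using True by (auto simp: open_segment_eq_real_ivl abs_mult)
    next
      case False
      then have "\<exists>z>s. z < 0 \<and> f 0 - f s = (0 - s) * f' z"
        using s seg by (intro MVT2) (auto intro!: f simp: closed_segment_eq_real_ivl)
      then obtain z where "z > s" "z < 0" "f 0 - f s = (0 - s) * f' z" by blast
      then show ?thesis using False by (intro bexI[of _ z]) (auto simp: open_segment_eq_real_ivl abs_mult assms(4))
    qed
    then obtain t where t: "t \<in> open_segment 0 s" "norm (f s) \<le> norm s * norm (f' t)"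
      using assms(4) by auto
    have "norm s * norm (f' t) \<le> norm s * (C * norm (s ^ n))"
      by (intro mult_left_mono bnd t) auto
    with t(2) show ?thesis by (simp add: abs_mult mult_ac)
  qed
  show ?thesis
    by (rule bigoI[of _ C]) (use e(1) bd in \<open>auto simp: eventually_at\<close>)
qed

text \<open>An asymptotic, possibly divergent, power series. Flat functions are those with the
  expansion \<open>\<lambda>n. 0\<close>. The filter \<open>at 0\<close> is punctured, so the value
  \<open>f 0\<close> is not constrained here; for smooth functions continuity recovers it in
  \<open>expansion_at_0\<close>.\<close>

definition expansion :: "(real \<Rightarrow> real) \<Rightarrow> (nat \<Rightarrow> real) \<Rightarrow> bool" where
  "expansion f c \<longleftrightarrow> (\<forall>N. (\<lambda>s. f s - (\<Sum>n<N. c n * s ^ n)) \<in> O[at 0](\<lambda>s. s ^ N))"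

lemma expansionD: "expansion f c \<Longrightarrow> (\<lambda>s. f s - (\<Sum>n<N. c n * s ^ n)) \<in> O[at 0](\<lambda>s. s ^ N)"
  by (simp add: expansion_def)

lemma expansion_add: "expansion f c \<Longrightarrow> expansion g d \<Longrightarrow> expansion (\<lambda>s. f s + g s) (\<lambda>n. c n + d n)"
  unfolding expansion_def
proof
  fix N assume "\<forall>N. (\<lambda>s. f s - (\<Sum>n<N. c n * s ^ n)) \<in> O[at 0](\<lambda>s. s ^ N)"
    "\<forall>N. (\<lambda>s. g s - (\<Sum>n<N. d n * s ^ n)) \<in> O[at 0](\<lambda>s. s ^ N)"
  then have "(\<lambda>s. (f s - (\<Sum>n<N. c n * s ^ n)) + (g s - (\<Sum>n<N. d n * s ^ n))) \<in> O[at 0](\<lambda>s. s ^ N)"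
    by (intro sum_in_bigo(1)) auto
  then show "(\<lambda>s. f s + g s - (\<Sum>n<N. (c n + d n) * s ^ n)) \<in> O[at 0](\<lambda>s. s ^ N)"
    by (simp add: algebra_simps sum.distrib)
qed

lemma expansion_cmult: "expansion f c \<Longrightarrow> expansion (\<lambda>s. k * f s) (\<lambda>n. k * c n)"
  unfolding expansion_def
proof
  fix N assume "\<forall>N. (\<lambda>s. f s - (\<Sum>n<N. c n * s ^ n)) \<in> O[at 0](\<lambda>s. s ^ N)"
  then have "(\<lambda>s. k * (f s - (\<Sum>n<N. c n * s ^ n))) \<in> O[at 0](\<lambda>s. s ^ N)" by simp
  then show "(\<lambda>s. k * f s - (\<Sum>n<N. k * c n * s ^ n)) \<in> O[at 0](\<lambda>s. s ^ N)"
    by (simp add: algebra_simps sum_distrib_left)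
qed

lemma expansion_diff: "expansion f c \<Longrightarrow> expansion g d \<Longrightarrow> expansion (\<lambda>s. f s - g s) (\<lambda>n. c n - d n)"
  using expansion_add[OF _ expansion_cmult[of g d "-1"], of f c] by simp

text \<open>Terms of degree at least \<open>N\<close> are absorbed by the error, so each estimate
  may be checked with a longer partial sum. Shifts and substitutions naturally produce partial sums
  of another length than the requested one.\<close>

lemma expansionI_le:
  assumes "\<And>N. \<exists>M\<ge>N. (\<lambda>s. f s - (\<Sum>n<M. c n * s ^ n)) \<in> O[at 0](\<lambda>s. s ^ N)"
  shows "expansion f c"
  unfolding expansion_def
proof
  fix N
  obtain M where M: "M \<ge> N" "(\<lambda>s. f s - (\<Sum>n<M. c n * s ^ n)) \<in> O[at 0](\<lambda>s. s ^ N)"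
    using assms by blast
  have "(\<lambda>s::real. \<Sum>n\<in>{N..<M}. c n * s ^ n) \<in> O[at 0](\<lambda>s. s ^ N)"
    by (intro big_sum_in_bigo) (auto intro: power_bigo_power)
  then have "(\<lambda>s. (f s - (\<Sum>n<M. c n * s ^ n)) + (\<Sum>n\<in>{N..<M}. c n * s ^ n)) \<in> O[at 0](\<lambda>s. s ^ N)"
    using M(2) by (intro sum_in_bigo(1))
  moreover have "(\<Sum>n<M. c n * s ^ n) = (\<Sum>n<N. c n * s ^ n) + (\<Sum>n\<in>{N..<M}. c n * s ^ n)" for s :: real
    using M(1) by (simp add: sum.atLeastLessThan_concat flip: atLeast0LessThan)
  ultimately show "(\<lambda>s. f s - (\<Sum>n<N. c n * s ^ n)) \<in> O[at 0](\<lambda>s. s ^ N)" by simp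
qed

lemma expansion_const: "expansion (\<lambda>s. c) (\<lambda>n. if n = 0 then c else 0)"
proof (rule expansionI_le)
  fix N
  show "\<exists>M\<ge>N. (\<lambda>s. c - (\<Sum>n<M. (if n = 0 then c else 0) * s ^ n)) \<in> O[at 0](\<lambda>s. s ^ N)"
    by (rule exI[of _ "Suc N"]) (subst sum.lessThan_Suc_shift, simp)
qed

lemma expansion_power_mult:
  assumes "expansion f c"
  shows "expansion (\<lambda>s. s ^ k * f s) (\<lambda>n. if n < k then 0 else c (n - k))"
proof (rule expansionI_le)
  fix N
  have eq: "(\<Sum>n<N + k. (if n < k then 0 else c (n - k)) * s ^ n) = s ^ k * (\<Sum>n<N. c n * s ^ n)" for s :: real
  proof -
    have "(\<Sum>n<N + k. (if n < k then 0 else c (n - k)) * s ^ n) = (\<Sum>n\<in>{k..<N + k}. c (n - k) * s ^ n)"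
      by (rule sum.mono_neutral_cong_right) auto
    also have "\<dots> = (\<Sum>n<N. c n * s ^ (n + k))"
      by (rule sum.reindex_bij_witness[of _ "\<lambda>n. n + k" "\<lambda>n. n - k"]) auto
    finally show ?thesis by (simp add: sum_distrib_left power_add mult_ac)
  qed
  have "(\<lambda>s. s ^ k * (f s - (\<Sum>n<N. c n * s ^ n))) \<in> O[at 0](\<lambda>s. s ^ k * s ^ N)"
    using expansionD[OF assms] by (intro landau_o.big.mult) auto
  then have "(\<lambda>s. s ^ k * (f s - (\<Sum>n<N. c n * s ^ n))) \<in> O[at 0](\<lambda>s. s ^ N)"
    by (rule bigo_power_weaken[of _ "k + N", unfolded power_add]) auto
  then show "\<exists>M\<ge>N. (\<lambda>s. s ^ k * f s - (\<Sum>n<M. (if n < k then 0 else c (n - k)) * s ^ n)) \<in> O[at 0](\<lambda>s. s ^ N)"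
    by (intro exI[of _ "N + k"]) (simp add: eq right_diff_distrib)
qed

lemma expansion_subst_power:
  assumes "expansion f c" and i: "i > 0"
  shows "expansion (\<lambda>s. f (s ^ i)) (\<lambda>n. if i dvd n then c (n div i) else 0)"
proof (rule expansionI_le)
  fix N
  have eq: "(\<Sum>n<i * N. (if i dvd n then c (n div i) else 0) * s ^ n) = (\<Sum>n<N. c n * (s ^ i) ^ n)" for s :: real
  proof -
    have "(\<Sum>n<i * N. (if i dvd n then c (n div i) else 0) * s ^ n)
        = (\<Sum>n\<in>{n. n < i * N \<and> i dvd n}. c (n div i) * s ^ n)"
      by (rule sum.mono_neutral_cong_right) auto
    also have "\<dots> = (\<Sum>n<N. c n * s ^ (i * n))"
      by (rule sum.reindex_bij_witness[of _ "\<lambda>n. i * n" "\<lambda>n. n div i"]) (use i in auto)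
    finally show ?thesis by (simp add: power_mult)
  qed
  have "filterlim (\<lambda>s::real. s ^ i) (at 0) (at 0)"
    using i by (auto simp: filterlim_at eventually_at_filter intro!: tendsto_eq_intros)
  from landau_o.big.compose[OF expansionD[OF assms(1), of N] this]
  have "(\<lambda>s. f (s ^ i) - (\<Sum>n<N. c n * (s ^ i) ^ n)) \<in> O[at 0](\<lambda>s. s ^ (i * N))"
    by (simp add: power_mult)
  then have "(\<lambda>s. f (s ^ i) - (\<Sum>n<N. c n * (s ^ i) ^ n)) \<in> O[at 0](\<lambda>s. s ^ N)"
    by (rule bigo_power_weaken) (use i in simp)
  then show "\<exists>M\<ge>N. (\<lambda>s. f (s ^ i) - (\<Sum>n<M. (if i dvd n then c (n div i) else 0) * s ^ n)) \<in> O[at 0](\<lambda>s. s ^ N)"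
    by (intro exI[of _ "i * N"]) (use i in \<open>simp add: eq\<close>)
qed

lemma expansion_leading:
  assumes "expansion f c" and "\<And>n. n < k \<Longrightarrow> c n = 0"
  shows "((\<lambda>s. f s / s ^ k) \<longlongrightarrow> c k) (at 0)"
proof -
  have "(\<Sum>n<Suc k. c n * s ^ n) = c k * s ^ k" for s :: real using assms(2) by simp
  then have "(\<lambda>s. f s - c k * s ^ k) \<in> O[at 0](\<lambda>s. s ^ Suc k)"
    using expansionD[OF assms(1), of "Suc k"] by simp
  then have "((\<lambda>s. c k + (f s - c k * s ^ k) / s ^ k) \<longlongrightarrow> c k) (at 0)"
    using tendsto_add[OF tendsto_const bigo_Suc_imp_tendsto_0, of "\<lambda>s. f s - c k * s ^ k" k "c k"] by simp
  then show ?thesis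
    by (rule Lim_transform_eventually) (auto simp: eventually_at_filter diff_divide_distrib)
qed

lemma expansion_unique:
  assumes "expansion f c" "expansion f d"
  shows "c = d"
proof
  fix n show "c n = d n"
  proof (induction n rule: less_induct)
    case (less n)
    have "expansion (\<lambda>s. 0) (\<lambda>n. c n - d n)" using expansion_diff[OF assms] by simp
    from expansion_leading[OF this, of n] less.IH have "((\<lambda>s::real. 0) \<longlongrightarrow> c n - d n) (at 0)" by simp
    then show ?case using LIM_unique[OF tendsto_const[of 0 "at (0::real)"]] by fastforce
  qed
qed

lemma expansion_bigo:
  assumes "expansion f c" and "f \<in> O[at 0](\<lambda>s. s ^ k)" and "n < k"
  shows "c n = 0"
  using assms(3)
proof (induction n rule: less_induct)
  case (less n)
  have "((\<lambda>s. f s / s ^ n) \<longlongrightarrow> c n) (at 0)" by (rule expansion_leading[OF assms(1)]) (use less in auto)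
  moreover have "((\<lambda>s. f s / s ^ n) \<longlongrightarrow> 0) (at 0)"
    by (rule bigo_Suc_imp_tendsto_0[OF bigo_power_weaken[OF assms(2)]]) (use less in auto)
  ultimately show ?case by (rule LIM_unique)
qed

lemma expansion_bigo_iff: "expansion f c \<Longrightarrow> f \<in> O[at 0](\<lambda>s. s ^ k) \<longleftrightarrow> (\<forall>n<k. c n = 0)"
  using expansion_bigo expansionD[of f c k] by auto

text \<open>Taylor's theorem with a Landau remainder. Differentiating the remainder of
  \<open>f\<close> gives the remainder of \<open>deriv f\<close> one degree lower; the induction on
  \<open>N\<close>, over all smooth \<open>f\<close>, integrates this estimate back.\<close>

lemma smooth_on_expansion_deriv:
  assumes "smooth_on S f" and "0 \<in> S"
  shows "expansion f (\<lambda>n. (deriv ^^ n) f 0 / fact n)"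
  unfolding expansion_def
proof
  fix N show "(\<lambda>s. f s - (\<Sum>n<N. (deriv ^^ n) f 0 / fact n * s ^ n)) \<in> O[at 0](\<lambda>s. s ^ N)"
    using assms(1)
  proof (induction N arbitrary: f)
    case 0
    have "(f \<longlongrightarrow> f 0) (at 0)"
      using smooth_on_imp_continuous_on[OF 0] smooth_on_imp_open[OF 0] assms(2)
      by (metis continuous_on_eq_continuous_at isCont_def)
    then show ?case by (auto intro!: bigoI_tendsto)
  next
    case (Suc N)
    note S = smooth_on_imp_open[OF Suc.prems]
    define c where "c = (\<lambda>n. (deriv ^^ n) f 0 / fact n)"
    have c: "(deriv ^^ n) (deriv f) 0 / fact n = real (Suc n) * c (Suc n)" for n
      by (simp add: c_def funpow_swap1 del: of_nat_Suc)
    have "(\<lambda>s. f s - (\<Sum>n<Suc N. c n * s ^ n)) \<in> O[at 0](\<lambda>s. s ^ Suc N)"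
    proof (rule bigo_antiderivative[OF S assms(2)])
      fix x assume x: "x \<in> S"
      have "((\<lambda>s. \<Sum>n<Suc N. c n * s ^ n) has_real_derivative (\<Sum>n<Suc N. c n * (real n * x ^ (n - 1)))) (at x)"
        by (auto intro!: derivative_eq_intros sum.cong simp: mult_ac)
      also have "(\<Sum>n<Suc N. c n * (real n * x ^ (n - 1))) = (\<Sum>n<N. (deriv ^^ n) (deriv f) 0 / fact n * x ^ n)"
        by (simp only: c) (subst sum.lessThan_Suc_shift, simp add: mult_ac)
      finally show "((\<lambda>s. f s - (\<Sum>n<Suc N. c n * s ^ n)) has_real_derivative
          deriv f x - (\<Sum>n<N. (deriv ^^ n) (deriv f) 0 / fact n * x ^ n)) (at x)"
        by (intro derivative_intros smooth_on_deriv(2)[OF Suc.prems x])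
    next
      show "f 0 - (\<Sum>n<Suc N. c n * 0 ^ n) = 0"
        by (subst sum.lessThan_Suc_shift) (simp add: c_def)
    qed (rule Suc.IH[OF smooth_on_deriv(1)[OF Suc.prems]])
    then show ?case by (simp only: c_def)
  qed
qed

lemma expansion_deriv:
  assumes "smooth_on S f" "0 \<in> S" "expansion f c"
  shows "expansion (deriv f) (\<lambda>n. real (Suc n) * c (Suc n))"
proof -
  have c: "c = (\<lambda>n. (deriv ^^ n) f 0 / fact n)"
    using expansion_unique[OF assms(3) smooth_on_expansion_deriv[OF assms(1,2)]] .
  have "(deriv ^^ n) (deriv f) 0 / fact n = real (Suc n) * c (Suc n)" for n
    by (simp add: c funpow_swap1 del: of_nat_Suc)
  then show ?thesis using smooth_on_expansion_deriv[OF smooth_on_deriv(1)[OF assms(1)] assms(2)] by presburger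
qed

lemma expansion_at_0:
  assumes "smooth_on S f" "0 \<in> S" "expansion f c"
  shows "f 0 = c 0"
  using expansion_unique[OF assms(3) smooth_on_expansion_deriv[OF assms(1,2)]] by simp

text \<open>The derivative of \<open>f s / s ^ k\<close> is
  \<open>(s * deriv f s - k * f s) / s ^ (k + 1)\<close>, and the new numerator vanishes to order k
  + 1. Hence the quotients of this kind, completed at 0 by the Taylor coefficient, form a class
  closed under differentiation.\<close>

lemma smooth_on_divide_power:
  assumes "smooth_on S f" and "0 \<in> S" and "expansion f c" and "\<And>n. n < k \<Longrightarrow> c n = 0"
  shows "smooth_on S (\<lambda>s. if s = 0 then c k else f s / s ^ k)"
proof (rule smooth_on_real_coinduct[where P = "\<lambda>F. \<exists>f c k. smooth_on S f \<and> expansion f c \<and> (\<forall>n<k. c n = 0)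
      \<and> F = (\<lambda>s. if s = 0 then c k else f s / s ^ k)"])
  fix F assume "\<exists>f c k. smooth_on S f \<and> expansion f c \<and> (\<forall>n<k. c n = 0) \<and> F = (\<lambda>s. if s = 0 then c k else f s / s ^ k)"
  then obtain f c k where f: "smooth_on S f" "expansion f c" "\<And>n. n < k \<Longrightarrow> c n = 0"
    and F: "F = (\<lambda>s. if s = 0 then c k else f s / s ^ k)" by blast
  note S = smooth_on_imp_open[OF f(1)]
  define g where "g = (\<lambda>s. s ^ 1 * deriv f s - real k * f s)"
  define d where "d = (\<lambda>n. (if n < 1 then 0 else real (Suc (n - 1)) * c (Suc (n - 1))) - real k * c n)"
  have g: "smooth_on S g" unfolding g_def
    by (intro smooth_on_intros f smooth_on_deriv S)
  have d: "expansion g d" unfolding g_def d_def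
    by (intro expansion_diff expansion_power_mult expansion_cmult f expansion_deriv[OF f(1) assms(2)])
  \<comment> \<open>The coefficient of degree \<open>n\<close> of \<open>g\<close> is
    \<open>(n - k) * c n\<close>: for n < k the second factor vanishes, for n = k the first
    one.\<close>
  have d0: "d n = 0" if "n < Suc k" for n
    using that f(3)[of n] by (cases "n = k") (auto simp: d_def)
  have dk: "d (Suc k) = c (Suc k)" by (simp add: d_def algebra_simps)
  define G where "G = (\<lambda>s. if s = 0 then d (Suc k) else g s / s ^ Suc k)"
  have "(F has_real_derivative G s) (at s)" if s: "s \<in> S" for s
  proof (cases "s = 0")
    case False
    have "((\<lambda>s. f s / s ^ k) has_real_derivative (deriv f s * s ^ k - f s * (real k * s ^ (k - 1))) / (s ^ k * s ^ k)) (at s)"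
      using False by (auto intro!: derivative_eq_intros smooth_on_deriv(2)[OF f(1) s])
    also have "(deriv f s * s ^ k - f s * (real k * s ^ (k - 1))) / (s ^ k * s ^ k) = G s"
      using False by (cases k) (auto simp: G_def g_def divide_simps, auto simp: algebra_simps)
    finally show ?thesis
      by (rule has_field_derivative_transform_within_open[where S = "S - {0}"]) (use False s S in \<open>auto simp: F\<close>)
  next
    case True
    have "expansion (\<lambda>s. s ^ k * c k) (\<lambda>n. if n < k then 0 else (if n - k = 0 then c k else 0))"
      by (intro expansion_power_mult expansion_const)
    then have "expansion (\<lambda>s. f s - s ^ k * c k) (\<lambda>n. c n - (if n < k then 0 else (if n - k = 0 then c k else 0)))"
      by (rule expansion_diff[OF f(2)])
    moreover have "c n - (if n < k then 0 else (if n - k = 0 then c k else 0)) = 0" if "n < Suc k" for n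
      using that f(3)[of n] by (cases "n = k") auto
    ultimately have "((\<lambda>s. (f s - s ^ k * c k) / s ^ Suc k) \<longlongrightarrow>
        c (Suc k) - (if Suc k < k then 0 else (if Suc k - k = 0 then c k else 0))) (at 0)"
      by (rule expansion_leading)
    then have "((\<lambda>s. (f s - s ^ k * c k) / s ^ Suc k) \<longlongrightarrow> c (Suc k)) (at 0)"
      by simp
    then have "((\<lambda>s. (F (0 + s) - F 0) / s) \<longlongrightarrow> c (Suc k)) (at 0)"
      by (rule Lim_transform_eventually) (auto simp: eventually_at_filter F diff_divide_distrib)
    then show ?thesis using True by (simp add: DERIV_def G_def dk)
  qed
  then show "\<exists>F'. (\<forall>x\<in>S. (F has_real_derivative F' x) (at x)) \<and> (\<exists>f c k. smooth_on S f \<and> expansion f c \<and>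
      (\<forall>n<k. c n = 0) \<and> F' = (\<lambda>s. if s = 0 then c k else f s / s ^ k))"
    using g d d0 by (intro exI[of _ G] conjI exI[of _ g] exI[of _ d] exI[of _ "Suc k"]) (auto simp: G_def)
qed (use assms smooth_on_imp_open in blast)+

lemma has_real_derivative_0_if_quadratic:
  assumes "F 0 = 0" and "eventually (\<lambda>x. \<bar>F x\<bar> \<le> C * x\<^sup>2) (at 0)"
  shows "(F has_real_derivative 0) (at 0)"
proof -
  have "F \<in> O[at 0](\<lambda>x. x ^ Suc 1)"
    by (rule bigoI[of _ C]) (use assms(2) in \<open>simp add: power2_eq_square abs_mult\<close>)
  from bigo_Suc_imp_tendsto_0[OF this] show ?thesis by (simp add: DERIV_def assms(1))
qed

text \<open>The derivative of such a function is again of the form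
  \<open>h (root i x) / root i x ^ m\<close> with \<open>h\<close> flat. For even \<open>i\<close> it is extended by zero to negative arguments.\<close>

lemma smooth_on_flat_root:
  fixes i k :: nat
  assumes g: "smooth_on {-e<..<e} g" and e: "e > 0" and flat: "expansion g (\<lambda>n. 0)" and i: "i > 0"
  shows "smooth_on {- (e ^ i)<..<e ^ i}
    (\<lambda>x. if 0 < x \<or> odd i \<and> x \<noteq> 0 then g (root i x) / root i x ^ k else 0)"
proof -
  define S where "S = {-e<..<e}"
  define T where "T = {- (e ^ i)<..<e ^ i}"
  \<comment> \<open>\<open>root\<close> is odd also for even \<open>i\<close>, so on negative
    arguments it then fails to invert the power. \<open>Q\<close> describes where
    \<open>root i x\<close> is nonzero and \<open>root i x ^ i = x\<close>.\<close>
  define Q where "Q = (\<lambda>x::real. 0 < x \<or> odd i \<and> x \<noteq> 0)"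
  have S: "open S" "0 \<in> S" using e by (auto simp: S_def)
  have T: "open T" "0 \<in> T" using e by (auto simp: T_def)
  have rpow: "root i x ^ i = x" if "Q x" for x
    using that i by (auto simp: Q_def odd_real_root_pow)
  have rnz: "root i x \<noteq> 0" if "Q x" for x using that i by (auto simp: Q_def)
  have rS: "root i x \<in> S" if "x \<in> T" for x
  proof -
    have "\<bar>x\<bar> < e ^ i" using that by (auto simp: T_def)
    then have "root i \<bar>x\<bar> < e" using i e by (metis real_root_less_iff real_root_power_cancel less_imp_le)
    then show ?thesis using i by (auto simp: S_def real_root_abs abs_less_iff)
  qed
  have rd: "(root i has_real_derivative inverse (real i * root i x ^ (i - 1))) (at x)" if "Q x" for x
    using that DERIV_real_root[OF i, of x] DERIV_odd_real_root[of i x] by (auto simp: Q_def)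
  have openQ: "open {x. Q x}"
  proof (cases "odd i")
    case True
    then have "{x. Q x} = - {0}" by (auto simp: Q_def)
    then show ?thesis by auto
  next
    case False
    then have "{x. Q x} = {0<..}" by (auto simp: Q_def)
    then show ?thesis by auto
  qed
  have "smooth_on T (\<lambda>x. if Q x then g (root i x) / root i x ^ k else 0)"
  proof (rule smooth_on_real_coinduct[where P = "\<lambda>F. \<exists>g k. smooth_on S g \<and> expansion g (\<lambda>n. 0) \<and>
      F = (\<lambda>x. if Q x then g (root i x) / root i x ^ k else 0)"])
    fix F assume "\<exists>g k. smooth_on S g \<and> expansion g (\<lambda>n. 0) \<and> F = (\<lambda>x. if Q x then g (root i x) / root i x ^ k else 0)"
    then obtain g k where g: "smooth_on S g" "expansion g (\<lambda>n. 0)"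
      and F: "F = (\<lambda>x. if Q x then g (root i x) / root i x ^ k else 0)" by blast
    define h where "h = (\<lambda>s. (1 / real i) * (s ^ 1 * deriv g s - real k * g s))"
    define H where "H = (\<lambda>x. if Q x then h (root i x) / root i x ^ (k + i) else 0)"
    have h: "smooth_on S h" unfolding h_def
      by (intro smooth_on_intros g smooth_on_deriv S)
    have ha: "expansion h (\<lambda>n. 0)"
    proof -
      have "expansion h (\<lambda>n. (1 / real i) * ((if n < 1 then 0 else real (Suc (n - 1)) * 0) - real k * 0))"
        unfolding h_def by (intro expansion_diff expansion_power_mult expansion_cmult g expansion_deriv[OF g(1) S(2)])
      then show ?thesis by (simp cong: if_cong)
    qed
    have "(F has_real_derivative H x) (at x)" if x: "x \<in> T" for x
    proof (cases "Q x")
      case True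
      define s where "s = root i x"
      have s0: "s \<noteq> 0" using rnz[OF True] s_def by simp
      have "((\<lambda>s. g s / s ^ k) has_real_derivative (deriv g s * s ^ k - g s * (real k * s ^ (k - 1))) / (s ^ k * s ^ k)) (at s)"
        using s0 rS[OF x] by (auto intro!: derivative_eq_intros smooth_on_deriv(2)[OF g(1)] simp: s_def)
      from DERIV_chain2[OF this[unfolded s_def] rd[OF True]]
      have "((\<lambda>x. g (root i x) / root i x ^ k) has_real_derivative
        (deriv g s * s ^ k - g s * (real k * s ^ (k - 1))) / (s ^ k * s ^ k) * inverse (real i * s ^ (i - 1))) (at x)"
        by (simp add: s_def)
      also have "(deriv g s * s ^ k - g s * (real k * s ^ (k - 1))) / (s ^ k * s ^ k) * inverse (real i * s ^ (i - 1)) = H x"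
      proof -
        obtain i' where i': "i = Suc i'" using i by (cases i) auto
        have Hx: "H x = h s / s ^ (k + i)" using True by (simp add: H_def s_def)
        show ?thesis unfolding Hx using s0
          by (cases k) (auto simp: h_def i' power_add divide_simps, auto simp: algebra_simps)
      qed
      finally show ?thesis
        by (rule has_field_derivative_transform_within_open[OF _ openQ]) (use True in \<open>auto simp: F\<close>)
    next
      case False
      then have Hx: "H x = 0" by (simp add: H_def)
      show ?thesis
      proof (cases "x = 0")
        case False
        then have x0: "x < 0" "even i" using \<open>\<not> Q x\<close> by (auto simp: Q_def)
        have "((\<lambda>x::real. 0) has_real_derivative 0) (at x)" by simp
        then have "(F has_real_derivative 0) (at x)"
          by (rule has_field_derivative_transform_within_open[where S = "{..<0}"])
            (use x0 in \<open>auto simp: F Q_def\<close>)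
        then show ?thesis by (simp add: Hx)
      next
        case True
        \<comment> \<open>The exponent \<open>k + 2 * i\<close> cancels the denominator
          \<open>root i x ^ k\<close> and leaves \<open>x\<^sup>2\<close>, enough for a zero
          derivative at 0.\<close>
        have "g \<in> O[at 0](\<lambda>s. s ^ (k + 2 * i))" using g(2) by (simp add: expansion_bigo_iff)
        then obtain C where C: "C > 0" "eventually (\<lambda>s. norm (g s) \<le> C * norm (s ^ (k + 2 * i))) (at 0)"
          using landau_o.bigE by blast
        then obtain \<delta> where \<delta>: "\<delta> > 0" "\<And>s. s \<noteq> 0 \<Longrightarrow> \<bar>s\<bar> < \<delta> \<Longrightarrow> \<bar>g s\<bar> \<le> C * \<bar>s ^ (k + 2 * i)\<bar>"
          unfolding eventually_at by auto
        have "(root i \<longlongrightarrow> 0) (at 0)"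
          using isCont_real_root[of 0 i] by (simp add: isCont_def)
        then have "eventually (\<lambda>x. \<bar>root i x\<bar> < \<delta>) (at 0)"
          using \<delta>(1) by (auto dest!: tendstoD simp: dist_real_def)
        then have "eventually (\<lambda>x. \<bar>F x\<bar> \<le> C * x\<^sup>2) (at 0)"
        proof eventually_elim
          case (elim x)
          show ?case
          proof (cases "Q x")
            case True
            have "\<bar>g (root i x)\<bar> \<le> C * \<bar>root i x ^ (k + 2 * i)\<bar>" using \<delta>(2) rnz[OF True] elim by blast
            also have "\<bar>root i x ^ (k + 2 * i)\<bar> = \<bar>root i x ^ k\<bar> * x\<^sup>2"
              using rpow[OF True] by (simp add: power_add power_mult abs_mult mult.commute[of 2])
            finally show ?thesis using True rnz[OF True] by (simp add: F field_simps)
          qed (use C in \<open>auto simp: F\<close>)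
        qed
        then have "(F has_real_derivative 0) (at 0)"
          by (intro has_real_derivative_0_if_quadratic[of F C]) (auto simp: F Q_def)
        then show ?thesis using Hx True by simp
      qed
    qed
    then show "\<exists>F'. (\<forall>x\<in>T. (F has_real_derivative F' x) (at x)) \<and> (\<exists>g k. smooth_on S g \<and> expansion g (\<lambda>n. 0) \<and>
      F' = (\<lambda>x. if Q x then g (root i x) / root i x ^ k else 0))"
      using h ha by (intro exI[of _ H] conjI exI[of _ h] exI[of _ "k + i"]) (auto simp: H_def)
  qed (use T g flat S_def in blast)+
  then show ?thesis by (simp add: T_def Q_def)
qed

section \<open>Borel's lemma\<close>

text \<open>A class closed under products and derivatives whose members are bounded on the whole
  line. Rescaled powers of \<open>sin\<close> from this class take the place of the usual cut-off
  monomials in the construction below.\<close>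

inductive trig_poly :: "(real \<Rightarrow> real) \<Rightarrow> bool" where
  const: "trig_poly (\<lambda>x. c)"
| sin: "trig_poly sin"
| cos: "trig_poly cos"
| add: "trig_poly f \<Longrightarrow> trig_poly g \<Longrightarrow> trig_poly (\<lambda>x. f x + g x)"
| mult: "trig_poly f \<Longrightarrow> trig_poly g \<Longrightarrow> trig_poly (\<lambda>x. f x * g x)"

lemma trig_poly_bounded: "trig_poly f \<Longrightarrow> \<exists>M. \<forall>x. \<bar>f x\<bar> \<le> M"
proof (induction rule: trig_poly.induct)
  case (add f g)
  then obtain M N where "\<forall>x. \<bar>f x\<bar> \<le> M" "\<forall>x. \<bar>g x\<bar> \<le> N" by blast
  then show ?case by (intro exI[of _ "M + N"]) (meson abs_triangle_ineq add_mono order_trans)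
next
  case (mult f g)
  then obtain M N where "\<forall>x. \<bar>f x\<bar> \<le> M" "\<forall>x. \<bar>g x\<bar> \<le> N" by blast
  then show ?case by (intro exI[of _ "M * N"]) (auto simp: abs_mult intro!: mult_mono order_trans[OF abs_ge_zero])
qed (auto intro: abs_sin_le_one abs_cos_le_one)

lemma trig_poly_deriv: "trig_poly f \<Longrightarrow> \<exists>f'. trig_poly f' \<and> (\<forall>x. (f has_real_derivative f' x) (at x))"
proof (induction rule: trig_poly.induct)
  case (const c)
  show ?case by (rule exI[of _ "\<lambda>x. 0"]) (auto intro: trig_poly.const)
next
  case sin
  show ?case by (rule exI[of _ cos]) (auto intro: trig_poly.cos DERIV_sin)
next
  case cos
  have "trig_poly (\<lambda>x. (-1) * sin x)" by (intro trig_poly.intros)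
  then show ?case by (intro exI[of _ "\<lambda>x. (-1) * sin x"]) (auto intro: DERIV_cos)
next
  case (add f g)
  then obtain f' g' where "trig_poly f'" "\<forall>x. (f has_real_derivative f' x) (at x)"
    "trig_poly g'" "\<forall>x. (g has_real_derivative g' x) (at x)" by blast
  then show ?case by (intro exI[of _ "\<lambda>x. f' x + g' x"]) (auto intro: trig_poly.add DERIV_add)
next
  case (mult f g)
  then obtain f' g' where "trig_poly f'" "\<forall>x. (f has_real_derivative f' x) (at x)"
    "trig_poly g'" "\<forall>x. (g has_real_derivative g' x) (at x)" by blast
  with mult.hyps show ?case
    by (intro exI[of _ "\<lambda>x. f' x * g x + g' x * f x"]) (auto intro!: trig_poly.add trig_poly.mult DERIV_mult)
qed

lemma trig_poly_deriv_funpow: "trig_poly f \<Longrightarrow> trig_poly ((deriv ^^ j) f)"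
proof (induction j)
  case (Suc j)
  then obtain f' where f': "trig_poly f'" "\<forall>x. ((deriv ^^ j) f has_real_derivative f' x) (at x)"
    using trig_poly_deriv by blast
  then have "deriv ((deriv ^^ j) f) = f'" by (auto intro: DERIV_imp_deriv)
  then show ?case using f' by simp
qed simp

lemma smooth_on_trig_poly: "trig_poly f \<Longrightarrow> smooth_on UNIV f"
  by (rule smooth_on_real_coinduct[where P = trig_poly]) (use trig_poly_deriv in blast)+

lemma smooth_on_deriv_funpow: "smooth_on S f \<Longrightarrow> smooth_on S ((deriv ^^ j) f)" for f :: "real \<Rightarrow> real"
  by (induction j) (auto intro: smooth_on_deriv)

lemma deriv_funpow_scale:
  fixes h :: "real \<Rightarrow> real"
  assumes "smooth_on UNIV h"
  shows "(deriv ^^ j) (\<lambda>x. c * h (k * x)) = (\<lambda>x. c * k ^ j * (deriv ^^ j) h (k * x))"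
proof (induction j)
  case (Suc j)
  have "((\<lambda>x. c * k ^ j * (deriv ^^ j) h (k * x)) has_real_derivative c * k ^ Suc j * (deriv ^^ Suc j) h (k * x)) (at x)" for x
  proof -
    have 1: "((deriv ^^ j) h has_real_derivative (deriv ^^ Suc j) h (k * x)) (at (k * x))"
      using smooth_on_deriv(2)[OF smooth_on_deriv_funpow[OF assms, of j], of "k * x"] by simp
    have 2: "((\<lambda>x. k * x) has_real_derivative k) (at x)" by (auto intro!: derivative_eq_intros)
    show ?thesis using DERIV_cmult[OF DERIV_chain2[OF 1 2], of "c * k ^ j"] by (simp add: mult_ac)
  qed
  then show ?case by (auto simp: Suc.IH intro: DERIV_imp_deriv)
qed simp

lemma trig_poly_sin_power: "trig_poly (\<lambda>x. sin x ^ n)"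
proof (induction n)
  case 0 show ?case using trig_poly.const[of 1] by simp
next
  case (Suc n) then show ?case using trig_poly.mult[OF trig_poly.sin Suc] by simp
qed

text \<open>Since \<open>sin x / x\<close> tends to 1, \<open>sin x ^ n\<close> has leading term
  \<open>x ^ n\<close> at 0.\<close>

lemma deriv_funpow_sin_power:
  "j < n \<Longrightarrow> (deriv ^^ j) (\<lambda>x::real. sin x ^ n) 0 = 0" "(deriv ^^ n) (\<lambda>x::real. sin x ^ n) 0 = fact n"
proof -
  let ?c = "\<lambda>j. (deriv ^^ j) (\<lambda>x::real. sin x ^ n) 0 / fact j"
  have c: "expansion (\<lambda>x. sin x ^ n) ?c"
    by (rule smooth_on_expansion_deriv[OF smooth_on_trig_poly[OF trig_poly_sin_power]]) simp
  have lim: "((\<lambda>x::real. sin x ^ n / x ^ n) \<longlongrightarrow> 1) (at 0)"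
    using tendsto_power[OF DERIV_sin[of "0::real", unfolded DERIV_def], of n] by (simp add: power_divide)
  have z: "?c j = 0" if "j < n" for j
    by (rule expansion_bigo[OF c bigoI_tendsto[OF lim eventually_power_nonzero] that])
  then show "j < n \<Longrightarrow> (deriv ^^ j) (\<lambda>x::real. sin x ^ n) 0 = 0" by simp
  have "((\<lambda>x::real. sin x ^ n / x ^ n) \<longlongrightarrow> ?c n) (at 0)" using expansion_leading[OF c z] .
  from LIM_unique[OF this lim] show "(deriv ^^ n) (\<lambda>x::real. sin x ^ n) 0 = fact n" by simp
qed

text \<open>Take \<open>v / (n! * k ^ n) * sin (k * x) ^ n\<close>. The derivative of order j scales
  like \<open>k ^ (j - n)\<close>: for a large \<open>k\<close> all derivatives of order below
  \<open>n\<close> are small, while the one of order \<open>n\<close> at 0 remains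
  \<open>v\<close>.\<close>

lemma small_function_with_derivative:
  fixes v \<epsilon> :: real
  assumes "\<epsilon> > 0"
  shows "\<exists>g. smooth_on UNIV g \<and> (\<forall>j<n. (deriv ^^ j) g 0 = 0) \<and> (deriv ^^ n) g 0 = v \<and>
    (\<forall>j<n. \<forall>x. \<bar>(deriv ^^ j) g x\<bar> \<le> \<epsilon>)"
proof -
  define h where "h = (\<lambda>x::real. sin x ^ n)"
  have h: "trig_poly h" "smooth_on UNIV h"
    unfolding h_def using trig_poly_sin_power smooth_on_trig_poly by blast+
  obtain B where B: "\<And>j x. \<bar>(deriv ^^ j) h x\<bar> \<le> B j"
    using trig_poly_bounded[OF trig_poly_deriv_funpow[OF h(1)]] by metis
  define M where "M = (\<Sum>j<n. B j)"
  have B0: "B j \<ge> 0" for j using B[of j 0] by linarith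
  have M: "\<bar>(deriv ^^ j) h x\<bar> \<le> M" if "j < n" for j x
    using B[of j x] member_le_sum[of j "{..<n}" B] B0 that by (auto simp: M_def)
  define k where "k = max 1 (\<bar>v\<bar> * M / \<epsilon>)"
  have k: "k \<ge> 1" "\<bar>v\<bar> * M \<le> \<epsilon> * k" using assms by (auto simp: k_def field_simps max_def)
  define c where "c = v / (fact n * k ^ n)"
  define g where "g = (\<lambda>x. c * h (k * x))"
  have d: "(deriv ^^ j) g x = c * k ^ j * (deriv ^^ j) h (k * x)" for j x
    using deriv_funpow_scale[OF h(2)] by (simp add: g_def)
  have "smooth_on UNIV g" unfolding g_def
    by (intro smooth_on_intros smooth_on_compose[OF h(2)]) auto
  moreover have "(deriv ^^ j) g 0 = 0" if "j < n" for j
    using deriv_funpow_sin_power(1)[OF that] by (simp add: d h_def)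
  moreover have "(deriv ^^ n) g 0 = v"
    using deriv_funpow_sin_power(2)[of n] k by (simp add: d h_def c_def)
  moreover have "\<bar>(deriv ^^ j) g x\<bar> \<le> \<epsilon>" if "j < n" for j x
  proof -
    have "\<bar>c\<bar> * k ^ j \<le> \<bar>v\<bar> / k ^ n * k ^ j"
      using k fact_ge_1[of n, where ?'a = real]
      by (auto simp: c_def abs_mult intro!: mult_right_mono divide_left_mono)
    also have "\<dots> = \<bar>v\<bar> / k ^ (n - j)" using that k by (simp add: power_diff)
    also have "\<dots> \<le> \<bar>v\<bar> / k"
      using that k power_increasing[of 1 "n - j" k] by (intro divide_left_mono) auto
    finally have "\<bar>c\<bar> * k ^ j * \<bar>(deriv ^^ j) h (k * x)\<bar> \<le> \<bar>v\<bar> / k * M"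
      using k M[OF that, of "k * x"] by (intro mult_mono) auto
    then have "\<bar>(deriv ^^ j) g x\<bar> \<le> \<bar>v\<bar> / k * M" using k by (simp add: d abs_mult)
    also have "\<dots> \<le> \<epsilon>" using k by (simp add: field_simps)
    finally show ?thesis .
  qed
  ultimately show ?thesis by blast
qed

text \<open>The function is a series of \<open>g n\<close> chosen recursively. \<open>g n\<close>
  corrects the derivative of order \<open>n\<close> at 0, to which the earlier summands may
  contribute, and has vanishing lower derivatives at 0, so earlier corrections survive. Its
  derivatives of order below \<open>n\<close> are at most \<open>(1/2) ^ n\<close>, so for every j
  the series of derivatives of order j converges uniformly and may be differentiated
  termwise.\<close>

theorem Borel_lemma:
  "\<exists>f. smooth_on UNIV f \<and> expansion f c"
proof -
  define P where "P = (\<lambda>(g :: nat \<Rightarrow> real \<Rightarrow> real) n (r :: real \<Rightarrow> real). smooth_on UNIV r \<and> (\<forall>j<n. (deriv ^^ j) r 0 = 0) \<and>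
    (deriv ^^ n) r 0 = fact n * c n - (\<Sum>m<n. (deriv ^^ n) (g m) 0) \<and>
    (\<forall>j<n. \<forall>x. \<bar>(deriv ^^ j) r x\<bar> \<le> (1/2) ^ n))"
  have "\<exists>g. \<forall>n. P g n (g n)"
  proof (rule dependent_wellorder_choice)
    show "P f x r = P g x r" if "\<And>y. y < x \<Longrightarrow> f y = g y" for r f g x
      using that by (simp add: P_def)
    show "\<exists>r. P f x r" for x f
      unfolding P_def by (rule small_function_with_derivative) simp
  qed
  then obtain g where g: "\<And>n. P g n (g n)" by blast
  have sm: "smooth_on UNIV (g n)" for n using g[of n] by (simp add: P_def)
  have z: "(deriv ^^ j) (g n) 0 = 0" if "j < n" for n j using g[of n] that by (simp add: P_def)
  have v: "(\<Sum>m<Suc n. (deriv ^^ n) (g m) 0) = fact n * c n" for n using g[of n] by (simp add: P_def)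
  have bd: "norm ((deriv ^^ j) (g n) x) \<le> (1/2) ^ n" if "j < n" for n j x using g[of n] that by (simp add: P_def)
  define F where "F = (\<lambda>j x. \<Sum>n. (deriv ^^ j) (g n) x)"
  have geo: "summable (\<lambda>n. (1/2::real) ^ n)" by (simp add: summable_geometric)
  have ev: "eventually (\<lambda>n. \<forall>x\<in>UNIV. norm ((deriv ^^ j) (g n) x) \<le> (1/2) ^ n) sequentially" for j
    using eventually_gt_at_top[of j] by eventually_elim (use bd in auto)
  have uc: "uniformly_convergent_on UNIV (\<lambda>n x. \<Sum>i<n. (deriv ^^ j) (g i) x)" for j
    using Weierstrass_m_test_ev[OF ev geo] unfolding uniformly_convergent_on_def by blast
  have dF: "(F j has_real_derivative F (Suc j) x) (at x)" for j x
    unfolding F_def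
  proof (rule has_field_derivative_series'(2)[of UNIV _ _ 0])
    show "((deriv ^^ j) (g n) has_real_derivative (deriv ^^ Suc j) (g n) y) (at y within UNIV)" for n y
      using smooth_on_deriv(2)[OF smooth_on_deriv_funpow[OF sm, of j n], of y] by simp
    show "summable (\<lambda>n. (deriv ^^ j) (g n) 0)"
      by (rule summable_comparison_test_ev[OF _ geo]) (use ev[of j] in eventually_elim, auto)
  qed (use uc[of "Suc j"] in auto)
  have smF: "smooth_on UNIV (F 0)"
    by (rule smooth_on_real_coinduct[where P = "\<lambda>f. \<exists>j. f = F j"]) (use dF in auto)
  have derF: "(deriv ^^ j) (F 0) = F j" for j
  proof (induction j)
    case (Suc j)
    have "deriv (F j) = F (Suc j)" using dF by (auto intro: DERIV_imp_deriv)
    then show ?case by (simp add: Suc.IH)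
  qed simp
  have "F j 0 = fact j * c j" for j
  proof -
    have "F j 0 = (\<Sum>n<Suc j. (deriv ^^ j) (g n) 0)"
      unfolding F_def by (rule suminf_finite) (auto intro: z)
    then show ?thesis using v by simp
  qed
  then have "(\<lambda>j. (deriv ^^ j) (F 0) 0 / fact j) = c" by (simp add: derF)
  then show ?thesis using smF smooth_on_expansion_deriv[OF smF] by auto
qed

section \<open>Reparametrization of plane curves\<close>

text \<open>The inverse function theorem on the line. Injectivity comes from the mean value theorem
  on an interval where the derivative has no zero. The inverse \<open>\<psi>\<close> is smooth
  because the functions \<open>h o \<psi>\<close> with \<open>h\<close> smooth are closed under
  differentiation: the derivative is \<open>(h' / s') o \<psi>\<close>.\<close>

lemma smooth_on_local_diffeo_real:
  fixes s :: "real \<Rightarrow> real"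
  assumes s: "smooth_on S s" and p: "p \<in> S" and d: "deriv s p \<noteq> 0"
  obtains U where "p \<in> U" "U \<subseteq> S" "diffeo_on U s"
proof -
  note S = smooth_on_imp_open[OF s]
  have "open (S \<inter> deriv s -` (- {0}))"
    by (rule continuous_open_preimage[OF smooth_on_imp_continuous_on[OF smooth_on_deriv(1)[OF s]] S]) auto
  then obtain e where e: "e > 0" "ball p e \<subseteq> S \<inter> deriv s -` (- {0})"
    using p d by (metis (no_types, lifting) ComplI IntI openE singletonD vimageI)
  define U where "U = ball p e"
  have U: "open U" "p \<in> U" "U \<subseteq> S" "\<And>x. x \<in> U \<Longrightarrow> deriv s x \<noteq> 0" using e by (auto simp: U_def)
  have sU: "smooth_on U s" by (rule smooth_on_subset[OF s U(1,3)])
  have ne: "s x \<noteq> s y" if "x \<in> U" "y \<in> U" "x < y" for x y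
  proof
    assume eq: "s x = s y"
    have sub: "t \<in> U" if "x \<le> t" "t \<le> y" for t
      using that \<open>x \<in> U\<close> \<open>y \<in> U\<close> by (auto simp: U_def dist_real_def)
    have "\<exists>z>x. z < y \<and> s y - s x = (y - x) * deriv s z"
      using \<open>x < y\<close> by (intro MVT2) (auto intro!: smooth_on_deriv(2)[OF sU] sub)
    then obtain z where "x < z" "z < y" "deriv s z = 0" using eq \<open>x < y\<close> by auto
    then show False using U(4)[of z] sub[of z] by auto
  qed
  then have inj: "inj_on s U" by (metis inj_onI linorder_neqE)
  have op: "open (s ` U)"
    by (rule invariance_of_domain[OF smooth_on_imp_continuous_on[OF sU] U(1) inj])
  define \<psi> where "\<psi> = inv_into U s"
  have \<psi>: "\<psi> (s x) = x" if "x \<in> U" for x using inj that by (simp add: \<psi>_def inv_into_f_f)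
  have d\<psi>: "(\<psi> has_real_derivative inverse (deriv s (\<psi> y))) (at y)" if y: "y \<in> s ` U" for y
  proof -
    obtain x where x: "x \<in> U" "y = s x" using y by blast
    show ?thesis unfolding x(2) \<psi>[OF x(1)]
      using has_derivative_inverse_strong[OF U(1) x(1) smooth_on_imp_continuous_on[OF sU] \<psi>
          smooth_on_deriv(2)[OF sU x(1), unfolded has_field_derivative_def]] U(4)[OF x(1)]
      by (auto simp: has_field_derivative_def fun_eq_iff)
  qed
  have "smooth_on (s ` U) \<psi>"
  proof (rule smooth_on_real_coinduct[OF op, where P = "\<lambda>F. \<exists>h. smooth_on U h \<and> F = (\<lambda>y. h (\<psi> y))"])
    show "\<exists>h. smooth_on U h \<and> \<psi> = (\<lambda>y. h (\<psi> y))"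
      by (rule exI[of _ "\<lambda>x. x"]) (auto intro: smooth_on_ident U)
  next
    fix F :: "real \<Rightarrow> real" assume "\<exists>h. smooth_on U h \<and> F = (\<lambda>y. h (\<psi> y))"
    then obtain h where h: "smooth_on U h" "F = (\<lambda>y. h (\<psi> y))" by blast
    \<comment> \<open>The quotient \<open>h' / s'\<close> is written over the square of
      \<open>s'\<close>, because \<open>smooth_on_divide\<close> asks for a positive denominator and
      \<open>s'\<close> may be negative.\<close>
    define k where "k = (\<lambda>x. deriv h x * deriv s x / (deriv s x)\<^sup>2)"
    have k: "smooth_on U k" unfolding k_def
      by (intro smooth_on_divide smooth_on_mult smooth_on_power smooth_on_deriv h sU) (use U(4) in simp)
    have "(F has_real_derivative k (\<psi> y)) (at y)" if y: "y \<in> s ` U" for y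
    proof -
      have \<psi>y: "\<psi> y \<in> U" using y \<psi> by auto
      have "k (\<psi> y) = deriv h (\<psi> y) * inverse (deriv s (\<psi> y))"
        using U(4)[OF \<psi>y] by (simp add: k_def power2_eq_square field_simps)
      then show ?thesis
        using DERIV_chain2[OF smooth_on_deriv(2)[OF h(1) \<psi>y] d\<psi>[OF y]] by (simp add: h(2))
    qed
    then show "\<exists>F'. (\<forall>x\<in>s ` U. (F has_real_derivative F' x) (at x)) \<and> (\<exists>h. smooth_on U h \<and> F' = (\<lambda>y. h (\<psi> y)))"
      using k by (intro exI[of _ "\<lambda>y. k (\<psi> y)"]) auto
  qed
  then have "diffeo_on U s" using U(1) sU inj op by (simp add: diffeo_on_def \<psi>_def)
  then show ?thesis using that U by blast
qed

lemma bigo_eventually_cong: "f \<in> O[F](h) \<Longrightarrow> eventually (\<lambda>x. f x = g x) F \<Longrightarrow> g \<in> O[F](h)"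
  using landau_o.big.in_cong by blast

lemma diffeo_on_id: "open U \<Longrightarrow> diffeo_on U (\<lambda>x. x)"
  by (rule diffeo_onI[where \<psi> = "\<lambda>x. x"]) (auto intro: smooth_on_ident)

lemma A_equiv_source:
  assumes "diffeo_on U \<phi>" and "p \<in> U" and "\<And>w. w \<in> U \<Longrightarrow> f w = g (\<phi> w)" and "\<phi> p = q"
  shows "A_equiv f p g q"
  unfolding A_equiv_def
  by (rule exI[of _ U], rule exI[of _ UNIV], rule exI[of _ \<phi>], rule exI[of _ "\<lambda>x. x"])
    (use assms in \<open>auto intro: diffeo_on_id\<close>)

lemma A_equiv_target:
  assumes "open U" "diffeo_on V \<Phi>" "p \<in> U" and "\<And>w. w \<in> U \<Longrightarrow> f w \<in> V \<and> g w = \<Phi> (f w)"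
  shows "A_equiv f p g p"
  unfolding A_equiv_def
  by (rule exI[of _ U], rule exI[of _ V], rule exI[of _ "\<lambda>x. x"], rule exI[of _ \<Phi>])
    (use assms in \<open>auto intro: diffeo_on_id\<close>)

text \<open>For smooth functions the order of vanishing is an integer or infinite, so being smaller
  than \<open>t ^ j\<close> already means one full power more.\<close>

lemma smooth_on_bigo_Suc:
  fixes f :: "real \<Rightarrow> real"
  assumes "smooth_on S f" "0 \<in> S" "((\<lambda>t. f t / t ^ j) \<longlongrightarrow> 0) (at 0)"
  shows "f \<in> O[at 0](\<lambda>t. t ^ Suc j)"
proof -
  obtain c where c: "expansion f c" using smooth_on_expansion_deriv[OF assms(1,2)] by blast
  have z: "c n = 0" if "n < j" for n
    by (rule expansion_bigo[OF c bigoI_tendsto[OF assms(3) eventually_power_nonzero] that])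
  have "c j = 0" using LIM_unique[OF expansion_leading[OF c z] assms(3)] .
  with z have "\<forall>n<Suc j. c n = 0" by (auto simp: less_Suc_eq)
  then show ?thesis using expansion_bigo_iff[OF c, of "Suc j"] by blast
qed

text \<open>The new parameter \<open>\<sigma> t = t * (X t / t ^ i) powr (1 / i)\<close> is a smooth
  root of \<open>X\<close>, so \<open>X = \<sigma> ^ i\<close> exactly, and \<open>Z\<close> is
  \<open>Y\<close> in this parameter. The last conclusion transfers estimates from \<open>t\<close>
  to the new parameter, so the inverse of \<open>\<sigma>\<close> need never be expanded.\<close>

lemma reparametrize_power:
  fixes X Y :: "real \<Rightarrow> real" and i :: nat
  assumes X: "smooth_on S X" and Y: "smooth_on S Y" and S: "0 \<in> S" and i: "i > 0"
    and lim: "((\<lambda>t. X t / t ^ i) \<longlongrightarrow> 1) (at 0)"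
  obtains U \<sigma> T Z where "0 \<in> U" "smooth_on U \<sigma>" "((\<lambda>t. \<sigma> t / t) \<longlongrightarrow> 1) (at 0)"
    "\<And>t. t \<in> U \<Longrightarrow> t \<noteq> 0 \<Longrightarrow> \<sigma> t = t * (X t / t ^ i) powr (1 / i)"
    "\<And>t. t \<in> U \<Longrightarrow> t \<noteq> 0 \<Longrightarrow> X t / t ^ i > 0"
    "0 \<in> T" "smooth_on T Z" "A_equiv (\<lambda>t. (X t, Y t)) 0 (\<lambda>s. (s ^ i, Z s)) 0"
    "\<And>j N. (\<lambda>t. Y t - \<sigma> t ^ j) \<in> O[at 0](\<lambda>t. t ^ N) \<Longrightarrow> (\<lambda>s. Z s - s ^ j) \<in> O[at 0](\<lambda>s. s ^ N)"
proof -
  obtain c where c: "expansion X c" using smooth_on_expansion_deriv[OF X S] by blast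
  have z: "c n = 0" if "n < i" for n
    by (rule expansion_bigo[OF c bigoI_tendsto[OF lim eventually_power_nonzero] that])
  have ci: "c i = 1" using LIM_unique[OF expansion_leading[OF c z] lim] .
  define g where "g = (\<lambda>t. if t = 0 then c i else X t / t ^ i)"
  have g: "smooth_on S g" unfolding g_def by (rule smooth_on_divide_power[OF X S c z])
  define W where "W = S \<inter> g -` {0<..}"
  have W: "open W" unfolding W_def
    by (rule continuous_open_preimage[OF smooth_on_imp_continuous_on[OF g] smooth_on_imp_open[OF g]]) auto
  have W0: "0 \<in> W" "W \<subseteq> S" using S by (auto simp: W_def g_def ci)
  have gW: "smooth_on W g" using smooth_on_subset[OF g W W0(2)] .
  define \<sigma> where "\<sigma> = (\<lambda>t. t * g t powr (1 / i))"
  have \<rho>: "smooth_on W (\<lambda>t. g t powr (1 / i))"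
    by (rule smooth_on_powr_comp[OF gW]) (auto simp: W_def)
  have \<sigma>: "smooth_on W \<sigma>" unfolding \<sigma>_def
    by (intro smooth_on_mult smooth_on_ident W \<rho>)
  have "isCont (\<lambda>t. g t powr (1 / i)) 0"
    using smooth_on_imp_continuous_on[OF \<rho>] W W0(1) by (simp add: continuous_on_eq_continuous_at)
  then have gl: "((\<lambda>t. g t powr (1 / i)) \<longlongrightarrow> 1) (at 0)" by (simp add: isCont_def g_def ci)
  have \<sigma>l: "((\<lambda>t. \<sigma> t / t) \<longlongrightarrow> 1) (at 0)"
    by (rule Lim_transform_eventually[OF gl]) (auto simp: \<sigma>_def eventually_at_filter)
  then have "(\<sigma> has_real_derivative 1) (at 0)" by (simp add: DERIV_def \<sigma>_def)
  then have d: "deriv \<sigma> 0 \<noteq> 0" by (simp add: DERIV_imp_deriv)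
  obtain U where U: "0 \<in> U" "U \<subseteq> W" "diffeo_on U \<sigma>"
    using smooth_on_local_diffeo_real[OF \<sigma> W0(1) d] by blast
  have oU: "open U" using U(3) by (simp add: diffeo_on_def)
  have inj: "inj_on \<sigma> U" using U(3) by (simp add: diffeo_on_def)
  have \<sigma>0: "\<sigma> 0 = 0" by (simp add: \<sigma>_def)
  have pow: "X t = \<sigma> t ^ i" if "t \<in> U" for t
  proof -
    have "g t > 0" using that U by (auto simp: W_def)
    then have "(g t powr (1 / i)) ^ i = g t" using i by (simp add: powr_powr flip: powr_realpow)
    then have "\<sigma> t ^ i = t ^ i * g t" by (simp add: \<sigma>_def power_mult_distrib)
    also have "\<dots> = X t"
    proof (cases "t = 0")
      case True
      then show ?thesis using i expansion_at_0[OF X S c] z[of 0] by simp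
    qed (simp add: g_def)
    finally show ?thesis by simp
  qed
  define \<tau> where "\<tau> = inv_into U \<sigma>"
  define T where "T = \<sigma> ` U"
  have T: "open T" "smooth_on T \<tau>" "0 \<in> T" using U \<sigma>0 by (auto simp: diffeo_on_def T_def \<tau>_def image_iff intro!: bexI[of _ 0])
  have \<tau>\<sigma>: "\<tau> (\<sigma> t) = t" if "t \<in> U" for t using inj that by (simp add: \<tau>_def inv_into_f_f)
  have \<sigma>\<tau>: "\<sigma> (\<tau> s) = s" "\<tau> s \<in> U" if "s \<in> T" for s using \<tau>\<sigma> that by (auto simp: T_def)
  have \<tau>0: "\<tau> 0 = 0" using \<tau>\<sigma>[OF U(1)] \<sigma>0 by simp
  define Z where "Z = (\<lambda>s. Y (\<tau> s))"
  have Z: "smooth_on T Z" unfolding Z_def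
    by (rule smooth_on_compose[OF Y T(2)]) (use \<sigma>\<tau> U(2) W0(2) in blast)
  have \<tau>O: "\<tau> \<in> O[at 0](\<lambda>s. s)"
  proof -
    obtain c where c: "expansion \<tau> c" using smooth_on_expansion_deriv[OF T(2,3)] by blast
    have "c 0 = 0" using expansion_at_0[OF T(2,3) c] \<tau>0 by simp
    then show ?thesis using expansion_bigo_iff[OF c, of 1] by simp
  qed
  have lim\<tau>: "filterlim \<tau> (at 0) (at 0)"
  proof -
    have "isCont \<tau> 0"
      using smooth_on_imp_continuous_on[OF T(2)] T by (simp add: continuous_on_eq_continuous_at)
    moreover have "eventually (\<lambda>s. \<tau> s \<noteq> 0) (at 0)"
      using eventually_at_in_open[OF T(1,3)] by eventually_elim (use \<sigma>\<tau> \<sigma>0 in force)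
    ultimately show ?thesis by (auto simp: filterlim_at isCont_def \<tau>0)
  qed
  have trans: "(\<lambda>s. Z s - s ^ j) \<in> O[at 0](\<lambda>s. s ^ N)" if "(\<lambda>t. Y t - \<sigma> t ^ j) \<in> O[at 0](\<lambda>t. t ^ N)" for j N
  proof -
    have "(\<lambda>s. Y (\<tau> s) - \<sigma> (\<tau> s) ^ j) \<in> O[at 0](\<lambda>s. \<tau> s ^ N)"
      by (rule landau_o.big.compose[OF that lim\<tau>])
    also have "(\<lambda>s. \<tau> s ^ N) \<in> O[at 0](\<lambda>s. s ^ N)" by (rule landau_o.big_power[OF \<tau>O])
    finally have "(\<lambda>s. Y (\<tau> s) - \<sigma> (\<tau> s) ^ j) \<in> O[at 0](\<lambda>s. s ^ N)" .
    moreover have "eventually (\<lambda>s. Y (\<tau> s) - \<sigma> (\<tau> s) ^ j = Z s - s ^ j) (at 0)"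
      using eventually_at_in_open'[OF T(1,3)] by eventually_elim (simp add: Z_def \<sigma>\<tau>)
    ultimately show ?thesis by (rule bigo_eventually_cong)
  qed
  have "A_equiv (\<lambda>t. (X t, Y t)) 0 (\<lambda>s. (s ^ i, Z s)) 0"
    by (rule A_equiv_source[OF U(3,1)]) (auto simp: pow \<tau>\<sigma> Z_def \<sigma>0)
  moreover have "\<sigma> t = t * (X t / t ^ i) powr (1 / i)" "X t / t ^ i > 0" if "t \<in> U" "t \<noteq> 0" for t
    using that U(2) by (auto simp: \<sigma>_def W_def g_def split: if_splits)
  ultimately show ?thesis
    using that[OF U(1) smooth_on_subset[OF \<sigma> oU U(2)] \<sigma>l _ _ T(3) Z _ trans] by blast
qed

text \<open>Any two smooth functions with the same Taylor series differ by a flat function, and a flat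
  function of \<open>s\<close> is a combination of smooth functions of \<open>s ^ i\<close>. So it suffices to match Taylor
  series, which Borel's lemma does whenever all exponents lie in the semigroup of \<open>i\<close> and \<open>j\<close>.\<close>

lemma flat_odd_power:
  fixes i :: nat
  assumes g: "smooth_on {-e<..<e} g" and e: "e > 0" and flat: "expansion g (\<lambda>n. 0)" and i: "odd i"
  obtains G where "smooth_on {- (e ^ i)<..<e ^ i} G" "\<And>s. s \<in> {-e<..<e} \<Longrightarrow> g s = G (s ^ i)"
proof -
  have "i > 0" using i by (cases i) auto
  have g0: "g 0 = 0" using expansion_at_0[OF g _ flat] e by simp
  show ?thesis
    by (rule that[OF smooth_on_flat_root[OF g e flat \<open>i > 0\<close>, of 0]])
      (use i g0 in \<open>auto simp: odd_real_root_power_cancel\<close>)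
qed

lemma expansion_reflect:
  assumes "expansion f (\<lambda>n. 0)"
  shows "expansion (\<lambda>s. f (- s)) (\<lambda>n. 0)"
  unfolding expansion_def
proof
  fix N
  have "filterlim (\<lambda>s::real. - s) (at 0) (at 0)"
    by (auto simp: filterlim_at eventually_at_filter intro!: tendsto_eq_intros)
  from landau_o.big.compose[OF expansionD[OF assms, of N] this]
  show "(\<lambda>s. f (- s) - (\<Sum>n<N. 0 * s ^ n)) \<in> O[at 0](\<lambda>s. s ^ N)"
    by (cases "even N") (simp_all)
qed

text \<open>The even part of \<open>g\<close> is a function of \<open>s\<^sup>2\<close>; the odd
  part becomes even after division by the odd power \<open>s ^ j\<close>, and flatness keeps the
  quotient smooth. Only nonnegative arguments of \<open>G\<close> and \<open>H\<close> occur in the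
  identity, so their extension by zero does not affect it. \<open>H 0 = 0\<close> is recorded so
  that adding \<open>H\<close> later leaves the value 1 at 0 unchanged.\<close>

lemma flat_square:
  fixes j :: nat
  assumes g: "smooth_on {-e<..<e} g" and e: "e > 0" and flat: "expansion g (\<lambda>n. 0)" and j: "odd j"
  obtains G H where "smooth_on {- (e\<^sup>2)<..<e\<^sup>2} G" "smooth_on {- (e\<^sup>2)<..<e\<^sup>2} H" "H 0 = 0"
    "\<And>s. s \<in> {-e<..<e} \<Longrightarrow> g s = G (s\<^sup>2) + s ^ j * H (s\<^sup>2)"
proof -
  define p where "p = (\<lambda>s. (1/2) * (g s + g (- s)))"
  define q where "q = (\<lambda>s. (1/2) * (g s - g (- s)))"
  have r: "smooth_on {-e<..<e} (\<lambda>s. g (- s))"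
    by (rule smooth_on_compose[OF g]) (auto intro!: smooth_on_intros)
  have p: "smooth_on {-e<..<e} p" and q: "smooth_on {-e<..<e} q"
    unfolding p_def q_def by (auto intro!: smooth_on_intros g r)
  have pa: "expansion p (\<lambda>n. 0)"
    using expansion_cmult[OF expansion_add[OF flat expansion_reflect[OF flat]], of "1/2"] by (simp add: p_def)
  have qa: "expansion q (\<lambda>n. 0)"
    using expansion_cmult[OF expansion_diff[OF flat expansion_reflect[OF flat]], of "1/2"] by (simp add: q_def)
  have g0: "g 0 = 0" using expansion_at_0[OF g _ flat] e by simp
  define G where "G = (\<lambda>x. if 0 < x \<or> odd (2::nat) \<and> x \<noteq> 0 then p (root 2 x) / root 2 x ^ 0 else 0)"
  define H where "H = (\<lambda>x. if 0 < x \<or> odd (2::nat) \<and> x \<noteq> 0 then q (root 2 x) / root 2 x ^ j else 0)"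
  have G: "smooth_on {- (e\<^sup>2)<..<e\<^sup>2} G" unfolding G_def by (rule smooth_on_flat_root[OF p e pa]) simp
  have H: "smooth_on {- (e\<^sup>2)<..<e\<^sup>2} H" unfolding H_def by (rule smooth_on_flat_root[OF q e qa]) simp
  have "g s = G (s\<^sup>2) + s ^ j * H (s\<^sup>2)" for s
  proof (cases "s = 0")
    case True then show ?thesis by (simp add: G_def H_def g0)
  next
    case False
    have r: "root 2 (s\<^sup>2) = \<bar>s\<bar>" by (simp flip: sqrt_def)
    show ?thesis
    proof (cases "s > 0")
      case True
      then show ?thesis using False by (simp add: G_def H_def r p_def q_def field_simps)
    next
      case False
      have "(- s) ^ j = - (s ^ j)" using j by simp
      then show ?thesis using False \<open>s \<noteq> 0\<close> by (simp add: G_def H_def r p_def q_def field_simps)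
    qed
  qed
  moreover have "H 0 = 0" by (simp add: H_def)
  ultimately show ?thesis using that[OF G H] by blast
qed

text \<open>As \<open>j\<close> is odd, for n \<ge> j exactly one of n and n - j is even. For n < j
  every term that occurs is zero.\<close>

lemma semigroup_coeffs_2:
  fixes r :: "nat \<Rightarrow> real"
  assumes "odd j" and "\<And>n. n < j \<Longrightarrow> r n = 0"
  shows "r n = (if 2 dvd n then r (2 * (n div 2)) else 0) +
    (if n < j then 0 else if 2 dvd (n - j) then r (j + 2 * ((n - j) div 2)) else 0)"
  using assms by (cases "n < j") auto

text \<open>The numbers 0, j, 2j represent the three residues modulo 3. The largest number that is
  not in the semigroup generated by 3 and \<open>j\<close> is 5 for j = 4 and 7 for j = 5, and
  \<open>N\<close> is its successor; so every n \<ge> N is at least as large as the representative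
  of its residue.\<close>

lemma semigroup_coeffs_3:
  fixes r :: "nat \<Rightarrow> real"
  assumes "(j, N) \<in> {(4, 6), (5, 8)}" and "\<And>n. n < N \<Longrightarrow> r n = 0"
  shows "r n = (if 3 dvd n then r (3 * (n div 3)) else 0) +
    (if n < j then 0 else if 3 dvd (n - j) then r (j + 3 * ((n - j) div 3)) else 0) +
    (if n < 2 * j then 0 else if 3 dvd (n - 2 * j) then r (2 * j + 3 * ((n - 2 * j) div 3)) else 0)"
proof -
  \<comment> \<open>Adding \<open>2 * k\<close> gives the same residue modulo 3 as subtracting
    \<open>k\<close>, and it removes the truncated subtraction.\<close>
  have a: "(if n < k then 0 else if 3 dvd (n - k) then r (k + 3 * ((n - k) div 3)) else 0) =
    (if 3 dvd (n + 2 * k) \<and> k \<le> n then r n else 0)" for k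
  proof (cases "n < k")
    case False
    then obtain m where m: "n = k + m" using le_Suc_ex by (metis not_less)
    have "3 dvd (k + m + 2 * k) \<longleftrightarrow> 3 dvd m" by presburger
    then show ?thesis using m by auto
  qed auto
  have b: "(if 3 dvd n then r (3 * (n div 3)) else 0) = (if 3 dvd n then r n else 0)" by auto
  show ?thesis unfolding a b
  proof (cases "n < N")
    case True
    then show "r n = (if 3 dvd n then r n else 0) + (if 3 dvd (n + 2 * j) \<and> j \<le> n then r n else 0) +
      (if 3 dvd (n + 2 * (2 * j)) \<and> 2 * j \<le> n then r n else 0)" using assms(2) by simp
  next
    case False
    have "j = 4 \<and> N = 6 \<or> j = 5 \<and> N = 8" using assms(1) by auto
    then have "3 dvd n \<and> \<not> 3 dvd (n + 2 * j) \<and> \<not> 3 dvd (n + 2 * (2 * j))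
      \<or> \<not> 3 dvd n \<and> 3 dvd (n + 2 * j) \<and> j \<le> n \<and> \<not> 3 dvd (n + 2 * (2 * j))
      \<or> \<not> 3 dvd n \<and> \<not> 3 dvd (n + 2 * j) \<and> 3 dvd (n + 2 * (2 * j)) \<and> 2 * j \<le> n"
      using False by presburger
    then show "r n = (if 3 dvd n then r n else 0) + (if 3 dvd (n + 2 * j) \<and> j \<le> n then r n else 0) +
      (if 3 dvd (n + 2 * (2 * j)) \<and> 2 * j \<le> n then r n else 0)" by (elim disjE conjE) simp_all
  qed
qed

lemma smooth_on_intervalE:
  fixes f :: "real \<Rightarrow> 'b::real_normed_vector"
  assumes "smooth_on S f" "0 \<in> S"
  obtains e where "e > 0" "{-e<..<e} \<subseteq> S" "smooth_on {-e<..<e} f"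
proof -
  obtain e where "e > 0" "ball 0 e \<subseteq> S" using smooth_on_imp_open[OF assms(1)] assms(2) openE by blast
  moreover have "ball 0 e = {-e<..<e}" by (auto simp: dist_real_def)
  ultimately show ?thesis using that[of e] smooth_on_subset[OF assms(1)] by auto
qed

section \<open>Division by powers of the first coordinate, and the resulting change of
  coordinates\<close>

text \<open>Borel's lemma realizes the even Taylor coefficients of \<open>Y s - s ^ j\<close> by
  \<open>A\<close>, and the odd ones by \<open>B\<close>; the difference is flat and
  \<open>flat_square\<close> distributes it. The remainder starts after degree \<open>j\<close>,
  which gives \<open>B 0 = 1\<close>.\<close>

lemma preparation_2:
  fixes Y :: "real \<Rightarrow> real"
  assumes Y: "smooth_on S Y" and S: "0 \<in> S" and j: "odd j"
    and R: "(\<lambda>s. Y s - s ^ j) \<in> O[at 0](\<lambda>s. s ^ Suc j)"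
  obtains e A B where "e > 0" "smooth_on {- (e\<^sup>2)<..<e\<^sup>2} A" "smooth_on {- (e\<^sup>2)<..<e\<^sup>2} B" "B 0 = 1"
    "\<And>s. s \<in> {-e<..<e} \<Longrightarrow> Y s = A (s\<^sup>2) + s ^ j * B (s\<^sup>2)"
proof -
  define R where "R = (\<lambda>s. Y s - s ^ j)"
  have Rs: "smooth_on S R" unfolding R_def by (intro smooth_on_intros Y smooth_on_imp_open[OF Y])
  obtain r where r: "expansion R r" using smooth_on_expansion_deriv[OF Rs S] by blast
  have r0: "r n = 0" if "n < Suc j" for n by (rule expansion_bigo[OF r _ that]) (use assms(4) in \<open>simp only: R_def\<close>)
  obtain A where A: "smooth_on UNIV A" "expansion A (\<lambda>k. r (2 * k))" using Borel_lemma by blast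
  obtain B where B: "smooth_on UNIV B" "expansion B (\<lambda>k. r (j + 2 * k))" using Borel_lemma by blast
  define g where "g = (\<lambda>s. R s - (A (s ^ 2) + s ^ j * B (s ^ 2)))"
  have "expansion g (\<lambda>n. r n - ((if 2 dvd n then r (2 * (n div 2)) else 0) +
    (if n < j then 0 else if 2 dvd (n - j) then r (j + 2 * ((n - j) div 2)) else 0)))"
    unfolding g_def
    by (intro expansion_diff r expansion_add expansion_power_mult expansion_subst_power[OF A(2)] expansion_subst_power[OF B(2)]) auto
  moreover have "r n = 0" if "n < j" for n using r0 that by simp
  ultimately have flat: "expansion g (\<lambda>n. 0)"
    by (simp only: semigroup_coeffs_2[OF j, of r, symmetric] diff_self)
  have g: "smooth_on S g" unfolding g_def
    by (intro smooth_on_intros Rs smooth_on_compose[OF A(1)] smooth_on_compose[OF B(1)] smooth_on_imp_open[OF Y]) auto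
  obtain e where e: "e > 0" "{-e<..<e} \<subseteq> S" "smooth_on {-e<..<e} g" using smooth_on_intervalE[OF g S] by blast
  obtain G H where G: "smooth_on {- (e\<^sup>2)<..<e\<^sup>2} G" "smooth_on {- (e\<^sup>2)<..<e\<^sup>2} H" "H 0 = 0"
    "\<And>s. s \<in> {-e<..<e} \<Longrightarrow> g s = G (s\<^sup>2) + s ^ j * H (s\<^sup>2)"
    using flat_square[OF e(3,1) flat j] by blast
  show ?thesis
  proof (rule that[OF e(1), of "\<lambda>x. A x + G x" "\<lambda>x. 1 + (B x + H x)"])
    show "smooth_on {- (e\<^sup>2)<..<e\<^sup>2} (\<lambda>x. A x + G x)"
      by (intro smooth_on_intros G smooth_on_subset[OF A(1)]) auto
    show "smooth_on {- (e\<^sup>2)<..<e\<^sup>2} (\<lambda>x. 1 + (B x + H x))"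
      by (intro smooth_on_intros G smooth_on_subset[OF B(1)]) auto
    show "1 + (B 0 + H 0) = 1" using G(3) expansion_at_0[OF B(1) _ B(2)] r0[of j] by simp
    show "Y s = A (s\<^sup>2) + G (s\<^sup>2) + s ^ j * (1 + (B (s\<^sup>2) + H (s\<^sup>2)))" if "s \<in> {-e<..<e}" for s
      using G(4)[OF that] by (simp add: g_def R_def algebra_simps)
  qed
qed

text \<open>Here the Taylor coefficients are sorted by residue modulo 3, whence the three functions.
  The flat difference is put entirely into \<open>A\<close>, since the cube root is defined on both
  sides of 0. \<open>N > j\<close> again yields \<open>B 0 = 1\<close>.\<close>

lemma preparation_3:
  fixes Y :: "real \<Rightarrow> real"
  assumes Y: "smooth_on S Y" and S: "0 \<in> S" and j: "(j, N) \<in> {(4, 6), (5, 8)}"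
    and R: "(\<lambda>s. Y s - s ^ j) \<in> O[at 0](\<lambda>s. s ^ N)"
  obtains e A B C where "e > 0" "smooth_on {- (e ^ 3)<..<e ^ 3} A" "smooth_on {- (e ^ 3)<..<e ^ 3} B"
    "smooth_on {- (e ^ 3)<..<e ^ 3} C" "B 0 = 1"
    "\<And>s. s \<in> {-e<..<e} \<Longrightarrow> Y s = A (s ^ 3) + s ^ j * B (s ^ 3) + s ^ (2 * j) * C (s ^ 3)"
proof -
  define R where "R = (\<lambda>s. Y s - s ^ j)"
  have Rs: "smooth_on S R" unfolding R_def by (intro smooth_on_intros Y smooth_on_imp_open[OF Y])
  obtain r where r: "expansion R r" using smooth_on_expansion_deriv[OF Rs S] by blast
  have r0: "r n = 0" if "n < N" for n by (rule expansion_bigo[OF r _ that]) (use assms(4) in \<open>simp only: R_def\<close>)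
  obtain A where A: "smooth_on UNIV A" "expansion A (\<lambda>k. r (3 * k))" using Borel_lemma by blast
  obtain B where B: "smooth_on UNIV B" "expansion B (\<lambda>k. r (j + 3 * k))" using Borel_lemma by blast
  obtain C where C: "smooth_on UNIV C" "expansion C (\<lambda>k. r (2 * j + 3 * k))" using Borel_lemma by blast
  define g where "g = (\<lambda>s. R s - (A (s ^ 3) + s ^ j * B (s ^ 3) + s ^ (2 * j) * C (s ^ 3)))"
  have "expansion g (\<lambda>n. r n - ((if 3 dvd n then r (3 * (n div 3)) else 0) +
    (if n < j then 0 else if 3 dvd (n - j) then r (j + 3 * ((n - j) div 3)) else 0) +
    (if n < 2 * j then 0 else if 3 dvd (n - 2 * j) then r (2 * j + 3 * ((n - 2 * j) div 3)) else 0)))"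
    unfolding g_def
    by (intro expansion_diff r expansion_add expansion_power_mult expansion_subst_power[OF A(2)] expansion_subst_power[OF B(2)]
        expansion_subst_power[OF C(2)]) auto
  then have flat: "expansion g (\<lambda>n. 0)"
    by (simp only: semigroup_coeffs_3[OF j, of r, OF r0, symmetric] diff_self)
  have g: "smooth_on S g" unfolding g_def
    by (intro smooth_on_intros Rs smooth_on_compose[OF A(1)] smooth_on_compose[OF B(1)]
        smooth_on_compose[OF C(1)] smooth_on_imp_open[OF Y]) auto
  obtain e where e: "e > 0" "{-e<..<e} \<subseteq> S" "smooth_on {-e<..<e} g" using smooth_on_intervalE[OF g S] by blast
  obtain G where G: "smooth_on {- (e ^ 3)<..<e ^ 3} G" "\<And>s. s \<in> {-e<..<e} \<Longrightarrow> g s = G (s ^ 3)"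
    using flat_odd_power[OF e(3,1) flat, of 3] by auto
  show ?thesis
  proof (rule that[OF e(1), of "\<lambda>x. A x + G x" "\<lambda>x. 1 + B x" C])
    show "smooth_on {- (e ^ 3)<..<e ^ 3} (\<lambda>x. A x + G x)"
      by (intro smooth_on_intros G smooth_on_subset[OF A(1)]) auto
    show "smooth_on {- (e ^ 3)<..<e ^ 3} (\<lambda>x. 1 + B x)"
      by (intro smooth_on_intros smooth_on_subset[OF B(1)]) auto
    show "smooth_on {- (e ^ 3)<..<e ^ 3} C" by (rule smooth_on_subset[OF C(1)]) auto
    show "1 + B 0 = 1" using expansion_at_0[OF B(1) _ B(2)] r0[of j] j by auto
    show "Y s = A (s ^ 3) + G (s ^ 3) + s ^ j * (1 + B (s ^ 3)) + s ^ (2 * j) * C (s ^ 3)" if "s \<in> {-e<..<e}" for s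
      using G(2)[OF that] by (simp add: g_def R_def algebra_simps)
  qed
qed

text \<open>With \<open>d = B\<^sup>2 + 4 C (y - A)\<close> the quadratic equation \<open>y = A + B w + C w\<^sup>2\<close> is solved near
  \<open>w = 0\<close> by \<open>w = 2 (y - A) / (B + sqrt d)\<close>, which makes sense also where \<open>C\<close> vanishes.\<close>

lemma diffeo_on_quadratic:
  fixes A B C :: "real \<Rightarrow> real"
  assumes A: "smooth_on E A" and B: "smooth_on E B" and C: "smooth_on E C" and pos: "\<And>x. x \<in> E \<Longrightarrow> B x > 0"
  shows "diffeo_on {p. fst p \<in> E \<and> B (fst p) + 2 * snd p * C (fst p) > 0}
    (\<lambda>p. (fst p, A (fst p) + snd p * B (fst p) + (snd p)\<^sup>2 * C (fst p)))"
proof -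
  note E = smooth_on_imp_open[OF A]
  define d where "d = (\<lambda>p. (B (fst p))\<^sup>2 + 4 * C (fst p) * (snd p - A (fst p)))"
  define U where "U = {p. fst p \<in> E \<and> B (fst p) + 2 * snd p * C (fst p) > 0}"
  define V where "V = {p. fst p \<in> E \<and> d p > 0}"
  define \<psi> where "\<psi> = (\<lambda>p. (fst p, 2 * (snd p - A (fst p)) / (B (fst p) + d p powr (1/2))))"
  have oE: "open (E \<times> (UNIV :: real set))" using E by (intro open_Times) auto
  have c: "smooth_on (E \<times> UNIV) (\<lambda>p::real\<times>real. F (fst p))" if "smooth_on E F" for F :: "real \<Rightarrow> real"
    by (rule smooth_on_compose[OF that smooth_on_fst[OF smooth_on_ident[OF oE]]]) auto
  note sm = smooth_on_intros oE c[OF A] c[OF B] c[OF C]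
  have ds: "smooth_on (E \<times> UNIV) d" unfolding d_def by (intro sm)
  have Us: "smooth_on (E \<times> UNIV) (\<lambda>p. B (fst p) + 2 * snd p * C (fst p))" by (intro sm)
  have \<phi>s: "smooth_on (E \<times> UNIV) (\<lambda>p. (fst p, A (fst p) + snd p * B (fst p) + (snd p)\<^sup>2 * C (fst p)))" by (intro sm)
  have U: "open U" "U \<subseteq> E \<times> UNIV"
  proof -
    have "U = (E \<times> UNIV) \<inter> (\<lambda>p. B (fst p) + 2 * snd p * C (fst p)) -` {0<..}" by (auto simp: U_def)
    then show "open U" using continuous_open_preimage[OF smooth_on_imp_continuous_on[OF Us] oE] by auto
  qed (auto simp: U_def)
  have V: "open V" "V \<subseteq> E \<times> UNIV"
  proof -
    have "V = (E \<times> UNIV) \<inter> d -` {0<..}" by (auto simp: V_def)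
    then show "open V" using continuous_open_preimage[OF smooth_on_imp_continuous_on[OF ds] oE] by auto
  qed (auto simp: V_def)
  have "smooth_on V (\<lambda>p. B (fst p) + d p powr (1/2))"
    by (intro smooth_on_add smooth_on_powr_comp smooth_on_subset[OF c[OF B] V] smooth_on_subset[OF ds V])
      (auto simp: V_def)
  moreover have "smooth_on V (\<lambda>p. 2 * (snd p - A (fst p)))"
    by (intro smooth_on_subset[OF _ V] sm)
  ultimately have \<psi>s: "smooth_on V \<psi>" unfolding \<psi>_def
    by (intro smooth_on_Pair smooth_on_divide smooth_on_fst smooth_on_ident V)
      (auto simp: V_def intro!: add_pos_nonneg pos)
  show ?thesis
  proof (fold U_def, rule diffeo_onI[OF U(1) V(1) smooth_on_subset[OF \<phi>s U] \<psi>s], goal_cases)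
    case (1 p)
    obtain x w where p: "p = (x, w)" by (cases p)
    define y where "y = A x + w * B x + w\<^sup>2 * C x"
    have x: "x \<in> E" and q: "B x + 2 * w * C x > 0" using 1 by (auto simp: U_def p)
    \<comment> \<open>On the image the discriminant is a perfect square, and \<open>U\<close>
      requires its root \<open>B + 2 w C\<close> to be positive; so the positive square root selects
      the right branch.\<close>
    have dq: "d (x, y) = (B x + 2 * w * C x)\<^sup>2" by (simp add: d_def y_def power2_eq_square algebra_simps)
    have "d (x, y) powr (1/2) = B x + 2 * w * C x" using q by (simp add: dq powr_half_sqrt)
    moreover have "B x + w * C x > 0" using q pos[OF x] by simp
    ultimately have "2 * (y - A x) / (B x + d (x, y) powr (1/2)) = w"
      by (simp add: y_def field_simps power2_eq_square)
    then show ?case using x q by (auto simp: p V_def \<psi>_def dq y_def[symmetric])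
  next
    case (2 p)
    obtain x y where p: "p = (x, y)" by (cases p)
    define \<rho> where "\<rho> = d (x, y) powr (1/2)"
    define w where "w = 2 * (y - A x) / (B x + \<rho>)"
    have x: "x \<in> E" and q: "d (x, y) > 0" using 2 by (auto simp: V_def p)
    have \<rho>: "\<rho> > 0" "\<rho>\<^sup>2 = d (x, y)" using q by (auto simp: \<rho>_def powr_half_sqrt)
    have B\<rho>: "B x + \<rho> > 0" using pos[OF x] \<rho> by simp
    have "4 * C x * (y - A x) = (\<rho> - B x) * (B x + \<rho>)"
      using \<rho>(2) by (simp add: d_def power2_eq_square algebra_simps)
    then have w: "2 * w * C x = \<rho> - B x" using B\<rho> by (simp add: w_def field_simps)
    have "w * B x + w\<^sup>2 * C x = w * (B x + \<rho>) / 2"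
    proof -
      have "w * B x + w\<^sup>2 * C x = w * (B x + (2 * w * C x) / 2)" by (simp add: power2_eq_square algebra_simps)
      then show ?thesis unfolding w by (simp add: field_simps)
    qed
    also have "\<dots> = y - A x" using B\<rho> by (simp add: w_def)
    finally have "A x + w * B x + w\<^sup>2 * C x = y" by simp
    moreover have "\<psi> p = (x, w)" by (simp add: p \<psi>_def \<rho>_def w_def)
    ultimately show ?case using x w \<rho>(1) by (simp add: p U_def)
  qed
qed

text \<open>The equation for \<open>Y\<close> says that the target map of
  \<open>diffeo_on_quadratic\<close> carries the model to the curve without changing the parameter.
  \<open>B 0 = 1\<close> puts the origin into the domain of that map. It leads from the model to the
  curve, hence the use of symmetry.\<close>

lemma A_equiv_quadratic:
  fixes A B C :: "real \<Rightarrow> real"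
  assumes e: "e > 0" and i: "i > 0" and j: "j > 0" and A: "smooth_on {- (e ^ i)<..<e ^ i} A"
    and B: "smooth_on {- (e ^ i)<..<e ^ i} B" and C: "smooth_on {- (e ^ i)<..<e ^ i} C" and B0: "B 0 = 1"
    and Y: "\<And>s. s \<in> {-e<..<e} \<Longrightarrow> Y s = A (s ^ i) + s ^ j * B (s ^ i) + s ^ (2 * j) * C (s ^ i)"
  shows "A_equiv (\<lambda>s. (s ^ i, Y s)) 0 (\<lambda>s. (s ^ i, s ^ j)) 0"
proof (rule A_equiv_sym)
  define E where "E = {- (e ^ i)<..<e ^ i} \<inter> B -` {0<..}"
  have E: "open E" unfolding E_def
    by (rule continuous_open_preimage[OF smooth_on_imp_continuous_on[OF B]]) auto
  have sub: "E \<subseteq> {- (e ^ i)<..<e ^ i}" by (auto simp: E_def)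
  let ?V = "{p. fst p \<in> E \<and> B (fst p) + 2 * snd p * C (fst p) > 0}"
  have diff: "diffeo_on ?V (\<lambda>p. (fst p, A (fst p) + snd p * B (fst p) + (snd p)\<^sup>2 * C (fst p)))"
    by (rule diffeo_on_quadratic; (rule smooth_on_subset[OF _ E sub], fact)?) (auto simp: E_def)
  have op: "open ?V" using diff by (simp add: diffeo_on_def)
  have "open ((\<lambda>s::real. (s ^ i, s ^ j)) -` ?V \<inter> {-e<..<e})"
    using op by (intro open_Int open_vimage) (auto intro!: continuous_intros)
  then show "A_equiv (\<lambda>s. (s ^ i, s ^ j)) 0 (\<lambda>s. (s ^ i, Y s)) 0"
    by (rule A_equiv_target[OF _ diff]) (use e i j B0 Y in \<open>auto simp: E_def power_mult mult.commute[of 2] zero_power\<close>)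
qed

lemma A_equiv_cusp_2:
  fixes Y :: "real \<Rightarrow> real"
  assumes "smooth_on S Y" "0 \<in> S" "odd j" "(\<lambda>s. Y s - s ^ j) \<in> O[at 0](\<lambda>s. s ^ Suc j)"
  shows "A_equiv (\<lambda>s. (s ^ 2, Y s)) 0 (\<lambda>s. (s ^ 2, s ^ j)) 0"
proof -
  obtain e A B where e: "e > 0" and A: "smooth_on {- (e\<^sup>2)<..<e\<^sup>2} A" and B: "smooth_on {- (e\<^sup>2)<..<e\<^sup>2} B"
    and B0: "B 0 = 1" and Y: "\<And>s. s \<in> {-e<..<e} \<Longrightarrow> Y s = A (s\<^sup>2) + s ^ j * B (s\<^sup>2)"
    using preparation_2[OF assms] by blast
  have "j > 0" using assms(3) by (cases j) auto
  then show ?thesis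
    by (intro A_equiv_quadratic[OF e _ _ A B smooth_on_const[of _ 0] B0]) (use Y in auto)
qed

lemma A_equiv_cusp_3:
  fixes Y :: "real \<Rightarrow> real"
  assumes "smooth_on S Y" "0 \<in> S" "(j, N) \<in> {(4, 6), (5, 8)}" "(\<lambda>s. Y s - s ^ j) \<in> O[at 0](\<lambda>s. s ^ N)"
  shows "A_equiv (\<lambda>s. (s ^ 3, Y s)) 0 (\<lambda>s. (s ^ 3, s ^ j)) 0"
proof -
  obtain e A B C where e: "e > 0" and A: "smooth_on {- (e ^ 3)<..<e ^ 3} A" and B: "smooth_on {- (e ^ 3)<..<e ^ 3} B"
    and C: "smooth_on {- (e ^ 3)<..<e ^ 3} C"
    and B0: "B 0 = 1" and Y: "\<And>s. s \<in> {-e<..<e} \<Longrightarrow> Y s = A (s ^ 3) + s ^ j * B (s ^ 3) + s ^ (2 * j) * C (s ^ 3)"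
    using preparation_3[OF assms] by blast
  show ?thesis
    by (rule A_equiv_quadratic[OF e _ _ A B C B0 Y]) (use assms(3) in auto)
qed

section \<open>Removal of the last gap of the semigroup, and the normal form\<close>

text \<open>The remainder and its first derivative vanish at 0. The bound has explicit constants and
  includes v = 0, because it is applied to a function of \<open>s\<close> that may vanish for s
  \<noteq> 0; composition along the punctured filter would not cover that.\<close>

lemma powr_linear_bound:
  fixes \<alpha> :: real
  obtains C \<delta> where "C \<ge> 0" "\<delta> > 0" "\<And>v. \<bar>v\<bar> < \<delta> \<Longrightarrow> \<bar>(1 + v) powr \<alpha> - 1 - \<alpha> * v\<bar> \<le> C * v\<^sup>2"
proof -
  define f where "f = (\<lambda>v. (1 + v) powr \<alpha> - 1 - \<alpha> * v)"
  have f: "smooth_on {-1<..} f" unfolding f_def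
    by (intro smooth_on_intros smooth_on_powr_comp) auto
  obtain c where c: "expansion f c" using smooth_on_expansion_deriv[OF f] by auto
  have "(f has_real_derivative 0) (at 0)" unfolding f_def
    by (auto intro!: derivative_eq_intros)
  then have d: "deriv f 0 = 0" by (rule DERIV_imp_deriv)
  have c0: "c 0 = 0" using expansion_at_0[OF f _ c] by (simp add: f_def)
  have c1: "c 1 = 0" using expansion_at_0[OF smooth_on_deriv(1)[OF f] _ expansion_deriv[OF f _ c]] d by simp
  have "f \<in> O[at 0](\<lambda>v. v ^ 2)" using c0 c1 by (auto simp: expansion_bigo_iff[OF c] less_2_cases_iff)
  then obtain C where C: "C > 0" "eventually (\<lambda>v. norm (f v) \<le> C * norm (v ^ 2)) (at 0)"
    using landau_o.bigE by blast
  then obtain \<delta> where "\<delta> > 0" "\<And>v. v \<noteq> 0 \<Longrightarrow> \<bar>v\<bar> < \<delta> \<Longrightarrow> \<bar>f v\<bar> \<le> C * v\<^sup>2"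
    unfolding eventually_at by auto
  moreover have "\<bar>f 0\<bar> \<le> C * 0\<^sup>2" by (simp add: f_def)
  ultimately have "\<And>v. \<bar>v\<bar> < \<delta> \<Longrightarrow> \<bar>f v\<bar> \<le> C * v\<^sup>2" by metis
  then show ?thesis using that[of C \<delta>] C(1) \<open>\<delta> > 0\<close> by (simp add: f_def)
qed

lemma bigo_power_cancel:
  fixes f :: "real \<Rightarrow> real"
  assumes "(\<lambda>s. s ^ k * f s) \<in> O[at 0](\<lambda>s. s ^ (k + n))"
  shows "f \<in> O[at 0](\<lambda>s. s ^ n)"
proof -
  obtain C where C: "eventually (\<lambda>s. norm (s ^ k * f s) \<le> C * norm (s ^ (k + n))) (at 0)"
    using landau_o.bigE[OF assms] by blast
  show ?thesis
  proof (rule bigoI[of _ C])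
    show "eventually (\<lambda>s. norm (f s) \<le> C * norm (s ^ n)) (at 0)"
      using C eventually_power_nonzero[of k]
      by eventually_elim (simp add: abs_mult power_add mult.left_commute del: power_eq_0_iff)
  qed
qed

lemma bigo_power_mult:
  fixes f :: "real \<Rightarrow> real"
  assumes "f \<in> O[at 0](\<lambda>s. s ^ n)"
  shows "(\<lambda>s. s ^ k * f s) \<in> O[at 0](\<lambda>s. s ^ (k + n))"
  unfolding power_add by (intro landau_o.big.mult assms) auto

text \<open>The gap \<open>j + m\<close> of the semigroup generated by \<open>3\<close> and \<open>j = 3 + m\<close> is removed by passing to the
  parameter \<open>\<sigma>\<close> with \<open>\<sigma> ^ 3 = s ^ 3 + p * Y s\<close>: then \<open>\<sigma> ^ j = s ^ j + (j / 3) * p * s ^ (j + m) + \<dots>\<close>.\<close>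

lemma A_equiv_cusp_3_gap:
  fixes Y :: "real \<Rightarrow> real"
  assumes Y: "smooth_on S Y" and S: "0 \<in> S" and m: "m \<ge> 1" and j: "j = 3 + m" and N: "(j, j + m + 1) \<in> {(4, 6), (5, 8)}"
    and Yc: "(\<lambda>s. Y s - s ^ j - c * s ^ (j + m)) \<in> O[at 0](\<lambda>s. s ^ (j + m + 1))"
  shows "A_equiv (\<lambda>s. (s ^ 3, Y s)) 0 (\<lambda>s. (s ^ 3, s ^ j)) 0"
proof -
  \<comment> \<open>Chosen so that \<open>j / 3 * p = c\<close>: then \<open>\<sigma> ^ j\<close>
    and \<open>Y\<close> have the same coefficient in degree \<open>j + m\<close>.\<close>
  define p where "p = 3 * c / real j"
  define X where "X = (\<lambda>s. s ^ 3 + p * Y s)"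
  define v where "v = (\<lambda>s. p * Y s / s ^ 3)"
  have Xs: "smooth_on S X" unfolding X_def by (intro smooth_on_intros Y smooth_on_imp_open[OF Y])
  have "(\<lambda>s. c * s ^ (j + m)) \<in> O[at 0](\<lambda>s. s ^ (j + 1))"
    using power_bigo_power[of "j + 1" "j + m"] m by simp
  then have "(\<lambda>s. (Y s - s ^ j - c * s ^ (j + m)) + c * s ^ (j + m)) \<in> O[at 0](\<lambda>s. s ^ (j + 1))"
    by (intro sum_in_bigo(1) bigo_power_weaken[OF Yc]) auto
  then have Yj: "(\<lambda>s. p * (Y s - s ^ j)) \<in> O[at 0](\<lambda>s. s ^ (3 + (m + 1)))" by (simp add: j)
  have v1: "(\<lambda>s. v s - p * s ^ m) \<in> O[at 0](\<lambda>s. s ^ (m + 1))"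
  proof (rule bigo_power_cancel[of 3])
    have "eventually (\<lambda>s::real. p * (Y s - s ^ j) = s ^ 3 * (v s - p * s ^ m)) (at 0)"
      using eventually_power_nonzero[of 1] by eventually_elim (simp add: v_def j field_simps power_add)
    then show "(\<lambda>s. s ^ 3 * (v s - p * s ^ m)) \<in> O[at 0](\<lambda>s. s ^ (3 + (m + 1)))"
      by (rule bigo_eventually_cong[OF Yj])
  qed
  have "(\<lambda>s. (v s - p * s ^ m) + p * s ^ m) \<in> O[at 0](\<lambda>s. s ^ m)"
    by (intro sum_in_bigo(1) bigo_power_weaken[OF v1]) auto
  then have vm: "v \<in> O[at 0](\<lambda>s. s ^ m)" by simp
  have v0: "(v \<longlongrightarrow> 0) (at 0)"
    using bigo_Suc_imp_tendsto_0[of v 0] bigo_power_weaken[OF vm, of "Suc 0"] m by simp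
  have Xv: "eventually (\<lambda>s. X s / s ^ 3 = 1 + v s) (at 0)"
    using eventually_power_nonzero[of 3] by eventually_elim (simp add: X_def v_def add_divide_distrib)
  have "((\<lambda>s. 1 + v s) \<longlongrightarrow> 1) (at 0)" using tendsto_add[OF tendsto_const[of 1] v0] by simp
  then have lim: "((\<lambda>s. X s / s ^ 3) \<longlongrightarrow> 1) (at 0)"
    by (rule Lim_transform_eventually) (use Xv in eventually_elim, simp)
  obtain U \<sigma> T Z where U: "0 \<in> U" "smooth_on U \<sigma>" "((\<lambda>t. \<sigma> t / t) \<longlongrightarrow> 1) (at 0)"
    and \<sigma>: "\<And>t. t \<in> U \<Longrightarrow> t \<noteq> 0 \<Longrightarrow> \<sigma> t = t * (X t / t ^ 3) powr (1 / real 3)"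
      "\<And>t. t \<in> U \<Longrightarrow> t \<noteq> 0 \<Longrightarrow> X t / t ^ 3 > 0"
    and T: "0 \<in> T" "smooth_on T Z" and eq: "A_equiv (\<lambda>t. (X t, Y t)) 0 (\<lambda>s. (s ^ 3, Z s)) 0"
    and tr: "\<And>j N. (\<lambda>t. Y t - \<sigma> t ^ j) \<in> O[at 0](\<lambda>t. t ^ N) \<Longrightarrow> (\<lambda>s. Z s - s ^ j) \<in> O[at 0](\<lambda>s. s ^ N)"
    by (rule reparametrize_power[OF Xs Y S zero_less_numeral lim]) (rule that)
  define \<alpha> where "\<alpha> = real j / 3"
  have \<alpha>p: "\<alpha> * p = c" using j by (simp add: \<alpha>_def p_def)
  obtain C \<delta> where C: "C \<ge> 0" "\<delta> > 0" "\<And>v. \<bar>v\<bar> < \<delta> \<Longrightarrow> \<bar>(1 + v) powr \<alpha> - 1 - \<alpha> * v\<bar> \<le> C * v\<^sup>2"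
    using powr_linear_bound[of \<alpha>] by blast
  have q1: "(\<lambda>s. (1 + v s) powr \<alpha> - 1 - \<alpha> * v s) \<in> O[at 0](\<lambda>s. s ^ (m + 1))"
  proof -
    have "(\<lambda>s. (1 + v s) powr \<alpha> - 1 - \<alpha> * v s) \<in> O[at 0](\<lambda>s. (v s)\<^sup>2)"
    proof (rule bigoI[of _ C])
      have "eventually (\<lambda>s. \<bar>v s\<bar> < \<delta>) (at 0)" using tendstoD[OF v0 C(2)] by (simp add: dist_real_def)
      then show "eventually (\<lambda>s. norm ((1 + v s) powr \<alpha> - 1 - \<alpha> * v s) \<le> C * norm ((v s)\<^sup>2)) (at 0)"
        by eventually_elim (use C(3) in simp)
    qed
    also have "(\<lambda>s. (v s)\<^sup>2) \<in> O[at 0](\<lambda>s. (s ^ m)\<^sup>2)" by (rule landau_o.big_power[OF vm])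
    also have "(\<lambda>s::real. (s ^ m)\<^sup>2) \<in> O[at 0](\<lambda>s. s ^ (m + 1))"
      unfolding power_mult[symmetric] by (rule power_bigo_power) (use m in simp)
    finally show ?thesis .
  qed
  have \<sigma>j: "eventually (\<lambda>s. \<sigma> s ^ j = s ^ j * (1 + v s) powr \<alpha>) (at 0)"
    using Xv eventually_at_in_open[OF smooth_on_imp_open[OF U(2)] U(1)]
  proof eventually_elim
    case (elim s)
    then have "1 + v s > 0" "\<sigma> s = s * (1 + v s) powr (1 / 3)" using \<sigma>[of s] by auto
    then show ?case by (simp add: power_mult_distrib powr_powr \<alpha>_def flip: powr_realpow)
  qed
  have "(\<lambda>s. \<alpha> * (s ^ j * (v s - p * s ^ m))) \<in> O[at 0](\<lambda>s. s ^ (j + (m + 1)))"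
    using bigo_power_mult[OF v1, of j] by simp
  \<comment> \<open>Three errors make up \<open>Y - \<sigma> ^ j\<close>: the remainder of
    \<open>Y\<close>, the quadratic remainder of the power of \<open>1 + v\<close>, and the
    deviation of \<open>v\<close> from \<open>p * s ^ m\<close>. The terms in \<open>c\<close>
    cancel because \<open>\<alpha> * p = c\<close>.\<close>
  from sum_in_bigo(2)[OF sum_in_bigo(2)[OF Yc[unfolded add.assoc] bigo_power_mult[OF q1, of j]] this]
  have "(\<lambda>s. (Y s - s ^ j - c * s ^ (j + m)) - s ^ j * ((1 + v s) powr \<alpha> - 1 - \<alpha> * v s)
      - \<alpha> * (s ^ j * (v s - p * s ^ m))) \<in> O[at 0](\<lambda>s. s ^ (j + (m + 1)))" .
  moreover have "eventually (\<lambda>s. (Y s - s ^ j - c * s ^ (j + m)) - s ^ j * ((1 + v s) powr \<alpha> - 1 - \<alpha> * v s)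
      - \<alpha> * (s ^ j * (v s - p * s ^ m)) = Y s - \<sigma> s ^ j) (at 0)"
    using \<sigma>j by eventually_elim (simp add: \<alpha>p[symmetric] algebra_simps power_add)
  ultimately have "(\<lambda>s. Y s - \<sigma> s ^ j) \<in> O[at 0](\<lambda>s. s ^ (j + (m + 1)))" by (rule bigo_eventually_cong)
  from tr[OF this] have "(\<lambda>s. Z s - s ^ j) \<in> O[at 0](\<lambda>s. s ^ (j + m + 1))" by (simp add: add.assoc)
  then have "A_equiv (\<lambda>s. (s ^ 3, Z s)) 0 (\<lambda>s. (s ^ 3, s ^ j)) 0" by (rule A_equiv_cusp_3[OF T(2,1) N])
  moreover have "A_equiv (\<lambda>s. (s ^ 3, Y s)) 0 (\<lambda>t. (X t, Y t)) 0"
  proof (rule A_equiv_target[of UNIV UNIV "\<lambda>w. (fst w + p * snd w, snd w)"])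
    show "diffeo_on UNIV (\<lambda>w. (fst w + p * snd w, snd w))"
      by (rule diffeo_onI[of _ UNIV _ "\<lambda>w. (fst w - p * snd w, snd w)"]) (auto intro!: smooth_on_Pair smooth_on_intros)
  qed (auto simp: X_def)
  ultimately show ?thesis using A_equiv_trans[OF _ A_equiv_trans[OF eq]] by blast
qed

lemma A_equiv_shear:
  fixes X Y :: "real \<Rightarrow> real"
  shows "A_equiv (\<lambda>s. (X s, Y s)) 0 (\<lambda>s. (X s, Y s - q * (X s)\<^sup>2)) 0"
proof (rule A_equiv_target[of UNIV UNIV "\<lambda>w. (fst w, snd w - q * (fst w)\<^sup>2)"])
  show "diffeo_on UNIV (\<lambda>w. (fst w, snd w - q * (fst w)\<^sup>2))"
    by (rule diffeo_onI[of _ UNIV _ "\<lambda>w. (fst w, snd w + q * (fst w)\<^sup>2)"]) (auto intro!: smooth_on_Pair smooth_on_intros)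
qed auto

lemma A_equiv_scale:
  fixes X Y :: "real \<Rightarrow> real"
  assumes "k \<noteq> 0" "l \<noteq> 0"
  shows "A_equiv (\<lambda>s. (X s, Y s)) 0 (\<lambda>s. (X s / k, Y s / l)) 0"
proof (rule A_equiv_target[of UNIV UNIV "\<lambda>w. (fst w / k, snd w / l)"])
  show "diffeo_on UNIV (\<lambda>w. (fst w / k, snd w / l))"
    by (rule diffeo_onI[of _ UNIV _ "\<lambda>w. (fst w * k, snd w * l)"])
      (use assms in \<open>auto intro!: smooth_on_Pair smooth_on_intros\<close>)
qed auto

text \<open>Once the first coordinate is \<open>s ^ i\<close>, only degrees above \<open>j\<close>
  that are gaps of the semigroup can obstruct: none for i = 2, degree 5 for (3, 4), degree 7 for (3,
  5). In the last case degree 6 is no gap but lies below the bound 8; being a multiple of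
  \<open>(s ^ 3)\<^sup>2\<close>, that term is removed by a shear.\<close>

theorem curve_normal_form:
  fixes X Y :: "real \<Rightarrow> real"
  assumes X: "smooth_on S X" and Y: "smooth_on S Y" and S: "0 \<in> S"
    and ij: "(i, j) \<in> {(2, 3), (2, 5), (3, 4), (3, 5)}"
    and limX: "((\<lambda>t. X t / t ^ i) \<longlongrightarrow> k) (at 0)" "k \<noteq> 0"
    and limY: "((\<lambda>t. Y t / t ^ j) \<longlongrightarrow> l) (at 0)" "l \<noteq> 0"
  shows "A_equiv (\<lambda>t. (X t, Y t)) 0 (\<lambda>t. (t ^ i, t ^ j)) 0"
proof -
  have X': "smooth_on S (\<lambda>t. X t / k)" and Y': "smooth_on S (\<lambda>t. Y t / l)"
    by (intro smooth_on_intros X Y)+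
  have limX': "((\<lambda>t. X t / k / t ^ i) \<longlongrightarrow> 1) (at 0)"
    using tendsto_divide[OF limX(1) tendsto_const[of k]] limX(2) by (simp add: mult.commute)
  have limY': "((\<lambda>t. Y t / l / t ^ j) \<longlongrightarrow> 1) (at 0)"
    using tendsto_divide[OF limY(1) tendsto_const[of l]] limY(2) by (simp add: mult.commute)
  have "i > 0" using ij by auto
  obtain U \<sigma> T Z where U: "0 \<in> U" "smooth_on U \<sigma>" and \<sigma>: "((\<lambda>t. \<sigma> t / t) \<longlongrightarrow> 1) (at 0)"
      "\<And>t. t \<in> U \<Longrightarrow> t \<noteq> 0 \<Longrightarrow> \<sigma> t = t * (X t / k / t ^ i) powr (1 / real i)"
      "\<And>t. t \<in> U \<Longrightarrow> t \<noteq> 0 \<Longrightarrow> X t / k / t ^ i > 0"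
    and T: "0 \<in> T" "smooth_on T Z" and eq: "A_equiv (\<lambda>t. (X t / k, Y t / l)) 0 (\<lambda>s. (s ^ i, Z s)) 0"
    and tr: "\<And>j N. (\<lambda>t. Y t / l - \<sigma> t ^ j) \<in> O[at 0](\<lambda>t. t ^ N) \<Longrightarrow> (\<lambda>s. Z s - s ^ j) \<in> O[at 0](\<lambda>s. s ^ N)"
    by (rule reparametrize_power[OF X' Y' S \<open>i > 0\<close> limX']) (rule that)
  have SU: "open (S \<inter> U)" "0 \<in> S \<inter> U" using smooth_on_imp_open[OF X] smooth_on_imp_open[OF U(2)] S U(1) by auto
  have "(\<lambda>t. Y t / l - \<sigma> t ^ j) \<in> O[at 0](\<lambda>t. t ^ Suc j)"
  proof (rule smooth_on_bigo_Suc[OF _ SU(2)])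
    show "smooth_on (S \<inter> U) (\<lambda>t. Y t / l - \<sigma> t ^ j)"
      by (intro smooth_on_diff smooth_on_power smooth_on_subset[OF Y'] smooth_on_subset[OF U(2)] SU) auto
    have "((\<lambda>t. Y t / l / t ^ j - (\<sigma> t / t) ^ j) \<longlongrightarrow> 1 - 1 ^ j) (at 0)"
      by (intro tendsto_diff limY' tendsto_power \<sigma>(1))
    then show "((\<lambda>t. (Y t / l - \<sigma> t ^ j) / t ^ j) \<longlongrightarrow> 0) (at 0)"
      by (simp add: power_divide diff_divide_distrib)
  qed
  from tr[OF this] have Zj: "(\<lambda>s. Z s - s ^ j) \<in> O[at 0](\<lambda>s. s ^ Suc j)" .
  define R where "R = (\<lambda>s. Z s - s ^ j)"
  have R: "smooth_on T R" unfolding R_def by (intro smooth_on_intros T smooth_on_imp_open[OF T(2)])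
  obtain c where c: "expansion R c" using smooth_on_expansion_deriv[OF R T(1)] by blast
  have c0: "c n = 0" if "n < Suc j" for n using expansion_bigo[OF c _ that] Zj unfolding R_def by blast
  have "A_equiv (\<lambda>s. (s ^ i, Z s)) 0 (\<lambda>s. (s ^ i, s ^ j)) 0"
  proof -
    consider "i = 2" "odd j" | "i = 3" "j = 4" | "i = 3" "j = 5" using ij by auto
    then show ?thesis
    proof cases
      case 1
      then show ?thesis using A_equiv_cusp_2[OF T(2,1) _ Zj] by simp
    next
      case 2
      have "(\<lambda>s. R s - c 5 * s ^ 5) \<in> O[at 0](\<lambda>s. s ^ 6)"
        using expansionD[OF c, of 6] c0 2 by (simp add: eval_nat_numeral)
      then show ?thesis using 2 A_equiv_cusp_3_gap[OF T(2,1), of 1 j "c 5"] by (simp add: R_def)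
    next
      case 3
      have "(\<lambda>s. R s - (c 6 * s ^ 6 + c 7 * s ^ 7)) \<in> O[at 0](\<lambda>s. s ^ 8)"
        using expansionD[OF c, of 8] c0 3 by (simp add: eval_nat_numeral)
      then have "(\<lambda>s. (Z s - c 6 * (s ^ 3)\<^sup>2) - s ^ 5 - c 7 * s ^ 7) \<in> O[at 0](\<lambda>s. s ^ 8)"
        by (simp add: R_def 3 algebra_simps flip: power_mult)
      moreover have "smooth_on T (\<lambda>s. Z s - c 6 * (s ^ 3)\<^sup>2)"
        by (intro smooth_on_intros T smooth_on_imp_open[OF T(2)])
      ultimately have "A_equiv (\<lambda>s. (s ^ 3, Z s - c 6 * (s ^ 3)\<^sup>2)) 0 (\<lambda>s. (s ^ 3, s ^ 5)) 0"
        using A_equiv_cusp_3_gap[of T _ 2 5 "c 7"] T(1) by simp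
      then show ?thesis using 3 A_equiv_trans[OF A_equiv_shear] by simp
    qed
  qed
  then show ?thesis using A_equiv_trans[OF A_equiv_scale[OF limX(2) limY(2)] A_equiv_trans[OF eq]] by blast
qed

section \<open>Cylinders over plane curves and the orders of functions along a curve\<close>

definition cylinder :: "(real \<Rightarrow> real \<times> real) \<Rightarrow> real \<times> real \<Rightarrow> real \<times> real \<times> real" where
  "cylinder c = (\<lambda>(w, t). (w, c t))"

lemma cusp_edge_iff_cylinder: "cusp_edge i j f p \<longleftrightarrow> A_equiv f p (cylinder (\<lambda>t. (t ^ i, t ^ j))) (0, 0)"
  by (simp add: cusp_edge_def cylinder_def)

lemma diffeo_on_Times:
  fixes \<phi> :: "'a::euclidean_space \<Rightarrow> 'a"
  assumes "diffeo_on U \<phi>"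
  shows "diffeo_on (UNIV \<times> U) (\<lambda>p::'b::euclidean_space \<times> 'a. (fst p, \<phi> (snd p)))"
proof -
  have U: "open U" "smooth_on U \<phi>" "inj_on \<phi> U" "open (\<phi> ` U)" "smooth_on (\<phi> ` U) (inv_into U \<phi>)"
    using assms by (auto simp: diffeo_on_def)
  have o: "open ((UNIV :: 'b set) \<times> U)" "open ((UNIV :: 'b set) \<times> \<phi> ` U)" using U by (auto intro: open_Times)
  show ?thesis
  proof (rule diffeo_onI[OF o])
    show "smooth_on (UNIV \<times> U) (\<lambda>p::'b \<times> 'a. (fst p, \<phi> (snd p)))"
      by (intro smooth_on_Pair smooth_on_fst smooth_on_ident o smooth_on_compose[OF U(2)] smooth_on_snd) auto
    show "smooth_on (UNIV \<times> \<phi> ` U) (\<lambda>p::'b \<times> 'a. (fst p, inv_into U \<phi> (snd p)))"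
      by (intro smooth_on_Pair smooth_on_fst smooth_on_ident o smooth_on_compose[OF U(5)] smooth_on_snd) auto
  qed (use U(3) in \<open>auto simp: inv_into_f_f\<close>)
qed

lemma A_equiv_cylinder:
  assumes "A_equiv c 0 e 0"
  shows "A_equiv (cylinder c) (0, 0) (cylinder e) (0, 0)"
proof -
  obtain U V \<phi> \<Phi> where *: "0 \<in> U" "c 0 \<in> V" "diffeo_on U \<phi>" "diffeo_on V \<Phi>" "\<phi> 0 = 0" "\<Phi> (c 0) = e 0"
    "\<And>w. w \<in> U \<Longrightarrow> c w \<in> V \<and> e (\<phi> w) = \<Phi> (c w)"
    using assms unfolding A_equiv_def by blast
  show ?thesis unfolding A_equiv_def
    by (rule exI[of _ "UNIV \<times> U"], rule exI[of _ "UNIV \<times> V"], rule exI[of _ "\<lambda>p. (fst p, \<phi> (snd p))"],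
        rule exI[of _ "\<lambda>p. (fst p, \<Phi> (snd p))"])
      (use * in \<open>auto simp: cylinder_def intro: diffeo_on_Times\<close>)
qed

section \<open>The set of orders along a curve as an invariant\<close>

text \<open>The value set of the curve germ, known from plane curve singularities, with smooth
  functions in place of power series. Functions that become flat along the curve contribute no
  order.\<close>

definition orders :: "(real \<Rightarrow> real \<times> real) \<Rightarrow> nat set" where
  "orders c = {n. \<exists>V h. (0, 0) \<in> V \<and> smooth_on V h \<and> (\<lambda>t. h (c t) :: real) \<in> \<Theta>[at 0](\<lambda>t. t ^ n)}"

text \<open>The kernel of the differential of a cylinder at a singular point is the \<open>t\<close>-direction; a pair of
  diffeomorphisms maps kernel to kernel, so it induces a regular change of \<open>t\<close> along the curve.\<close>

lemma orders_subset:
  assumes eq: "A_equiv (cylinder c) (0, 0) (cylinder e) (0, 0)"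
    and c0: "c 0 = (0, 0)" and e0: "e 0 = (0, 0)" and c': "(c has_derivative (\<lambda>t. (0, 0))) (at 0)"
  shows "orders e \<subseteq> orders c"
proof
  fix n assume "n \<in> orders e"
  then obtain W h where h: "(0, 0) \<in> W" "smooth_on W h" "(\<lambda>t. h (e t) :: real) \<in> \<Theta>[at 0](\<lambda>t. t ^ n)"
    by (auto simp: orders_def)
  obtain U V \<phi> \<Phi> where U: "(0, 0) \<in> U" "cylinder c (0, 0) \<in> V" "diffeo_on U \<phi>" "diffeo_on V \<Phi>"
    "\<phi> (0, 0) = (0, 0)" "\<Phi> (cylinder c (0, 0)) = cylinder e (0, 0)"
    "\<And>w. w \<in> U \<Longrightarrow> cylinder c w \<in> V \<and> cylinder e (\<phi> w) = \<Phi> (cylinder c w)"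
    using eq unfolding A_equiv_def by blast
  have \<phi>: "open U" "smooth_on U \<phi>" "inj_on \<phi> U" "smooth_on (\<phi> ` U) (inv_into U \<phi>)"
    using U(3) by (auto simp: diffeo_on_def)
  have \<Phi>: "open V" "smooth_on V \<Phi>" using U(4) by (auto simp: diffeo_on_def)
  have V0: "(0, 0, 0) \<in> V" "\<Phi> (0, 0, 0) = (0, 0, 0)" using U(2,6) c0 e0 by (auto simp: cylinder_def)
  obtain d\<phi> where d\<phi>: "(\<phi> has_derivative d\<phi>) (at (0, 0))" using smooth_onE[OF \<phi>(2)] U(1) by metis
  obtain d\<psi> where d\<psi>: "(inv_into U \<phi> has_derivative d\<psi>) (at (0, 0))"
    using smooth_onE[OF \<phi>(4)] U(1,5) by (metis imageI)
  obtain d\<Phi> where d\<Phi>: "(\<Phi> has_derivative d\<Phi>) (at (0, 0, 0))" using smooth_onE[OF \<Phi>(2)] V0(1) by metis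
  have dt: "((\<lambda>t::real. (0::real, t)) has_derivative (\<lambda>t. (0, t))) (at 0)"
    by (auto intro!: derivative_eq_intros)
  have dc: "((\<lambda>t. \<phi> (0, t)) has_derivative (\<lambda>t. d\<phi> (0, t))) (at 0)"
    using has_derivative_compose[OF dt, of \<phi> d\<phi>] d\<phi> by simp
  have T: "open ((\<lambda>t::real. (0::real, t)) -` U)" "0 \<in> (\<lambda>t::real. (0::real, t)) -` U"
    using \<phi>(1) U(1) by (auto intro!: open_vimage continuous_intros)
  define \<sigma> where "\<sigma> = (\<lambda>t. snd (\<phi> (0, t)))"
  have key: "fst (\<phi> (0, t)) = fst (\<Phi> (0, c t))" "e (\<sigma> t) = snd (\<Phi> (0, c t))" "(0, c t) \<in> V" if "(0, t) \<in> U" for t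
    using U(7)[OF that] by (auto simp: cylinder_def \<sigma>_def split: prod.splits) (metis fst_conv snd_conv)+
  \<comment> \<open>The first coordinate of a cylinder is the coordinate along its rulings, so
    \<open>fst (\<phi> (0, t))\<close> is the first component of \<open>\<Phi>\<close> along
    \<open>(0, c t)\<close>. This has zero velocity at 0 because \<open>c\<close> has. Away from 0
    it may be nonzero, which is harmless as \<open>e\<close> sees only
    \<open>\<sigma>\<close>.\<close>
  have k0: "fst (d\<phi> (0, 1)) = 0"
  proof -
    have "((\<lambda>t. (0::real, c t)) has_derivative (\<lambda>t. (0, (0, 0)))) (at 0)"
      by (intro has_derivative_Pair c') auto
    from has_derivative_compose[OF this, of \<Phi> d\<Phi>] d\<Phi> c0
    have "((\<lambda>t. \<Phi> (0, c t)) has_derivative (\<lambda>t. d\<Phi> (0, 0, 0))) (at 0)" by simp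
    moreover have "d\<Phi> (0, 0, 0) = 0"
      using d\<Phi> has_derivative_bounded_linear linear_simps(3) by (metis zero_prod_def)
    ultimately have "((\<lambda>t. fst (\<Phi> (0, c t))) has_derivative (\<lambda>t. 0)) (at 0)"
      using has_derivative_fst by fastforce
    then have "((\<lambda>t. fst (\<phi> (0, t))) has_derivative (\<lambda>t. 0)) (at 0)"
      by (rule has_derivative_transform_within_open[OF _ T]) (simp add: key)
    moreover have "((\<lambda>t. fst (\<phi> (0, t))) has_derivative (\<lambda>t. fst (d\<phi> (0, t)))) (at 0)"
      by (rule has_derivative_fst[OF dc])
    ultimately show ?thesis using has_derivative_unique by (metis (no_types, lifting))
  qed
  define q where "q = snd (d\<phi> (0, 1))"
  \<comment> \<open>The differential of a diffeomorphism kills no vector; as the first component of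
    \<open>d\<phi> (0, 1)\<close> vanishes, the second cannot.\<close>
  have q: "q \<noteq> 0"
  proof
    assume "q = 0"
    with k0 have z: "d\<phi> (0, 1) = 0" by (simp add: q_def prod_eq_iff)
    have "((\<lambda>w. inv_into U \<phi> (\<phi> w)) has_derivative (\<lambda>w. d\<psi> (d\<phi> w))) (at (0, 0))"
      by (rule has_derivative_compose[OF d\<phi>]) (simp add: U(5) d\<psi>)
    then have "((\<lambda>w. w) has_derivative (\<lambda>w. d\<psi> (d\<phi> w))) (at (0, 0))"
      by (rule has_derivative_transform_within_open[OF _ \<phi>(1) U(1)]) (simp add: inv_into_f_f \<phi>(3))
    then have "(\<lambda>w. d\<psi> (d\<phi> w)) = (\<lambda>w. w)" using has_derivative_unique[OF _ has_derivative_ident] by blast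
    then have "d\<psi> (d\<phi> (0, 1)) = (0, 1)" by meson
    moreover have "d\<psi> 0 = 0" using d\<psi> has_derivative_bounded_linear linear_simps(3) by blast
    ultimately show False by (simp add: z zero_prod_def)
  qed
  have \<sigma>0: "\<sigma> 0 = 0" by (simp add: \<sigma>_def U(5))
  have "(\<sigma> has_derivative (\<lambda>t. snd (d\<phi> (0, t)))) (at 0)" unfolding \<sigma>_def by (rule has_derivative_snd[OF dc])
  moreover have "snd (d\<phi> (0, t)) = q * t" for t
  proof -
    have "d\<phi> (t *\<^sub>R (0, 1)) = t *\<^sub>R d\<phi> (0, 1)"
      using d\<phi> has_derivative_bounded_linear linear_simps(5) by blast
    then show ?thesis by (simp add: q_def)
  qed
  ultimately have d\<sigma>: "(\<sigma> has_real_derivative q) (at 0)" by (simp add: has_field_derivative_def)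
  then have lim: "((\<lambda>t. \<sigma> t / t) \<longlongrightarrow> q) (at 0)" by (simp add: DERIV_def \<sigma>0)
  have \<sigma>\<Theta>: "\<sigma> \<in> \<Theta>[at 0](\<lambda>t. t)"
    by (rule bigthetaI_tendsto[OF q lim])
  have ft: "filterlim \<sigma> (at 0) (at 0)"
  proof -
    have "(\<sigma> \<longlongrightarrow> 0) (at 0)"
      using DERIV_isCont[OF d\<sigma>] by (simp add: isCont_def \<sigma>0)
    moreover have "eventually (\<lambda>t. \<sigma> t \<noteq> 0) (at 0)"
      using tendsto_imp_eventually_ne[OF lim q] by eventually_elim auto
    ultimately show ?thesis by (auto simp: filterlim_at)
  qed
  have main: "(\<lambda>t. h (e (\<sigma> t))) \<in> \<Theta>[at 0](\<lambda>t. t ^ n)"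
  proof -
    have "(\<lambda>t. h (e (\<sigma> t))) \<in> \<Theta>[at 0](\<lambda>t. \<sigma> t ^ n)"
      by (rule landau_theta.compose[OF h(3) ft])
    also have "(\<lambda>t. \<sigma> t ^ n) \<in> \<Theta>[at 0](\<lambda>t. t ^ n)" 
      by (intro bigthetaI landau_o.big_power landau_omega.big_power bigthetaD1[OF \<sigma>\<Theta>] bigthetaD2[OF \<sigma>\<Theta>])
    finally show ?thesis .
  qed
  \<comment> \<open>The pullback of \<open>h\<close> through the slice of \<open>\<Phi>\<close> at
    ruling coordinate 0: along \<open>c\<close> it agrees with \<open>h\<close> along
    \<open>e\<close> in the parameter \<open>\<sigma>\<close>.\<close>
  define k where "k = (\<lambda>y. h (snd (\<Phi> (0, y))))"
  define D where "D = {y. (0, y) \<in> V \<and> snd (\<Phi> (0, y)) \<in> W}"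
  have pre: "open ((\<lambda>y. (0::real, y)) -` V)" using \<Phi>(1) by (auto intro!: open_vimage continuous_intros)
  have s\<Phi>: "smooth_on ((\<lambda>y. (0::real, y)) -` V) (\<lambda>y. snd (\<Phi> (0, y)))"
    by (intro smooth_on_snd smooth_on_compose[OF \<Phi>(2)] smooth_on_Pair smooth_on_const smooth_on_ident pre) auto
  have "D = ((\<lambda>y. (0::real, y)) -` V) \<inter> (\<lambda>y. snd (\<Phi> (0, y))) -` W" by (auto simp: D_def)
  then have D: "open D"
    using continuous_open_preimage[OF smooth_on_imp_continuous_on[OF s\<Phi>] pre smooth_on_imp_open[OF h(2)]] by simp
  have "smooth_on D k" unfolding k_def
    by (rule smooth_on_compose[OF h(2) smooth_on_subset[OF s\<Phi> D]]) (auto simp: D_def)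
  moreover have "(0, 0) \<in> D" using V0 h(1) by (simp add: D_def)
  moreover have "(\<lambda>t. k (c t)) \<in> \<Theta>[at 0](\<lambda>t. t ^ n)"
  proof -
    have ev: "eventually (\<lambda>t. h (e (\<sigma> t)) = k (c t)) (at 0)"
      using eventually_at_in_open'[OF T] by eventually_elim (simp add: k_def key)
    show ?thesis by (rule landau_theta.in_cong[OF ev, THEN iffD1, OF main])
  qed
  ultimately show "n \<in> orders c" by (auto simp: orders_def)
qed

text \<open>Only the monomials \<open>x\<close>, \<open>x\<^sup>2\<close> and \<open>y\<close> are
  kept; on the curves considered the others vanish to orders too high to matter. The proof expands
  \<open>h\<close> on the axis y = 0 to degree 3 and then integrates in \<open>y\<close>, where the
  partial derivative differs from its value at the origin by at most a multiple of
  \<open>\<bar>x\<bar> + \<bar>y\<bar>\<close>.\<close>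

lemma quadratic_expansion:
  fixes h :: "real \<times> real \<Rightarrow> real"
  assumes h: "smooth_on V h" and V: "(0, 0) \<in> V"
  obtains h0 \<alpha> \<delta> \<beta> C r where "C \<ge> 0" "r > 0"
    "\<And>x y. \<bar>x\<bar> < r \<Longrightarrow> \<bar>y\<bar> < r \<Longrightarrow>
      \<bar>h (x, y) - (h0 + \<alpha> * x + \<delta> * x\<^sup>2 + \<beta> * y)\<bar> \<le> C * (\<bar>x\<bar> ^ 3 + \<bar>x\<bar> * \<bar>y\<bar> + \<bar>y\<bar>\<^sup>2)"
proof -
  obtain h' where h': "\<And>p. p \<in> V \<Longrightarrow> (h has_derivative h' p) (at p)" "\<And>w. smooth_on V (\<lambda>p. h' p w)"
    using smooth_onE[OF h] by blast
  define g where "g = (\<lambda>p. h' p (0, 1))"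
  have gs: "smooth_on V g" unfolding g_def by (rule h'(2))
  obtain g' where g': "\<And>p. p \<in> V \<Longrightarrow> (g has_derivative g' p) (at p)"
    using smooth_onE[OF gs] by metis
  obtain e where e: "e > 0" "ball (0, 0) e \<subseteq> V" using smooth_on_imp_open[OF h] V openE by blast
  have box: "(x, y) \<in> V" if "\<bar>x\<bar> < e / 2" "\<bar>y\<bar> < e / 2" for x y
  proof -
    have "norm (x, y) \<le> norm x + norm y" by (rule norm_Pair_le)
    then have "(x, y) \<in> ball 0 e" using that by simp
    then show ?thesis using e(2) by (auto simp: zero_prod_def)
  qed
  have bl: "bounded_linear (g' (0, 0))" using has_derivative_bounded_linear[OF g'[OF V]] .
  obtain B where B: "B > 0" "\<And>p. norm (g' (0, 0) p) \<le> norm p * B" using bounded_linear.pos_bounded[OF bl] by blast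
  obtain d where d: "d > 0" "\<And>p. norm (p - (0, 0)) < d \<Longrightarrow>
      norm (g p - g (0, 0) - g' (0, 0) (p - (0, 0))) \<le> 1 * norm (p - (0, 0))"
    using g'[OF V] unfolding has_derivative_at_alt by (metis zero_less_one)
  have lip: "\<bar>g (x, y) - g (0, 0)\<bar> \<le> (1 + B) * (\<bar>x\<bar> + \<bar>y\<bar>)" if "\<bar>x\<bar> < d / 2" "\<bar>y\<bar> < d / 2" for x y
  proof -
    have n: "norm (x, y) \<le> \<bar>x\<bar> + \<bar>y\<bar>" using norm_Pair_le[of x y] by simp
    then have "norm ((x, y) - (0, 0)) < d" using that by simp
    from d(2)[OF this] have "\<bar>g (x, y) - g (0, 0) - g' (0, 0) (x, y)\<bar> \<le> norm (x, y)" by simp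
    then have "\<bar>g (x, y) - g (0, 0)\<bar> \<le> norm (x, y) + norm (x, y) * B"
      using B(2)[of "(x, y)"] by simp
    also have "\<dots> = (1 + B) * norm (x, y)" by (simp add: algebra_simps)
    also have "\<dots> \<le> (1 + B) * (\<bar>x\<bar> + \<bar>y\<bar>)" using n B(1) by (intro mult_left_mono) auto
    finally show ?thesis .
  qed
  define k where "k = (\<lambda>x. h (x, 0))"
  have k: "smooth_on {- (e/2)<..<e/2} k" unfolding k_def
    by (rule smooth_on_compose[OF h]) (use box[of _ 0] e in \<open>auto intro!: smooth_on_intros\<close>)
  obtain c where c: "expansion k c" using smooth_on_expansion_deriv[OF k] e by auto
  obtain K where K: "K > 0" "eventually (\<lambda>x. norm (k x - (\<Sum>n<3. c n * x ^ n)) \<le> K * norm (x ^ 3)) (at 0)"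
    using landau_o.bigE[OF expansionD[OF c, of 3]] by blast
  obtain r1 where r1: "r1 > 0" "\<And>x. x \<noteq> 0 \<Longrightarrow> \<bar>x\<bar> < r1 \<Longrightarrow> norm (k x - (\<Sum>n<3. c n * x ^ n)) \<le> K * norm (x ^ 3)"
    using K(2) unfolding eventually_at by auto
  have k0: "k 0 = c 0" using expansion_at_0[OF k _ c] e by simp
  have kx: "\<bar>k x - (c 0 + c 1 * x + c 2 * x\<^sup>2)\<bar> \<le> K * \<bar>x\<bar> ^ 3" if "\<bar>x\<bar> < r1" for x
    using r1(2)[of x] that k0 by (cases "x = 0") (auto simp: eval_nat_numeral power_abs abs_mult)
  define r where "r = min r1 (min (e / 2) (d / 2))"
  have r: "r > 0" using r1 e d by (simp add: r_def)
  have hy: "\<bar>h (x, y) - k x - g (0, 0) * y\<bar> \<le> (1 + B) * (\<bar>x\<bar> * \<bar>y\<bar> + \<bar>y\<bar>\<^sup>2)" if x: "\<bar>x\<bar> < r" and y: "\<bar>y\<bar> < r" for x y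
  proof -
    define F where "F = (\<lambda>s. h (x, s) - g (0, 0) * s)"
    have "norm (F y - F 0) \<le> (1 + B) * (\<bar>x\<bar> + \<bar>y\<bar>) * norm (y - 0)"
    proof (rule field_differentiable_bound[where S = "{- \<bar>y\<bar>..\<bar>y\<bar>}" and f' = "\<lambda>s. g (x, s) - g (0, 0)"])
      fix s assume s: "s \<in> {- \<bar>y\<bar>..\<bar>y\<bar>}"
      then have s': "\<bar>s\<bar> \<le> \<bar>y\<bar>" by auto
      have inV: "(x, s) \<in> V" using box[of x s] x y s' by (auto simp: r_def)
      have lin: "h' (x, s) (0, t) = t * g (x, s)" for t
      proof -
        have "h' (x, s) (t *\<^sub>R (0, 1)) = t *\<^sub>R h' (x, s) (0, 1)"
          using has_derivative_bounded_linear[OF h'(1)[OF inV]] linear_simps(5) by blast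
        then show ?thesis by (simp add: g_def)
      qed
      have "((\<lambda>s. (x, s)) has_derivative (\<lambda>t. (0, t))) (at s)" by (auto intro!: derivative_eq_intros)
      from has_derivative_compose[OF this h'(1)[OF inV]]
      have "((\<lambda>s. h (x, s)) has_real_derivative g (x, s)) (at s)"
        by (simp add: lin has_field_derivative_def mult_commute_abs)
      then show "(F has_real_derivative g (x, s) - g (0, 0)) (at s within {- \<bar>y\<bar>..\<bar>y\<bar>})"
        unfolding F_def by (auto intro!: derivative_eq_intros intro: has_field_derivative_at_within)
      have "\<bar>g (x, s) - g (0, 0)\<bar> \<le> (1 + B) * (\<bar>x\<bar> + \<bar>s\<bar>)" using lip[of x s] x y s' by (auto simp: r_def)
      also have "\<dots> \<le> (1 + B) * (\<bar>x\<bar> + \<bar>y\<bar>)" using s' B by (intro mult_left_mono) auto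
      finally show "norm (g (x, s) - g (0, 0)) \<le> (1 + B) * (\<bar>x\<bar> + \<bar>y\<bar>)" by simp
    qed auto
    then show ?thesis by (simp add: F_def k_def algebra_simps power2_eq_square)
  qed
  define C where "C = K + (1 + B)"
  have "\<bar>h (x, y) - (c 0 + c 1 * x + c 2 * x\<^sup>2 + g (0, 0) * y)\<bar> \<le> C * (\<bar>x\<bar> ^ 3 + \<bar>x\<bar> * \<bar>y\<bar> + \<bar>y\<bar>\<^sup>2)"
    if x: "\<bar>x\<bar> < r" and y: "\<bar>y\<bar> < r" for x y
  proof -
    have "\<bar>h (x, y) - (c 0 + c 1 * x + c 2 * x\<^sup>2 + g (0, 0) * y)\<bar> \<le>
      K * \<bar>x\<bar> ^ 3 + (1 + B) * (\<bar>x\<bar> * \<bar>y\<bar> + \<bar>y\<bar>\<^sup>2)"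
      using hy[OF x y] kx[of x] x by (auto simp: r_def)
    also have "\<dots> \<le> C * (\<bar>x\<bar> ^ 3 + \<bar>x\<bar> * \<bar>y\<bar> + \<bar>y\<bar>\<^sup>2)"
      using K(1) B(1) by (simp add: C_def algebra_simps)
    finally show ?thesis .
  qed
  moreover have "C \<ge> 0" using K(1) B(1) by (simp add: C_def)
  ultimately show ?thesis by (intro that[OF _ r])
qed

text \<open>The bounds \<open>3 * a\<close>, \<open>a + b\<close> and \<open>2 * b\<close> on
  \<open>n\<close> are the orders along the curve of the neglected terms \<open>x ^ 3\<close>,
  \<open>x * y\<close> and \<open>y ^ 2\<close>.\<close>

lemma curve_expansion:
  fixes h :: "real \<times> real \<Rightarrow> real"
  assumes h: "smooth_on V h" "(0, 0) \<in> V" and X: "X \<in> O[at 0](\<lambda>t. t ^ a)" and Y: "Y \<in> O[at 0](\<lambda>t. t ^ b)"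
    and "a \<ge> 1" "b \<ge> 1" "n \<le> 3 * a" "n \<le> a + b" "n \<le> 2 * b"
  obtains h0 \<alpha> \<delta> \<beta> where
    "(\<lambda>t. h (X t, Y t) - (h0 + \<alpha> * X t + \<delta> * (X t)\<^sup>2 + \<beta> * Y t)) \<in> O[at 0](\<lambda>t. t ^ n)"
proof -
  obtain h0 \<alpha> \<delta> \<beta> C r where C: "C \<ge> 0" "r > 0"
    "\<And>x y. \<bar>x\<bar> < r \<Longrightarrow> \<bar>y\<bar> < r \<Longrightarrow>
      \<bar>h (x, y) - (h0 + \<alpha> * x + \<delta> * x\<^sup>2 + \<beta> * y)\<bar> \<le> C * (\<bar>x\<bar> ^ 3 + \<bar>x\<bar> * \<bar>y\<bar> + \<bar>y\<bar>\<^sup>2)"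
    using quadratic_expansion[OF h] by metis
  have small: "eventually (\<lambda>t. \<bar>F t\<bar> < r) (at 0)" if "F \<in> O[at 0](\<lambda>t. t ^ m)" "m \<ge> 1" for F :: "real \<Rightarrow> real" and m
  proof -
    have "(F \<longlongrightarrow> 0) (at 0)"
      using bigo_Suc_imp_tendsto_0[of F 0] bigo_power_weaken[OF that(1), of "Suc 0"] that(2) by simp
    from tendstoD[OF this C(2)] show ?thesis by (simp add: dist_real_def)
  qed
  have "(\<lambda>t. h (X t, Y t) - (h0 + \<alpha> * X t + \<delta> * (X t)\<^sup>2 + \<beta> * Y t)) \<in>
      O[at 0](\<lambda>t. \<bar>X t\<bar> ^ 3 + \<bar>X t\<bar> * \<bar>Y t\<bar> + \<bar>Y t\<bar>\<^sup>2)"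
    by (rule bigoI[of _ C]) (use small[OF X assms(5)] small[OF Y assms(6)] in \<open>eventually_elim, use C in auto\<close>)
  also have "(\<lambda>t. \<bar>X t\<bar> ^ 3 + \<bar>X t\<bar> * \<bar>Y t\<bar> + \<bar>Y t\<bar>\<^sup>2) \<in> O[at 0](\<lambda>t. t ^ n)"
  proof (intro sum_in_bigo(1))
    have aX: "(\<lambda>t. \<bar>X t\<bar>) \<in> O[at 0](\<lambda>t. t ^ a)" and aY: "(\<lambda>t. \<bar>Y t\<bar>) \<in> O[at 0](\<lambda>t. t ^ b)" using X Y by auto
    show "(\<lambda>t. \<bar>X t\<bar> ^ 3) \<in> O[at 0](\<lambda>t. t ^ n)"
      by (rule bigo_power_weaken[of _ "a * 3"]) (use landau_o.big_power[OF aX, of 3] assms in \<open>auto simp: power_mult\<close>)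
    show "(\<lambda>t. \<bar>X t\<bar> * \<bar>Y t\<bar>) \<in> O[at 0](\<lambda>t. t ^ n)"
      by (rule bigo_power_weaken[of _ "a + b"]) (use landau_o.big.mult[OF aX aY] assms in \<open>auto simp: power_add\<close>)
    show "(\<lambda>t. \<bar>Y t\<bar>\<^sup>2) \<in> O[at 0](\<lambda>t. t ^ n)"
      by (rule bigo_power_weaken[of _ "b * 2"]) (use landau_o.big_power[OF aY, of 2] assms in \<open>auto simp: power_mult\<close>)
  qed
  finally show ?thesis using that by blast
qed

lemma orders_expansion:
  assumes n: "n \<in> orders (\<lambda>t. (X t, Y t))" "n > 0" and X: "X \<in> O[at 0](\<lambda>t. t ^ a)" and Y: "Y \<in> O[at 0](\<lambda>t. t ^ b)"
    and ab: "a \<ge> 1" "b \<ge> 1" "N \<le> 3 * a" "N \<le> a + b" "N \<le> 2 * b"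
  obtains f \<alpha> \<delta> \<beta> where "f \<in> \<Theta>[at 0](\<lambda>t. t ^ n)"
    "(\<lambda>t. f t - (\<alpha> * X t + \<delta> * (X t)\<^sup>2 + \<beta> * Y t)) \<in> O[at 0](\<lambda>t. t ^ N)"
proof -
  obtain V h where h: "(0, 0) \<in> V" "smooth_on V h" "(\<lambda>t. h (X t, Y t)) \<in> \<Theta>[at 0](\<lambda>t. t ^ n)"
    using n(1) by (auto simp: orders_def)
  \<comment> \<open>At least 1, so that the remainder vanishes at 0 and, the order \<open>n\<close>
    being positive, the constant term \<open>h0\<close> is forced to be zero.\<close>
  define M where "M = max 1 N"
  have "M \<le> 3 * a" "M \<le> a + b" "M \<le> 2 * b" using ab by (auto simp: M_def)
  then obtain h0 \<alpha> \<delta> \<beta> where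
    e: "(\<lambda>t. h (X t, Y t) - (h0 + \<alpha> * X t + \<delta> * (X t)\<^sup>2 + \<beta> * Y t)) \<in> O[at 0](\<lambda>t. t ^ M)"
    using curve_expansion[OF h(2,1) X Y ab(1,2)] by blast
  have X1: "X \<in> O[at 0](\<lambda>t. t ^ 1)" and Y1: "Y \<in> O[at 0](\<lambda>t. t ^ 1)"
    using bigo_power_weaken[OF X ab(1)] bigo_power_weaken[OF Y ab(2)] .
  have X2: "(\<lambda>t. (X t)\<^sup>2) \<in> O[at 0](\<lambda>t. t ^ 1)"
    using bigo_power_weaken[of "\<lambda>t. (X t)\<^sup>2" "1 * 2" 1] landau_o.big_power[OF X1, of 2] by simp
  have 1: "(\<lambda>t. \<alpha> * X t + \<delta> * (X t)\<^sup>2 + \<beta> * Y t) \<in> O[at 0](\<lambda>t. t ^ 1)"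
    using X1 X2 Y1 by (intro sum_in_bigo(1)) auto
  have 2: "(\<lambda>t. h (X t, Y t)) \<in> O[at 0](\<lambda>t. t ^ 1)"
    by (rule bigo_power_weaken[OF bigthetaD1[OF h(3)]]) (use n(2) in simp)
  have 3: "(\<lambda>t. h (X t, Y t) - (h0 + \<alpha> * X t + \<delta> * (X t)\<^sup>2 + \<beta> * Y t)) \<in> O[at 0](\<lambda>t. t ^ 1)"
    by (rule bigo_power_weaken[OF e]) (simp add: M_def)
  from sum_in_bigo(2)[OF sum_in_bigo(2)[OF 2 1] 3] have "(\<lambda>t::real. h0 * t ^ 0) \<in> O[at 0](\<lambda>t. t ^ 1)"
    by (simp add: algebra_simps)
  then have "h0 = 0" by (rule monomial_bigo_imp_zero) simp
  then have "(\<lambda>t. h (X t, Y t) - (\<alpha> * X t + \<delta> * (X t)\<^sup>2 + \<beta> * Y t)) \<in> O[at 0](\<lambda>t. t ^ N)"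
    using bigo_power_weaken[OF e, of N] by (simp add: M_def)
  then show ?thesis using that[OF h(3)] by blast
qed

lemma orders_ge:
  assumes "n \<in> orders (\<lambda>t. (X t, Y t))" "n > 0" and X: "X \<in> O[at 0](\<lambda>t. t ^ a)" and Y: "Y \<in> O[at 0](\<lambda>t. t ^ a)" and "a \<ge> 1"
  shows "a \<le> n"
proof -
  obtain f \<alpha> \<delta> \<beta> where f: "f \<in> \<Theta>[at 0](\<lambda>t. t ^ n)"
    "(\<lambda>t. f t - (\<alpha> * X t + \<delta> * (X t)\<^sup>2 + \<beta> * Y t)) \<in> O[at 0](\<lambda>t. t ^ a)"
    by (rule orders_expansion[OF assms(1-4) assms(5,5), of a]) auto
  have "(\<lambda>t. (X t)\<^sup>2) \<in> O[at 0](\<lambda>t. t ^ a)"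
    using bigo_power_weaken[of "\<lambda>t. (X t)\<^sup>2" "a * 2" a] landau_o.big_power[OF X, of 2] by (simp add: power_mult)
  with X Y have "(\<lambda>t. \<alpha> * X t + \<delta> * (X t)\<^sup>2 + \<beta> * Y t) \<in> O[at 0](\<lambda>t. t ^ a)"
    by (intro sum_in_bigo(1)) auto
  from sum_in_bigo(1)[OF f(2) this] have "f \<in> O[at 0](\<lambda>t. t ^ a)" by simp
  then show ?thesis by (rule bigtheta_power_not_bigo[OF f(1)])
qed

lemma bigtheta_power_unique:
  fixes f :: "real \<Rightarrow> real"
  assumes "f \<in> \<Theta>[at 0](\<lambda>t. t ^ m)" "f \<in> \<Theta>[at 0](\<lambda>t. t ^ n)"
  shows "m = n"
  using bigtheta_power_not_bigo[OF assms(1) bigthetaD1[OF assms(2)]]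
    bigtheta_power_not_bigo[OF assms(2) bigthetaD1[OF assms(1)]] by simp

lemma bigtheta_perturb:
  fixes f g :: "real \<Rightarrow> real"
  assumes "g \<in> \<Theta>[at 0](\<lambda>t. t ^ a)" "(\<lambda>t. f t - g t) \<in> O[at 0](\<lambda>t. t ^ N)" "a < N"
  shows "f \<in> \<Theta>[at 0](\<lambda>t. t ^ a)"
proof -
  have "(\<lambda>t. f t - g t) \<in> O[at 0](\<lambda>t. t ^ Suc a)" by (rule bigo_power_weaken[OF assms(2)]) (use assms(3) in simp)
  then have "(\<lambda>t. f t - g t) \<in> o[at 0](\<lambda>t. t ^ a)"
    using bigo_Suc_imp_tendsto_0 eventually_power_nonzero by (intro smalloI_tendsto) auto
  then have "(\<lambda>t. f t - g t) \<in> o[at 0](g)" using assms(1) landau_o.small.cong_bigtheta by blast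
  from landau_theta.plus_absorb1[OF this] have "\<Theta>[at 0](f) = \<Theta>[at 0](g)" by simp
  then show ?thesis using assms(1) by (metis bigtheta_sym)
qed

text \<open>Modulo \<open>t ^ N\<close> every function along the curve without constant term is a
  multiple of \<open>X\<close>, so its order is \<open>a\<close> or at least
  \<open>N\<close>.\<close>

lemma orders_lt:
  assumes "n \<in> orders (\<lambda>t. (X t, Y t))" "n > 0" and X: "X \<in> \<Theta>[at 0](\<lambda>t. t ^ a)" and Y: "Y \<in> O[at 0](\<lambda>t. t ^ b)" and "a \<ge> 1"
    and N: "N \<le> 2 * a" "N \<le> b" "n < N"
  shows "n = a"
proof -
  have X': "X \<in> O[at 0](\<lambda>t. t ^ a)" using X by blast
  obtain f \<alpha> \<delta> \<beta> where f: "f \<in> \<Theta>[at 0](\<lambda>t. t ^ n)"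
    "(\<lambda>t. f t - (\<alpha> * X t + \<delta> * (X t)\<^sup>2 + \<beta> * Y t)) \<in> O[at 0](\<lambda>t. t ^ N)"
    by (rule orders_expansion[OF assms(1,2) X' Y assms(5), of N]) (use N assms(2) in auto)
  have "(\<lambda>t. (X t)\<^sup>2) \<in> O[at 0](\<lambda>t. t ^ N)"
    using bigo_power_weaken[of "\<lambda>t. (X t)\<^sup>2" "a * 2" N] landau_o.big_power[OF X', of 2] N by (simp add: power_mult)
  with bigo_power_weaken[OF Y N(2)] have "(\<lambda>t. \<delta> * (X t)\<^sup>2 + \<beta> * Y t) \<in> O[at 0](\<lambda>t. t ^ N)"
    by (intro sum_in_bigo(1)) auto
  from sum_in_bigo(1)[OF f(2) this] have g: "(\<lambda>t. f t - \<alpha> * X t) \<in> O[at 0](\<lambda>t. t ^ N)"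
    by (simp add: algebra_simps)
  show ?thesis
  proof (cases "\<alpha> = 0")
    case True
    then show ?thesis using bigtheta_power_not_bigo[OF f(1), of N] g N by simp
  next
    case False
    show ?thesis
    proof (cases "a < N")
      case True
      have "(\<lambda>t. \<alpha> * X t) \<in> \<Theta>[at 0](\<lambda>t. t ^ a)" using X False by simp
      from bigtheta_perturb[OF this g True] show ?thesis using bigtheta_power_unique[OF f(1)] by blast
    next
      case False
      then have "X \<in> O[at 0](\<lambda>t. t ^ N)" using bigo_power_weaken[OF X', of N] by simp
      then have "(\<lambda>t. (f t - \<alpha> * X t) + \<alpha> * X t) \<in> O[at 0](\<lambda>t. t ^ N)" by (intro sum_in_bigo(1) g) simp
      then show ?thesis using bigtheta_power_not_bigo[OF f(1), of N] N by simp
    qed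
  qed
qed

text \<open>Modulo \<open>t ^ 6\<close> also \<open>Y\<close> is a multiple of
  \<open>X\<^sup>2\<close>, so functions along the curve without constant term are combinations of
  \<open>X\<close>, of order 2, and \<open>X\<^sup>2\<close>, of order 4. The positive orders below
  6 are therefore among 2 and 4.\<close>

lemma five_notin_orders:
  assumes X: "X \<in> \<Theta>[at 0](\<lambda>t. t ^ 2)" and Y: "(\<lambda>t. Y t - q * (X t)\<^sup>2) \<in> O[at 0](\<lambda>t. t ^ 6)"
  shows "5 \<notin> orders (\<lambda>t. (X t, Y t))"
proof
  assume n: "5 \<in> orders (\<lambda>t. (X t, Y t))"
  have X': "X \<in> O[at 0](\<lambda>t. t ^ 2)" using X by blast
  have X2: "(\<lambda>t. (X t)\<^sup>2) \<in> \<Theta>[at 0](\<lambda>t. t ^ 4)"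
    using landau_theta.mult[OF X X] by (simp add: power2_eq_square power4_eq_xxxx mult.assoc)
  have "(\<lambda>t. (Y t - q * (X t)\<^sup>2) + q * (X t)\<^sup>2) \<in> O[at 0](\<lambda>t. t ^ 4)"
    by (intro sum_in_bigo(1) bigo_power_weaken[OF Y]) (use X2 in auto)
  then have Y4: "Y \<in> O[at 0](\<lambda>t. t ^ 4)" by simp
  obtain f \<alpha> \<delta> \<beta> where f: "f \<in> \<Theta>[at 0](\<lambda>t. t ^ 5)"
    "(\<lambda>t. f t - (\<alpha> * X t + \<delta> * (X t)\<^sup>2 + \<beta> * Y t)) \<in> O[at 0](\<lambda>t. t ^ 6)"
    by (rule orders_expansion[OF n _ X' Y4, of 6]) auto
  have "(\<lambda>t. \<beta> * (Y t - q * (X t)\<^sup>2)) \<in> O[at 0](\<lambda>t. t ^ 6)" using Y by simp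
  from sum_in_bigo(1)[OF f(2) this]
  have g: "(\<lambda>t. f t - (\<alpha> * X t + (\<delta> + \<beta> * q) * (X t)\<^sup>2)) \<in> O[at 0](\<lambda>t. t ^ 6)"
    by (simp add: algebra_simps)
  show False
  proof (cases "\<alpha> = 0")
    case True
    show False
    proof (cases "\<delta> + \<beta> * q = 0")
      case z: True
      then have "f \<in> O[at 0](\<lambda>t. t ^ 6)" using g unfolding z True by simp
      then show False using bigtheta_power_not_bigo[OF f(1), of 6] by simp
    next
      case False
      then have "(\<lambda>t. (\<delta> + \<beta> * q) * (X t)\<^sup>2) \<in> \<Theta>[at 0](\<lambda>t. t ^ 4)" using X2 by simp
      from bigtheta_perturb[OF this, of f 6] g True show False using bigtheta_power_unique[OF f(1), of 4] by simp
    qed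
  next
    case False
    have "(\<lambda>t. (f t - (\<alpha> * X t + (\<delta> + \<beta> * q) * (X t)\<^sup>2)) + (\<delta> + \<beta> * q) * (X t)\<^sup>2) \<in> O[at 0](\<lambda>t. t ^ 4)"
      by (intro sum_in_bigo(1) bigo_power_weaken[OF g]) (use X2 in auto)
    then have g2: "(\<lambda>t. f t - \<alpha> * X t) \<in> O[at 0](\<lambda>t. t ^ 4)" by (simp add: algebra_simps)
    have "(\<lambda>t. \<alpha> * X t) \<in> \<Theta>[at 0](\<lambda>t. t ^ 2)" using X False by simp
    from bigtheta_perturb[OF this g2] show False using bigtheta_power_unique[OF f(1), of 2] by simp
  qed
qed

lemma fst_order: "X \<in> \<Theta>[at 0](\<lambda>t. t ^ n) \<Longrightarrow> n \<in> orders (\<lambda>t. (X t, Y t))"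
  unfolding orders_def by (auto intro!: exI[of _ UNIV] exI[of _ fst] smooth_on_linear bounded_linear_fst)

lemma snd_order: "Y \<in> \<Theta>[at 0](\<lambda>t. t ^ n) \<Longrightarrow> n \<in> orders (\<lambda>t. (X t, Y t))"
  unfolding orders_def by (auto intro!: exI[of _ UNIV] exI[of _ snd] smooth_on_linear bounded_linear_snd)

lemma orders_models:
  "2 \<in> orders (\<lambda>t. (t ^ 2, t ^ 3))" "3 \<in> orders (\<lambda>t. (t ^ 2, t ^ 3))"
  "2 \<in> orders (\<lambda>t. (t ^ 2, t ^ 5))" "3 \<notin> orders (\<lambda>t. (t ^ 2, t ^ 5))" "5 \<in> orders (\<lambda>t. (t ^ 2, t ^ 5))"
  "2 \<notin> orders (\<lambda>t. (t ^ 3, t ^ 4))" "3 \<in> orders (\<lambda>t. (t ^ 3, t ^ 4))" "4 \<in> orders (\<lambda>t. (t ^ 3, t ^ 4))"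
  "2 \<notin> orders (\<lambda>t. (t ^ 3, t ^ 5))" "3 \<in> orders (\<lambda>t. (t ^ 3, t ^ 5))" "4 \<notin> orders (\<lambda>t. (t ^ 3, t ^ 5))"
  "5 \<in> orders (\<lambda>t. (t ^ 3, t ^ 5))"
proof -
  have sub: "(\<lambda>t::real. t ^ n) \<in> O[at 0](\<lambda>t. t ^ m)" if "m \<le> n" for m n using power_bigo_power[OF that] .
  show "3 \<notin> orders (\<lambda>t. (t ^ 2, t ^ 5))"
    using orders_lt[of 3 "\<lambda>t. t ^ 2" "\<lambda>t. t ^ 5" 2 5 4] by auto
  show "4 \<notin> orders (\<lambda>t. (t ^ 3, t ^ 5))"
    using orders_lt[of 4 "\<lambda>t. t ^ 3" "\<lambda>t. t ^ 5" 3 5 5] by auto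
  show "2 \<notin> orders (\<lambda>t. (t ^ 3, t ^ 4))" "2 \<notin> orders (\<lambda>t. (t ^ 3, t ^ 5))"
    using orders_ge[of 2 "\<lambda>t. t ^ 3" "\<lambda>t. t ^ 4" 3] orders_ge[of 2 "\<lambda>t. t ^ 3" "\<lambda>t. t ^ 5" 3] sub by auto
qed (auto intro: fst_order snd_order)

lemma orders_eq_if_cusp_edge:
  fixes X Y :: "real \<Rightarrow> real"
  assumes eq: "A_equiv (cylinder (\<lambda>t. (X t, Y t))) (0, 0) (cylinder (\<lambda>t. (t ^ i, t ^ j))) (0, 0)"
    and ij: "i \<ge> 2" "j \<ge> 2" and X: "(X has_real_derivative 0) (at 0)" "X 0 = 0"
    and Y: "(Y has_real_derivative 0) (at 0)" "Y 0 = 0"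
  shows "orders (\<lambda>t. (X t, Y t)) = orders (\<lambda>t. (t ^ i, t ^ j))"
proof
  have d: "((\<lambda>t. (F t, G t)) has_derivative (\<lambda>t. (0, 0))) (at 0)"
    if "(F has_real_derivative 0) (at 0)" "(G has_real_derivative 0) (at 0)" for F G :: "real \<Rightarrow> real"
    using that by (intro has_derivative_Pair) (auto simp: has_field_derivative_def lambda_zero)
  have p: "((\<lambda>t::real. t ^ k) has_real_derivative 0) (at 0)" if "k \<ge> 2" for k
    using that by (auto intro!: derivative_eq_intros)
  have m0: "((0::real) ^ i, (0::real) ^ j) = (0, 0)" using ij by simp
  show "orders (\<lambda>t. (t ^ i, t ^ j)) \<subseteq> orders (\<lambda>t. (X t, Y t))"
    by (rule orders_subset[OF eq]) (use X Y m0 in \<open>auto intro: d\<close>)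
  show "orders (\<lambda>t. (X t, Y t)) \<subseteq> orders (\<lambda>t. (t ^ i, t ^ j))"
    by (rule orders_subset[OF A_equiv_sym[OF eq]]) (use X Y m0 d[OF p[OF ij(1)] p[OF ij(2)]] in auto)
qed

section \<open>Helicoidal surfaces of Legendre curves\<close>

text \<open>The screw motion acts on the surface; taking the height, measured from its value
  \<open>k\<close> at the given point, as ruling coordinate and turning each horizontal plane back
  by the matching angle leaves a curve independent of the height.\<close>

lemma helicoid_equiv_cylinder:
  fixes x z :: "real \<Rightarrow> real"
  assumes x: "smooth_on I x" and z: "smooth_on I z" and u0: "u0 \<in> I" and lam: "lam \<noteq> 0"
  shows "A_equiv (\<lambda>(u, v). (x u * cos v, x u * sin v, z u + lam * v)) (u0, v0)
    (cylinder (\<lambda>t. (x (t + u0) * cos ((z (t + u0) - z u0) / lam), x (t + u0) * sin ((z (t + u0) - z u0) / lam)))) (0, 0)"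
proof -
  define k where "k = z u0 + lam * v0"
  define U where "U = I \<times> (UNIV :: real set)"
  define V where "V = {q :: real \<times> real. snd q + u0 \<in> I}"
  define \<phi> where "\<phi> = (\<lambda>p. (z (fst p) + lam * snd p - k, fst p - u0))"
  define \<psi> where "\<psi> = (\<lambda>q. (snd q + u0, (fst q + k - z (snd q + u0)) / lam))"
  \<comment> \<open>In each horizontal plane this is a reflection, an involution, so
    \<open>\<Psi>\<close> can use the same formula. It sends the polar angle \<open>v\<close> to
    \<open>\<theta> - v\<close>, and with this \<open>\<theta>\<close> the difference is
    \<open>(z u - z u0) / lam\<close>, free of \<open>v\<close>.\<close>
  define \<Phi> where "\<Phi> = (\<lambda>p :: real \<times> real \<times> real. let \<theta> = v0 + (snd (snd p) - k) / lam in
    (snd (snd p) - k, fst p * cos \<theta> + fst (snd p) * sin \<theta>, fst p * sin \<theta> - fst (snd p) * cos \<theta>))"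
  define \<Psi> where "\<Psi> = (\<lambda>q :: real \<times> real \<times> real. let \<theta> = v0 + fst q / lam in
    (fst (snd q) * cos \<theta> + snd (snd q) * sin \<theta>, fst (snd q) * sin \<theta> - snd (snd q) * cos \<theta>, fst q + k))"
  have oI: "open I" by (rule smooth_on_imp_open[OF x])
  have oU: "open U" unfolding U_def using oI by (intro open_Times) auto
  have oV: "open V"
  proof -
    have "V = (\<lambda>q. snd q + u0) -` I" by (auto simp: V_def)
    then show ?thesis using oI by (auto intro!: open_vimage continuous_intros)
  qed
  have \<phi>: "diffeo_on U \<phi>"
  proof (rule diffeo_onI[OF oU oV])
    show "smooth_on U \<phi>" unfolding \<phi>_def
      by (intro smooth_on_Pair smooth_on_diff smooth_on_add smooth_on_mult smooth_on_const smooth_on_fst smooth_on_snd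
          smooth_on_ident smooth_on_compose[OF z] oU) (auto simp: U_def)
    show "smooth_on V \<psi>" unfolding \<psi>_def
      by (intro smooth_on_Pair smooth_on_diff smooth_on_add smooth_on_divide_const smooth_on_const smooth_on_fst smooth_on_snd
          smooth_on_ident smooth_on_compose[OF z] oV) (auto simp: V_def)
  qed (use lam in \<open>auto simp: U_def V_def \<phi>_def \<psi>_def\<close>)
  have rot: "(a * cos \<theta> + b * sin \<theta>) * cos \<theta> + (a * sin \<theta> - b * cos \<theta>) * sin \<theta> = a"
    "(a * cos \<theta> + b * sin \<theta>) * sin \<theta> - (a * sin \<theta> - b * cos \<theta>) * cos \<theta> = b" for a b \<theta> :: real
    using sin_cos_squared_add3[of \<theta>] by (algebra)+
  have \<Phi>: "diffeo_on UNIV \<Phi>"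
  proof (rule diffeo_onI[of _ UNIV _ \<Psi>])
    show "smooth_on UNIV \<Phi>" unfolding \<Phi>_def Let_def by (intro smooth_on_intros) auto
    show "smooth_on UNIV \<Psi>" unfolding \<Psi>_def Let_def by (intro smooth_on_intros) auto
  qed (auto simp: \<Phi>_def \<Psi>_def Let_def rot)
  show ?thesis unfolding A_equiv_def
  proof (rule exI[of _ U], rule exI[of _ UNIV], rule exI[of _ \<phi>], rule exI[of _ \<Phi>], intro conjI ballI)
    have eq: "cylinder (\<lambda>t. (x (t + u0) * cos ((z (t + u0) - z u0) / lam), x (t + u0) * sin ((z (t + u0) - z u0) / lam))) (\<phi> (u, v))
      = \<Phi> (x u * cos v, x u * sin v, z u + lam * v)" for u v
    proof -
      define \<theta> where "\<theta> = v0 + (z u + lam * v - k) / lam"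
      have e: "(z u - z u0) / lam = \<theta> - v" using lam by (simp add: \<theta>_def k_def field_simps)
      show ?thesis
        by (simp add: cylinder_def \<phi>_def \<Phi>_def Let_def e flip: \<theta>_def) (simp add: cos_diff sin_diff algebra_simps)
    qed
    then show "cylinder (\<lambda>t. (x (t + u0) * cos ((z (t + u0) - z u0) / lam), x (t + u0) * sin ((z (t + u0) - z u0) / lam))) (\<phi> w)
      = \<Phi> (case w of (u, v) \<Rightarrow> (x u * cos v, x u * sin v, z u + lam * v))" for w
      by (cases w) simp
    show \<phi>0: "\<phi> (u0, v0) = (0, 0)" by (simp add: \<phi>_def k_def)
    show "\<Phi> (case (u0, v0) of (u, v) \<Rightarrow> (x u * cos v, x u * sin v, z u + lam * v)) =
      cylinder (\<lambda>t. (x (t + u0) * cos ((z (t + u0) - z u0) / lam), x (t + u0) * sin ((z (t + u0) - z u0) / lam))) (0, 0)"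
      using eq[of u0 v0] by (simp add: \<phi>0)
  qed (use \<phi> \<Phi> u0 in \<open>auto simp: U_def\<close>)
qed

section \<open>Taylor coefficients of the profile curve in terms of the curvature\<close>

lemma smooth_on_shift:
  fixes f :: "real \<Rightarrow> real"
  assumes "smooth_on I f"
  shows "smooth_on ((\<lambda>t. t + u0) -` I) (\<lambda>t. f (t + u0))"
proof (rule smooth_on_compose[OF assms])
  have "open ((\<lambda>t. t + u0) -` I)"
    using smooth_on_imp_open[OF assms] by (intro open_vimage) (auto intro!: continuous_intros)
  then show "smooth_on ((\<lambda>t. t + u0) -` I) (\<lambda>t. t + u0)" by (intro smooth_on_intros)
qed auto

lemma expansion_eventually_cong:
  assumes "expansion f c" and "eventually (\<lambda>t. f t = g t) (at 0)"
  shows "expansion g c"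
  unfolding expansion_def
proof
  fix N
  show "(\<lambda>s. g s - (\<Sum>n<N. c n * s ^ n)) \<in> O[at 0](\<lambda>s. s ^ N)"
    by (rule bigo_eventually_cong[OF expansionD[OF assms(1)]]) (use assms(2) in eventually_elim, simp)
qed

lemma taylor_coeffs:
  fixes f :: "real \<Rightarrow> real"
  assumes f: "smooth_on I f" and u0: "u0 \<in> I"
    and d1: "\<And>u. u \<in> I \<Longrightarrow> (f has_real_derivative f1 u) (at u)"
    and d2: "\<And>u. u \<in> I \<Longrightarrow> (f1 has_real_derivative f2 u) (at u)"
    and d3: "\<And>u. u \<in> I \<Longrightarrow> (f2 has_real_derivative f3 u) (at u)"
  obtains c where "expansion (\<lambda>t. f (t + u0)) c" "c 0 = f u0" "c 1 = f1 u0" "c 2 = f2 u0 / 2" "c 3 = f3 u0 / 6"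
proof -
  define J where "J = (\<lambda>t. t + u0) -` I"
  have J: "0 \<in> J" using u0 by (simp add: J_def)
  have step: "smooth_on I g1 \<and> expansion (\<lambda>t. g1 (t + u0)) (\<lambda>n. real (Suc n) * c (Suc n))"
    if g: "smooth_on I g" and d: "\<And>u. u \<in> I \<Longrightarrow> (g has_real_derivative g1 u) (at u)" and c: "expansion (\<lambda>t. g (t + u0)) c" for g g1 c
  proof
    show "smooth_on I g1"
      by (rule smooth_on_cong[OF smooth_on_deriv(1)[OF g]]) (simp add: DERIV_imp_deriv[OF d])
    have gs: "smooth_on J (\<lambda>t. g (t + u0))" unfolding J_def by (rule smooth_on_shift[OF g])
    have "deriv (\<lambda>t. g (t + u0)) t = g1 (t + u0)" if "t \<in> J" for t
      using d[of "t + u0"] that by (intro DERIV_imp_deriv) (simp add: DERIV_shift J_def)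
    then have "eventually (\<lambda>t. deriv (\<lambda>t. g (t + u0)) t = g1 (t + u0)) (at 0)"
      using eventually_at_in_open'[OF smooth_on_imp_open[OF gs] J] by (auto elim: eventually_mono)
    from expansion_eventually_cong[OF expansion_deriv[OF gs J c] this]
    show "expansion (\<lambda>t. g1 (t + u0)) (\<lambda>n. real (Suc n) * c (Suc n))" .
  qed
  have val: "g u0 = c 0" if g: "smooth_on I g" and c: "expansion (\<lambda>t. g (t + u0)) c" for g c
    using expansion_at_0[OF smooth_on_shift[OF g, of u0] _ c] u0 by simp
  obtain c where c: "expansion (\<lambda>t. f (t + u0)) c"
    using smooth_on_expansion_deriv[OF smooth_on_shift[OF f, of u0]] u0 by auto
  note s1 = step[OF f d1 c]
  note s2 = step[OF conjunct1[OF s1] d2 conjunct2[OF s1]]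
  note s3 = step[OF conjunct1[OF s2] d3 conjunct2[OF s2]]
  show ?thesis
    using that[OF c] val[OF f c] val[OF conjunct1[OF s1] conjunct2[OF s1]] val[OF conjunct1[OF s2] conjunct2[OF s2]]
      val[OF conjunct1[OF s3] conjunct2[OF s3]]
    by (simp add: eval_nat_numeral)
qed

text \<open>The Frenet equations. Differentiating \<open>a\<^sup>2 + b\<^sup>2 = 1\<close> shows
  that the velocity of \<open>(a, b)\<close> is orthogonal to the unit vector \<open>(a, b)\<close>,
  as the velocity of \<open>(x, z)\<close> is by the Legendre condition; so both are multiples of
  \<open>(- b, a)\<close>, with factors \<open>ell\<close> and \<open>beta\<close>.\<close>

lemma legendre_derivs:
  assumes leg: "legendre_curve I x z a b" and u: "u \<in> I"
  defines "ell \<equiv> leg_ell a b" and "beta \<equiv> leg_beta x z a b"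
  shows "(x has_real_derivative - (beta u * b u)) (at u)" "(z has_real_derivative beta u * a u) (at u)"
    "(a has_real_derivative - (ell u * b u)) (at u)" "(b has_real_derivative ell u * a u) (at u)"
    "(beta has_real_derivative deriv beta u) (at u)" "(ell has_real_derivative deriv ell u) (at u)"
    "(deriv beta has_real_derivative deriv (deriv beta) u) (at u)"
proof -
  have I: "open I" and sm: "smooth_on I x" "smooth_on I z" "smooth_on I a" "smooth_on I b"
    and n: "\<And>u. u \<in> I \<Longrightarrow> (a u)\<^sup>2 + (b u)\<^sup>2 = 1" and o: "\<And>u. u \<in> I \<Longrightarrow> deriv x u * a u + deriv z u * b u = 0"
    using leg by (auto simp: legendre_curve_def)
  note d = smooth_on_deriv(2)[OF _ u]
  have "((\<lambda>u. (a u)\<^sup>2 + (b u)\<^sup>2) has_real_derivative 2 * a u * deriv a u + 2 * b u * deriv b u) (at u)"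
    using d[OF sm(3)] d[OF sm(4)] by (auto intro!: derivative_eq_intros)
  moreover have "((\<lambda>u. (a u)\<^sup>2 + (b u)\<^sup>2) has_real_derivative 0) (at u)"
    by (rule has_field_derivative_transform_within_open[OF DERIV_const[of 1] I u]) (simp add: n)
  ultimately have t: "a u * deriv a u + b u * deriv b u = 0" using DERIV_unique by fastforce
  have n1: "a u * a u + b u * b u = 1" using n[OF u] by (simp add: power2_eq_square)
  have "deriv x u = - (beta u * b u)" "deriv z u = beta u * a u"
    using n1 o[OF u] unfolding beta_def leg_beta_def by algebra+
  then show "(x has_real_derivative - (beta u * b u)) (at u)" "(z has_real_derivative beta u * a u) (at u)"
    using d[OF sm(1)] d[OF sm(2)] by simp_all
  have "deriv a u = - (ell u * b u)" "deriv b u = ell u * a u"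
    using n1 t unfolding ell_def leg_ell_def by algebra+
  then show "(a has_real_derivative - (ell u * b u)) (at u)" "(b has_real_derivative ell u * a u) (at u)"
    using d[OF sm(3)] d[OF sm(4)] by simp_all
  have "smooth_on I (\<lambda>u. deriv x u * (- b u) + deriv z u * a u)"
    by (intro smooth_on_add smooth_on_mult smooth_on_minus smooth_on_deriv sm)
  then have B: "smooth_on I beta" by (rule smooth_on_cong) (simp add: beta_def leg_beta_def)
  have "smooth_on I (\<lambda>u. deriv a u * (- b u) + deriv b u * a u)"
    by (intro smooth_on_add smooth_on_mult smooth_on_minus smooth_on_deriv sm)
  then have L: "smooth_on I ell" by (rule smooth_on_cong) (simp add: ell_def leg_ell_def)
  show "(beta has_real_derivative deriv beta u) (at u)" "(ell has_real_derivative deriv ell u) (at u)"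
    "(deriv beta has_real_derivative deriv (deriv beta) u) (at u)"
    using d[OF B] d[OF L] d[OF smooth_on_deriv(1)[OF B]] by auto
qed

lemma legendre_taylor:
  assumes leg: "legendre_curve I x z a b" and u0: "u0 \<in> I"
  defines "ell \<equiv> leg_ell a b" and "beta \<equiv> leg_beta x z a b"
  obtains cx cz where "expansion (\<lambda>t. x (t + u0)) cx" "expansion (\<lambda>t. z (t + u0)) cz"
    "cx 0 = x u0" "cx 1 = - (beta u0 * b u0)" "cx 2 = - (deriv beta u0 * b u0 + beta u0 * ell u0 * a u0) / 2"
    "cx 3 = - (deriv (deriv beta) u0 * b u0 + 2 * deriv beta u0 * ell u0 * a u0 + beta u0 * deriv ell u0 * a u0
      - beta u0 * (ell u0)\<^sup>2 * b u0) / 6"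
    "cz 0 = z u0" "cz 1 = beta u0 * a u0" "cz 2 = (deriv beta u0 * a u0 - beta u0 * ell u0 * b u0) / 2"
    "cz 3 = (deriv (deriv beta) u0 * a u0 - 2 * deriv beta u0 * ell u0 * b u0 - beta u0 * deriv ell u0 * b u0
      - beta u0 * (ell u0)\<^sup>2 * a u0) / 6"
proof -
  have sm: "smooth_on I x" "smooth_on I z" using leg by (auto simp: legendre_curve_def)
  note d = legendre_derivs[OF leg, folded ell_def beta_def]
  obtain cx where cx: "expansion (\<lambda>t. x (t + u0)) cx" "cx 0 = x u0" "cx 1 = - (beta u0 * b u0)"
    "cx 2 = - (deriv beta u0 * b u0 + beta u0 * ell u0 * a u0) / 2"
    "cx 3 = - (deriv (deriv beta) u0 * b u0 + 2 * deriv beta u0 * ell u0 * a u0 + beta u0 * deriv ell u0 * a u0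
      - beta u0 * (ell u0)\<^sup>2 * b u0) / 6"
  proof (rule taylor_coeffs[OF sm(1) u0, where ?f1.0 = "\<lambda>u. - (beta u * b u)"
        and ?f2.0 = "\<lambda>u. - (deriv beta u * b u + beta u * ell u * a u)"
        and ?f3.0 = "\<lambda>u. - (deriv (deriv beta) u * b u + 2 * deriv beta u * ell u * a u + beta u * deriv ell u * a u
      - beta u * (ell u)\<^sup>2 * b u)"], goal_cases)
    case (1 u) then show ?case using d(1) by blast
  next
    case (2 u) show ?case
      by (rule derivative_eq_intros d[OF 2(2)] refl)+ (simp add: algebra_simps)
  next
    case (3 u) show ?case
      by (rule derivative_eq_intros d[OF 3(2)] refl)+ (simp add: algebra_simps power2_eq_square)
  qed
  obtain cz where cz: "expansion (\<lambda>t. z (t + u0)) cz" "cz 0 = z u0" "cz 1 = beta u0 * a u0"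
    "cz 2 = (deriv beta u0 * a u0 - beta u0 * ell u0 * b u0) / 2"
    "cz 3 = (deriv (deriv beta) u0 * a u0 - 2 * deriv beta u0 * ell u0 * b u0 - beta u0 * deriv ell u0 * b u0
      - beta u0 * (ell u0)\<^sup>2 * a u0) / 6"
  proof (rule taylor_coeffs[OF sm(2) u0, where ?f1.0 = "\<lambda>u. beta u * a u"
        and ?f2.0 = "\<lambda>u. deriv beta u * a u - beta u * ell u * b u"
        and ?f3.0 = "\<lambda>u. deriv (deriv beta) u * a u - 2 * deriv beta u * ell u * b u - beta u * deriv ell u * b u
      - beta u * (ell u)\<^sup>2 * a u"], goal_cases)
    case (1 u) then show ?case using d(2) by blast
  next
    case (2 u) show ?case
      by (rule derivative_eq_intros d[OF 2(2)] refl)+ (simp add: algebra_simps)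
  next
    case (3 u) show ?case
      by (rule derivative_eq_intros d[OF 3(2)] refl)+ (simp add: algebra_simps power2_eq_square)
  qed
  show ?thesis using that[OF cx(1) cz(1)] cx cz by simp
qed

section \<open>Classification of the curve from its polar radius and angle\<close>

text \<open>\<open>\<xi>\<close> is a signed polar radius and \<open>\<zeta>\<close> the angle.
  \<open>cx 0 = cx 1 = 0\<close> gives the curve zero velocity at 0 whatever the angle does, which
  is what the invariance of the orders requires.\<close>

locale polar_curve =
  fixes \<xi> \<zeta> :: "real \<Rightarrow> real" and J :: "real set" and cx cz :: "nat \<Rightarrow> real"
  assumes \<xi>: "smooth_on J \<xi>" and \<zeta>: "smooth_on J \<zeta>" and J: "0 \<in> J"
    and cx: "expansion \<xi> cx" "cx 0 = 0" "cx 1 = 0" and cz: "expansion \<zeta> cz" "cz 0 = 0"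
begin

definition "X t = \<xi> t * cos (\<zeta> t)"
definition "Y t = \<xi> t * sin (\<zeta> t)"

lemma smooth_X: "smooth_on J X" and smooth_Y: "smooth_on J Y"
  unfolding X_def[abs_def] Y_def[abs_def] by (intro smooth_on_intros \<xi> \<zeta>; simp)+

lemma bigo_\<xi>: "(\<And>n. n < p \<Longrightarrow> cx n = 0) \<Longrightarrow> \<xi> \<in> O[at 0](\<lambda>t. t ^ p)"
  using expansion_bigo_iff[OF cx(1)] by blast

lemma bigo_\<zeta>: "(\<And>n. n < m \<Longrightarrow> cz n = 0) \<Longrightarrow> \<zeta> \<in> O[at 0](\<lambda>t. t ^ m)"
  using expansion_bigo_iff[OF cz(1)] by blast

lemma \<zeta>_0: "\<zeta> 0 = 0"
  using expansion_at_0[OF \<zeta> J cz(1)] cz(2) by simp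

lemma tendsto_\<zeta>: "(\<zeta> \<longlongrightarrow> 0) (at 0)"
  using smooth_on_imp_continuous_on[OF \<zeta>] smooth_on_imp_open[OF \<zeta>] J \<zeta>_0
  by (metis continuous_on_eq_continuous_at isCont_def)

lemma bigo_X: "\<xi> \<in> O[at 0](\<lambda>t. t ^ p) \<Longrightarrow> X \<in> O[at 0](\<lambda>t. t ^ p)"
  unfolding X_def[abs_def] by (rule landau_o.big_1_mult) (auto intro!: bigoI[of _ 1])

lemma bigo_sin_\<zeta>: "\<zeta> \<in> O[at 0](\<lambda>t. t ^ m) \<Longrightarrow> (\<lambda>t. sin (\<zeta> t)) \<in> O[at 0](\<lambda>t. t ^ m)"
  by (rule landau_o.big_trans[of _ _ \<zeta>]) (auto intro!: bigoI[of _ 1] always_eventually abs_sin_x_le_abs_x)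

lemma bigo_Y: "\<xi> \<in> O[at 0](\<lambda>t. t ^ p) \<Longrightarrow> \<zeta> \<in> O[at 0](\<lambda>t. t ^ m) \<Longrightarrow> Y \<in> O[at 0](\<lambda>t. t ^ (p + m))"
  unfolding Y_def[abs_def] power_add by (intro landau_o.big.mult bigo_sin_\<zeta>)

lemma bigo_Y': "\<xi> \<in> O[at 0](\<lambda>t. t ^ p) \<Longrightarrow> Y \<in> O[at 0](\<lambda>t. t ^ p)"
  using bigo_Y[of p 0] bigo_\<zeta>[of 0] by simp

lemma sin_minus_ident: "\<zeta> \<in> O[at 0](\<lambda>t. t ^ m) \<Longrightarrow> (\<lambda>t. sin (\<zeta> t) - \<zeta> t) \<in> O[at 0](\<lambda>t. t ^ (3 * m))"
proof -
  assume *: "\<zeta> \<in> O[at 0](\<lambda>t. t ^ m)"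
  have "\<bar>sin y - y\<bar> \<le> \<bar>y\<bar> ^ 3" for y :: real
    using Maclaurin_sin_bound[of y 3] by (simp add: eval_nat_numeral sin_coeff_def) argo
  then have "(\<lambda>t. sin (\<zeta> t) - \<zeta> t) \<in> O[at 0](\<lambda>t. \<zeta> t ^ 3)"
    by (intro bigoI[of _ 1]) (simp add: power_abs)
  also have "(\<lambda>t. \<zeta> t ^ 3) \<in> O[at 0](\<lambda>t. (t ^ m) ^ 3)" by (rule landau_o.big_power[OF *])
  finally show ?thesis by (simp add: power_mult[symmetric] mult.commute)
qed

lemma lim_X: "(\<And>n. n < p \<Longrightarrow> cx n = 0) \<Longrightarrow> ((\<lambda>t. X t / t ^ p) \<longlongrightarrow> cx p) (at 0)"
  using tendsto_mult[OF expansion_leading[OF cx(1)] tendsto_cos[OF tendsto_\<zeta>], of p] by (simp add: X_def)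

lemma lim_sin_\<zeta>:
  assumes "\<And>n. n < m \<Longrightarrow> cz n = 0" and "m > 0"
  shows "((\<lambda>t. sin (\<zeta> t) / t ^ m) \<longlongrightarrow> cz m) (at 0)"
proof -
  have "(\<lambda>t. sin (\<zeta> t) - \<zeta> t) \<in> O[at 0](\<lambda>t. t ^ Suc m)"
    by (rule bigo_power_weaken[OF sin_minus_ident[OF bigo_\<zeta>[of m]]]) (use assms in auto)
  moreover have "((\<lambda>t. \<zeta> t / t ^ m) \<longlongrightarrow> cz m) (at 0)" using expansion_leading[OF cz(1)] assms(1) by blast
  ultimately show ?thesis
    using tendsto_add[OF _ bigo_Suc_imp_tendsto_0, of "\<lambda>t. \<zeta> t / t ^ m" "cz m" "\<lambda>t. sin (\<zeta> t) - \<zeta> t" m]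
    by (simp add: diff_divide_distrib)
qed

lemma lim_Y:
  assumes "\<And>n. n < p \<Longrightarrow> cx n = 0" "\<And>n. n < m \<Longrightarrow> cz n = 0" "m > 0"
  shows "((\<lambda>t. Y t / t ^ (p + m)) \<longlongrightarrow> cx p * cz m) (at 0)"
proof -
  have "((\<lambda>t. \<xi> t / t ^ p) \<longlongrightarrow> cx p) (at 0)" using expansion_leading[OF cx(1)] assms(1) by blast
  moreover have "((\<lambda>t. sin (\<zeta> t) / t ^ m) \<longlongrightarrow> cz m) (at 0)" using lim_sin_\<zeta> assms(2,3) by blast
  ultimately show ?thesis using tendsto_mult by (fastforce simp: Y_def power_add)
qed

text \<open>With \<open>q = cz 2 / cx 2\<close> one has \<open>Y - q X\<^sup>2 = \<xi> * (sin
  \<zeta> - q * \<xi> * (cos \<zeta>)\<^sup>2)\<close>. The choice of \<open>q\<close> makes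
  \<open>\<zeta> - q * \<xi>\<close> start in degree 3, while \<open>sin \<zeta> - \<zeta>\<close>
  and \<open>\<xi> * (sin \<zeta>)\<^sup>2\<close> start in degree at least 6.\<close>

lemma lim_Y_shear:
  assumes "cz 1 = 0" "cx 2 \<noteq> 0"
  shows "((\<lambda>t. (Y t - cz 2 / cx 2 * (X t)\<^sup>2) / t ^ 5) \<longlongrightarrow> cx 2 * cz 3 - cz 2 * cx 3) (at 0)"
proof -
  define q where "q = cz 2 / cx 2"
  have c2: "cx n = 0" "cz n = 0" if "n < 2" for n using that cx(2,3) cz(2) assms(1) by (auto simp: less_2_cases_iff)
  have \<xi>O: "\<xi> \<in> O[at 0](\<lambda>t. t ^ 2)" and \<zeta>O: "\<zeta> \<in> O[at 0](\<lambda>t. t ^ 2)" using bigo_\<xi> bigo_\<zeta> c2 by auto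
  have "expansion (\<lambda>t. \<zeta> t - q * \<xi> t) (\<lambda>n. cz n - q * cx n)" by (intro expansion_diff expansion_cmult cx cz)
  moreover have "cz n - q * cx n = 0" if "n < 3" for n
    using that c2[of n] assms(2) by (cases "n = 2") (auto simp: q_def)
  ultimately have 1: "((\<lambda>t. (\<zeta> t - q * \<xi> t) / t ^ 3) \<longlongrightarrow> cz 3 - q * cx 3) (at 0)" by (rule expansion_leading)
  have a: "(\<lambda>t. sin (\<zeta> t) - \<zeta> t) \<in> O[at 0](\<lambda>t. t ^ Suc 3)"
    by (rule bigo_power_weaken[OF sin_minus_ident[OF \<zeta>O]]) simp
  have b: "(\<lambda>t. q * (\<xi> t * (sin (\<zeta> t) * sin (\<zeta> t)))) \<in> O[at 0](\<lambda>t. t ^ Suc 3)"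
  proof -
    have "(\<lambda>t. \<xi> t * (sin (\<zeta> t) * sin (\<zeta> t))) \<in> O[at 0](\<lambda>t. t ^ 2 * (t ^ 2 * t ^ 2))"
      by (intro landau_o.big.mult bigo_sin_\<zeta> \<xi>O \<zeta>O)
    then have "(\<lambda>t. \<xi> t * (sin (\<zeta> t) * sin (\<zeta> t))) \<in> O[at 0](\<lambda>t. t ^ 6)" by (simp flip: power_add)
    from bigo_power_weaken[OF this, of "Suc 3"] show ?thesis by simp
  qed
  from tendsto_add[OF 1 bigo_Suc_imp_tendsto_0[OF sum_in_bigo(1)[OF a b]]]
  have "((\<lambda>t. (sin (\<zeta> t) - q * (\<xi> t * (1 - (sin (\<zeta> t))\<^sup>2))) / t ^ 3) \<longlongrightarrow> cz 3 - q * cx 3) (at 0)"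
    by (simp add: add_divide_distrib[symmetric] algebra_simps power2_eq_square)
  from tendsto_mult[OF expansion_leading[OF cx(1) c2(1), of 2] this]
  have "((\<lambda>t. \<xi> t / t ^ 2 * ((sin (\<zeta> t) - q * (\<xi> t * (cos (\<zeta> t))\<^sup>2)) / t ^ 3)) \<longlongrightarrow> cx 2 * (cz 3 - q * cx 3)) (at 0)"
    by (simp only: cos_squared_eq)
  moreover have "\<xi> t / t ^ 2 * ((sin (\<zeta> t) - q * (\<xi> t * (cos (\<zeta> t))\<^sup>2)) / t ^ 3) = (Y t - q * (X t)\<^sup>2) / t ^ 5" for t
  proof -
    have "\<xi> t / t ^ 2 * ((sin (\<zeta> t) - q * (\<xi> t * (cos (\<zeta> t))\<^sup>2)) / t ^ 3) =
      (\<xi> t * (sin (\<zeta> t) - q * (\<xi> t * (cos (\<zeta> t))\<^sup>2))) / (t ^ 2 * t ^ 3)" by simp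
    also have "t ^ 2 * t ^ 3 = t ^ 5" by (simp flip: power_add)
    finally show ?thesis by (simp add: X_def Y_def algebra_simps power2_eq_square)
  qed
  moreover have "cx 2 * (cz 3 - q * cx 3) = cx 2 * cz 3 - cz 2 * cx 3"
    using assms(2) by (simp add: q_def algebra_simps)
  ultimately show ?thesis by (simp only: q_def)
qed

lemma \<xi>_bigo_2: "\<xi> \<in> O[at 0](\<lambda>t. t ^ 2)"
  by (rule bigo_\<xi>) (use cx(2,3) in \<open>auto simp: less_2_cases_iff\<close>)

lemma derivative_0:
  assumes "smooth_on J F" "F \<in> O[at 0](\<lambda>t. t ^ 2)"
  shows "(F has_real_derivative 0) (at 0)" "F 0 = 0"
proof -
  obtain c where c: "expansion F c" using smooth_on_expansion_deriv[OF assms(1) J] by blast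
  show F0: "F 0 = 0" using expansion_at_0[OF assms(1) J c] expansion_bigo[OF c assms(2), of 0] by simp
  have "((\<lambda>t. F t / t ^ 1) \<longlongrightarrow> 0) (at 0)" using bigo_Suc_imp_tendsto_0[of F 1] assms(2) by (simp add: numeral_2_eq_2)
  then show "(F has_real_derivative 0) (at 0)" by (simp add: DERIV_def F0)
qed

lemma orders_eq:
  assumes "A_equiv (cylinder (\<lambda>t. (X t, Y t))) (0, 0) (cylinder (\<lambda>t. (t ^ i, t ^ j))) (0, 0)" "i \<ge> 2" "j \<ge> 2"
  shows "orders (\<lambda>t. (X t, Y t)) = orders (\<lambda>t. (t ^ i, t ^ j))"
  using orders_eq_if_cusp_edge[OF assms] derivative_0[OF smooth_X bigo_X[OF \<xi>_bigo_2]]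
    derivative_0[OF smooth_Y bigo_Y'[OF \<xi>_bigo_2]] by blast

lemma bigtheta_X: "(\<And>n. n < p \<Longrightarrow> cx n = 0) \<Longrightarrow> cx p \<noteq> 0 \<Longrightarrow> X \<in> \<Theta>[at 0](\<lambda>t. t ^ p)"
  by (rule bigthetaI_tendsto[OF _ lim_X])

lemma cuspI:
  assumes "(i, j) \<in> {(2, 3), (2, 5), (3, 4), (3, 5)}" "j = i + m" "m > 0"
    and "\<And>n. n < i \<Longrightarrow> cx n = 0" "cx i \<noteq> 0" "\<And>n. n < m \<Longrightarrow> cz n = 0" "cz m \<noteq> 0"
  shows "A_equiv (cylinder (\<lambda>t. (X t, Y t))) (0, 0) (cylinder (\<lambda>t. (t ^ i, t ^ j))) (0, 0)"
proof (rule A_equiv_cylinder, rule curve_normal_form[OF smooth_X smooth_Y J assms(1)])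
  show "((\<lambda>t. X t / t ^ i) \<longlongrightarrow> cx i) (at 0)" using lim_X assms(4) by blast
  show "((\<lambda>t. Y t / t ^ j) \<longlongrightarrow> cx i * cz m) (at 0)" unfolding assms(2) using lim_Y assms(3,4,6) by blast
qed (use assms in auto)

definition cusp :: "nat \<Rightarrow> nat \<Rightarrow> bool" where
  "cusp i j \<longleftrightarrow> A_equiv (cylinder (\<lambda>t. (X t, Y t))) (0, 0) (cylinder (\<lambda>t. (t ^ i, t ^ j))) (0, 0)"

abbreviation "ord \<equiv> orders (\<lambda>t. (X t, Y t))"

text \<open>Any two of the four right-hand sides contradict each other, so establishing one type
  excludes the other three.\<close>

lemma ord_cusp:
  "cusp 2 3 \<Longrightarrow> 2 \<in> ord \<and> 3 \<in> ord"
  "cusp 2 5 \<Longrightarrow> 2 \<in> ord \<and> 3 \<notin> ord \<and> 5 \<in> ord"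
  "cusp 3 4 \<Longrightarrow> 2 \<notin> ord \<and> 3 \<in> ord \<and> 4 \<in> ord"
  "cusp 3 5 \<Longrightarrow> 2 \<notin> ord \<and> 3 \<in> ord \<and> 4 \<notin> ord \<and> 5 \<in> ord"
  using orders_eq[of 2 3] orders_eq[of 2 5] orders_eq[of 3 4] orders_eq[of 3 5] orders_models
  unfolding cusp_def by auto

text \<open>Each of the four types has 2 or 3 among its orders, so none of them occurs here.\<close>

lemma ord_if_bigo_4:
  assumes "cx 2 = 0" "cx 3 = 0"
  shows "2 \<notin> ord" "3 \<notin> ord"
proof -
  have "cx n = 0" if "n < 4" for n
    using that assms cx(2,3) by (auto simp: eval_nat_numeral less_Suc_eq)
  then have "\<xi> \<in> O[at 0](\<lambda>t. t ^ 4)" by (rule bigo_\<xi>)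
  from orders_ge[OF _ _ bigo_X[OF this] bigo_Y'[OF this]] show "2 \<notin> ord" "3 \<notin> ord" by force+
qed

lemma cx_less_3: "cx 2 = 0 \<Longrightarrow> n < 3 \<Longrightarrow> cx n = 0"
  using cx(2,3) by (auto simp: eval_nat_numeral less_Suc_eq)

lemma cx_less_2: "n < 2 \<Longrightarrow> cx n = 0"
  using cx(2,3) by (auto simp: less_2_cases_iff)

lemma cz_less_2: "cz 1 = 0 \<Longrightarrow> n < 2 \<Longrightarrow> cz n = 0"
  using cz(2) by (auto simp: less_2_cases_iff)

text \<open>If \<open>cx 2\<close> is zero, radius and angle both vanish to order 3 and
  \<open>Y\<close> to order 6, so among 2, 3, 4, 5 at most 3 is an order and no type fits. If
  \<open>cx 2\<close> is nonzero, 2 is an order and 3 is not, which leaves only exponents (2, 5);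
  the coefficient \<open>\<kappa>\<close> of \<open>t ^ 5\<close> after the shear decides,
  sufficiency by the normal form and necessity because 5 is no order when it vanishes.\<close>

lemma cusp_both_quadratic:
  assumes z1: "cz 1 = 0" and z2: "cx 2 = 0 \<Longrightarrow> cz 2 = 0"
  shows "(cusp 2 5 \<longleftrightarrow> cx 2 \<noteq> 0 \<and> cx 2 * cz 3 - cz 2 * cx 3 \<noteq> 0) \<and> \<not> cusp 2 3 \<and> \<not> cusp 3 4 \<and> \<not> cusp 3 5"
proof (cases "cx 2 = 0")
  case True
  have c3: "cx n = 0" "cz n = 0" if "n < 3" for n
    using that True z2 cx(2,3) cz(2) z1 by (auto simp: eval_nat_numeral less_Suc_eq)
  have O: "\<xi> \<in> O[at 0](\<lambda>t. t ^ 3)" "\<zeta> \<in> O[at 0](\<lambda>t. t ^ 3)" using bigo_\<xi> bigo_\<zeta> c3 by auto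
  have 2: "2 \<notin> ord" using orders_ge[OF _ _ bigo_X[OF O(1)] bigo_Y'[OF O(1)], of 2] by auto
  have "3 \<notin> ord \<or> (4 \<notin> ord \<and> 5 \<notin> ord)"
  proof (cases "cx 3 = 0")
    case False
    have "X \<in> \<Theta>[at 0](\<lambda>t. t ^ 3)" using bigtheta_X[of 3] c3 False by blast
    from orders_lt[OF _ _ this bigo_Y[OF O], of 4 6] orders_lt[OF _ _ this bigo_Y[OF O], of 5 6] show ?thesis by auto
  qed (use True ord_if_bigo_4 in auto)
  then show ?thesis using True 2 ord_cusp by blast
next
  case False
  have X: "X \<in> \<Theta>[at 0](\<lambda>t. t ^ 2)" using bigtheta_X[of 2] cx_less_2 False by blast
  have O: "\<zeta> \<in> O[at 0](\<lambda>t. t ^ 2)" using bigo_\<zeta> cz_less_2[OF z1] by blast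
  have 2: "2 \<in> ord" using fst_order[OF X] .
  have 3: "3 \<notin> ord" using orders_lt[OF _ _ X bigo_Y[OF \<xi>_bigo_2 O], of 3 4] by auto
  define q where "q = cz 2 / cx 2"
  define \<kappa> where "\<kappa> = cx 2 * cz 3 - cz 2 * cx 3"
  have lim: "((\<lambda>t. (Y t - q * (X t)\<^sup>2) / t ^ 5) \<longlongrightarrow> \<kappa>) (at 0)"
    using lim_Y_shear[OF z1 False] by (simp add: q_def \<kappa>_def)
  have sm: "smooth_on J (\<lambda>t. Y t - q * (X t)\<^sup>2)"
    by (intro smooth_on_intros smooth_X smooth_Y smooth_on_imp_open[OF \<xi>])
  have "cusp 2 5 \<longleftrightarrow> \<kappa> \<noteq> 0"
  proof
    assume c: "cusp 2 5"
    show "\<kappa> \<noteq> 0"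
    proof
      assume "\<kappa> = 0"
      with lim have "(\<lambda>t. Y t - q * (X t)\<^sup>2) \<in> O[at 0](\<lambda>t. t ^ Suc 5)"
        by (intro smooth_on_bigo_Suc[OF sm J]) simp
      then have "5 \<notin> ord" by (intro five_notin_orders[OF X]) simp
      with ord_cusp(2)[OF c] show False by blast
    qed
  next
    have limX: "((\<lambda>t. X t / t ^ 2) \<longlongrightarrow> cx 2) (at 0)" by (intro lim_X cx_less_2)
    assume "\<kappa> \<noteq> 0"
    then have "A_equiv (\<lambda>t. (X t, Y t - q * (X t)\<^sup>2)) 0 (\<lambda>t. (t ^ 2, t ^ 5)) 0"
      by (intro curve_normal_form[OF smooth_X sm J _ limX False lim]) simp_all
    then show "cusp 2 5" unfolding cusp_def by (rule A_equiv_cylinder[OF A_equiv_trans[OF A_equiv_shear]])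
  qed
  then show ?thesis using False 2 3 ord_cusp by (auto simp: \<kappa>_def)
qed

text \<open>The angle has order 1, so \<open>Y\<close> vanishes to exactly one order more than
  \<open>X\<close> and the type is read off from the order of the radius.\<close>

lemma cusp_regular_angle:
  assumes z1: "cz 1 \<noteq> 0"
  shows "(cusp 2 3 \<longleftrightarrow> cx 2 \<noteq> 0) \<and> (cusp 3 4 \<longleftrightarrow> cx 2 = 0 \<and> cx 3 \<noteq> 0) \<and> \<not> cusp 2 5 \<and> \<not> cusp 3 5"
proof -
  have z0: "cz n = 0" if "n < 1" for n using that cz(2) by simp
  consider "cx 2 \<noteq> 0" | "cx 2 = 0" "cx 3 \<noteq> 0" | "cx 2 = 0" "cx 3 = 0" by blast
  then show ?thesis
  proof cases
    case 1
    have "cusp 2 3" unfolding cusp_def by (rule cuspI[where m = 1]) (use 1 cx_less_2 z0 z1 in auto)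
    then show ?thesis using 1 ord_cusp by blast
  next
    case 2
    have c: "cusp 3 4" unfolding cusp_def by (rule cuspI[where m = 1]) (use 2 cx_less_3 z0 z1 in auto)
    then show ?thesis using 2 ord_cusp by blast
  next
    case 3
    then show ?thesis using ord_if_bigo_4 ord_cusp by blast
  qed
qed

text \<open>The angle has order at least 2 and the radius order at least 3. If the radius has order
  exactly 3, the assumption \<open>z2\<close> makes the angle have order exactly 2, whence the
  exponents 3 and 3 + 2.\<close>

lemma cusp_cubic:
  assumes z1: "cz 1 = 0" and x2: "cx 2 = 0" and z2: "cx 3 \<noteq> 0 \<Longrightarrow> cz 2 \<noteq> 0"
  shows "(cusp 3 5 \<longleftrightarrow> cx 3 \<noteq> 0) \<and> \<not> cusp 2 3 \<and> \<not> cusp 2 5 \<and> \<not> cusp 3 4"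
proof (cases "cx 3 = 0")
  case True
  then show ?thesis using x2 ord_if_bigo_4 ord_cusp by blast
next
  case False
  have "cusp 3 5" unfolding cusp_def
    by (rule cuspI[where m = 2]) (use False z2 cx_less_3[OF x2] cz_less_2[OF z1] in auto)
  then show ?thesis using False ord_cusp by blast
qed

end

theorem theorem4p3:
  fixes I :: "real set" and x z a b :: "real \<Rightarrow> real" and u0 lam :: real
  assumes leg: "legendre_curve I x z a b"
    and u0: "u0 \<in> I" and x0: "x u0 = 0" and lam: "lam \<noteq> 0"
  defines "r \<equiv> (\<lambda>(u, v). (x u * cos v, x u * sin v, z u + lam * v))"
    and "ell \<equiv> leg_ell a b" and "beta \<equiv> leg_beta x z a b"
  shows
    "(beta u0 = 0 \<and> b u0 \<noteq> 0 \<longrightarrow> (\<forall>v.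
        (cusp_edge 2 5 r (u0, v) \<longleftrightarrow> deriv beta u0 * ell u0 \<noteq> 0) \<and>
        \<not> cusp_edge 2 3 r (u0, v) \<and> \<not> cusp_edge 3 4 r (u0, v) \<and> \<not> cusp_edge 3 5 r (u0, v)))
   \<and> (beta u0 \<noteq> 0 \<and> b u0 = 0 \<longrightarrow> (\<forall>v.
        (cusp_edge 2 3 r (u0, v) \<longleftrightarrow> ell u0 \<noteq> 0) \<and>
        (cusp_edge 3 4 r (u0, v) \<longleftrightarrow> ell u0 = 0 \<and> deriv ell u0 \<noteq> 0) \<and>
        \<not> cusp_edge 2 5 r (u0, v) \<and> \<not> cusp_edge 3 5 r (u0, v)))
   \<and> (beta u0 = 0 \<and> b u0 = 0 \<longrightarrow> (\<forall>v.
        (cusp_edge 3 5 r (u0, v) \<longleftrightarrow> deriv beta u0 * ell u0 \<noteq> 0) \<and>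
        \<not> cusp_edge 2 3 r (u0, v) \<and> \<not> cusp_edge 2 5 r (u0, v) \<and> \<not> cusp_edge 3 4 r (u0, v)))"
proof -
  have sm: "smooth_on I x" "smooth_on I z" and ab: "(a u0)\<^sup>2 + (b u0)\<^sup>2 = 1"
    using leg u0 by (auto simp: legendre_curve_def)
  obtain cx cz where cx: "expansion (\<lambda>t. x (t + u0)) cx" and cz: "expansion (\<lambda>t. z (t + u0)) cz"
    and x: "cx 0 = x u0" "cx 1 = - (beta u0 * b u0)" "cx 2 = - (deriv beta u0 * b u0 + beta u0 * ell u0 * a u0) / 2"
      "cx 3 = - (deriv (deriv beta) u0 * b u0 + 2 * deriv beta u0 * ell u0 * a u0 + beta u0 * deriv ell u0 * a u0
        - beta u0 * (ell u0)\<^sup>2 * b u0) / 6"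
    and z: "cz 0 = z u0" "cz 1 = beta u0 * a u0" "cz 2 = (deriv beta u0 * a u0 - beta u0 * ell u0 * b u0) / 2"
      "cz 3 = (deriv (deriv beta) u0 * a u0 - 2 * deriv beta u0 * ell u0 * b u0 - beta u0 * deriv ell u0 * b u0
        - beta u0 * (ell u0)\<^sup>2 * a u0) / 6"
    by (rule legendre_taylor[OF leg u0, folded ell_def beta_def]) (rule that)
  define \<xi> where "\<xi> = (\<lambda>t. x (t + u0))"
  define \<zeta> where "\<zeta> = (\<lambda>t. (z (t + u0) - z u0) / lam)"
  define J where "J = (\<lambda>t. t + u0) -` I"
  define dz where "dz = (\<lambda>n. 1 / lam * (cz n - (if n = 0 then z u0 else 0)))"
  have dz: "expansion \<zeta> dz"
    using expansion_cmult[OF expansion_diff[OF cz expansion_const], of "1 / lam" "z u0"] by (simp add: \<zeta>_def dz_def)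
  \<comment> \<open>The premise holds in all three cases; it says that the derivative of
    \<open>x\<close> vanishes at \<open>u0\<close>, that is \<open>cx 1 = 0\<close>.\<close>
  have pc: "polar_curve \<xi> \<zeta> J cx dz" if "beta u0 * b u0 = 0"
  proof
    show "smooth_on J \<xi>" "smooth_on J \<zeta>" unfolding J_def \<xi>_def \<zeta>_def
      by (intro smooth_on_shift sm smooth_on_divide_const smooth_on_diff smooth_on_const
          smooth_on_imp_open[OF smooth_on_shift[OF sm(1)]])+
  qed (use u0 that x z x0 cx dz in \<open>auto simp: J_def \<xi>_def dz_def\<close>)
  have edge: "cusp_edge i j r (u0, v) \<longleftrightarrow> polar_curve.cusp \<xi> \<zeta> i j" if "beta u0 * b u0 = 0" for i j v
  proof -
    note pc = pc[OF that]
    have "A_equiv r (u0, v) (cylinder (\<lambda>t. (polar_curve.X \<xi> \<zeta> t, polar_curve.Y \<xi> \<zeta> t))) (0, 0)"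
      unfolding polar_curve.X_def[OF pc] polar_curve.Y_def[OF pc] unfolding r_def \<xi>_def \<zeta>_def
      by (rule helicoid_equiv_cylinder[OF sm u0 lam])
    then show ?thesis unfolding cusp_edge_iff_cylinder polar_curve.cusp_def[OF pc]
      using A_equiv_trans A_equiv_sym by blast
  qed
  have I: "(cusp_edge 2 5 r (u0, v) \<longleftrightarrow> deriv beta u0 * ell u0 \<noteq> 0) \<and>
      \<not> cusp_edge 2 3 r (u0, v) \<and> \<not> cusp_edge 3 4 r (u0, v) \<and> \<not> cusp_edge 3 5 r (u0, v)"
    if h: "beta u0 = 0" "b u0 \<noteq> 0" for v
  proof -
    have bb: "beta u0 * b u0 = 0" using h by simp
    \<comment> \<open>For \<open>beta u0 = 0\<close> the terms with the second derivative of
      \<open>beta\<close> cancel in this minor, and those with \<open>ell\<close> combine to the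
      squared norm of \<open>(a, b)\<close>, which is 1.\<close>
    have "cx 2 * dz 3 - dz 2 * cx 3 = (deriv beta u0)\<^sup>2 * ell u0 * ((a u0)\<^sup>2 + (b u0)\<^sup>2) / (6 * lam)"
      using lam by (simp add: x z dz_def h field_simps power2_eq_square)
    then have "cx 2 \<noteq> 0 \<and> cx 2 * dz 3 - dz 2 * cx 3 \<noteq> 0 \<longleftrightarrow> deriv beta u0 * ell u0 \<noteq> 0"
      using h lam ab x(3) by auto
    then show ?thesis unfolding edge[OF bb]
      using polar_curve.cusp_both_quadratic[OF pc[OF bb]] h x(3) z(2,3) by (simp add: dz_def)
  qed
  have II: "(cusp_edge 2 3 r (u0, v) \<longleftrightarrow> ell u0 \<noteq> 0) \<and>
      (cusp_edge 3 4 r (u0, v) \<longleftrightarrow> ell u0 = 0 \<and> deriv ell u0 \<noteq> 0) \<and>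
      \<not> cusp_edge 2 5 r (u0, v) \<and> \<not> cusp_edge 3 5 r (u0, v)"
    if h: "beta u0 \<noteq> 0" "b u0 = 0" for v
  proof -
    have bb: "beta u0 * b u0 = 0" using h by simp
    have a0: "a u0 \<noteq> 0" using ab h by auto
    \<comment> \<open>With \<open>b u0 = 0\<close> the quadratic coefficient is
      \<open>- beta * ell * a / 2\<close>, and once \<open>ell u0 = 0\<close> the cubic one is
      \<open>- beta * deriv ell * a / 6\<close>; both \<open>beta\<close> and \<open>a\<close> are
      nonzero at \<open>u0\<close>.\<close>
    have "cx 2 \<noteq> 0 \<longleftrightarrow> ell u0 \<noteq> 0" "cx 2 = 0 \<and> cx 3 \<noteq> 0 \<longleftrightarrow> ell u0 = 0 \<and> deriv ell u0 \<noteq> 0" "dz 1 \<noteq> 0"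
      using h a0 lam z(2) by (auto simp: x(3,4) dz_def)
    then show ?thesis unfolding edge[OF bb] using polar_curve.cusp_regular_angle[OF pc[OF bb]] by simp
  qed
  have III: "(cusp_edge 3 5 r (u0, v) \<longleftrightarrow> deriv beta u0 * ell u0 \<noteq> 0) \<and>
      \<not> cusp_edge 2 3 r (u0, v) \<and> \<not> cusp_edge 2 5 r (u0, v) \<and> \<not> cusp_edge 3 4 r (u0, v)"
    if h: "beta u0 = 0" "b u0 = 0" for v
  proof -
    have bb: "beta u0 * b u0 = 0" using h by simp
    have a0: "a u0 \<noteq> 0" using ab h by auto
    \<comment> \<open>Here \<open>cx 3 = - deriv beta * ell * a / 3\<close> and
      \<open>dz 2 = deriv beta * a / (2 * lam)\<close> at \<open>u0\<close>, so the factor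
      \<open>deriv beta\<close> is common and the first being nonzero forces the second to
      be.\<close>
    have "cx 3 \<noteq> 0 \<longleftrightarrow> deriv beta u0 * ell u0 \<noteq> 0" "dz 1 = 0" "cx 2 = 0" "cx 3 \<noteq> 0 \<Longrightarrow> dz 2 \<noteq> 0"
      using h a0 lam z(2) by (auto simp: x(3,4) z(3) dz_def)
    then show ?thesis unfolding edge[OF bb] using polar_curve.cusp_cubic[OF pc[OF bb]] by simp
  qed
  show ?thesis using I II III by blast
qed

end
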